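(* Fix constants $R^\star,\varepsilon_\circ,\eta_\circ,B>0$. There exists $n_0=n_0(\varepsilon_\circ,\eta_\circ,R^\star,B)$ such that for every $n\ge n_0$ there exist a rate $R\le R^\star+\varepsilon_\circ$, an encoder $f:\mathbb R^n\times\mathbb S^n_+\times[0,1]\to\{1,\dots,\lfloor2^{nR}\rfloor\}$ and a decoder $g:\{1,\dots,\lfloor2^{nR}\rfloor\}\times[0,1]\to\mathbb R^n$ such that the following holds. For every fixed $\Sigma\in\mathbb S^n_+$ with $\mathrm{tr}\,\Sigma=n$, letting $S\sim\mathrm{Unif}[0,1]$, $W\sim\mathcal N(0,I_n)$ independent of $S$, and $\widehat W=g(f(W,\Sigma,S),S)$, $$\Pr_S\Big[\tfrac1n\mathbb E_W\big[d_\Sigma(W,\widehat W)\big]\le\mathbf D_{\mathrm{rc}}(\mathrm{spec}(\Sigma),R^\star)+\eta_\circ\Big]\ \ge\ 1-\exp(-n^B).$$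
   Context: $\mathbb S^n_+$ is the set of positive semidefinite $n\times n$ matrices; $\mathrm{spec}(\Sigma)\in\mathbb R^n_{\ge0}$ is the vector of eigenvalues of $\Sigma$. For $w,\hat w\in\mathbb R^n$, $d_\Sigma(w,\hat w)=(w-\hat w)^\top\Sigma(w-\hat w)$. Logarithms are base 2. For $\lambda\in\mathbb R^n_{\ge0}$, $\lambda\neq0$, and $R>0$, let $T^\lambda_{\mathrm{rc}}(R)$ be the unique $T>0$ with $\frac1{2n}\sum_{i=1}^n\log(1+\lambda_iT)=R$, and define $\mathbf D_{\mathrm{rc}}(\lambda,R)=\frac1n\sum_{i=1}^n\frac{\lambda_i}{1+\lambda_iT^\lambda_{\mathrm{rc}}(R)}$. The expectation $\mathbb E_W$ is over $W$ only, with $S$ fixed. *)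

theory Defs
  imports "HOL-Probability.Probability" "Jordan_Normal_Form.Char_Poly"
begin

definition psd_mats :: "nat \<Rightarrow> real mat set" where
  "psd_mats n = {A. A \<in> carrier_mat n n \<and> transpose_mat A = A \<and>
      (\<forall>v \<in> carrier_vec n. 0 \<le> v \<bullet> (A *\<^sub>v v))}"

definition mat_trace :: "real mat \<Rightarrow> real" where
  "mat_trace A = (\<Sum>i<dim_row A. A $$ (i,i))"

text \<open>Spectrum: the multiset of eigenvalues (with multiplicity), i.e. of the roots of the
  characteristic polynomial, which splits over the reals for symmetric matrices.\<close>
definition spec :: "real mat \<Rightarrow> real multiset" where
  "spec A = (SOME M. size M = dim_row A \<and>
      char_poly A = (\<Prod>a\<in>#M. [:- a, 1:]))"

text \<open>Vectors of R^n are functions nat => real (only coordinates i < n matter).\<close>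
definition d_Sigma :: "real mat \<Rightarrow> (nat \<Rightarrow> real) \<Rightarrow> (nat \<Rightarrow> real) \<Rightarrow> real" where
  "d_Sigma A w w' = (\<Sum>i<dim_row A. \<Sum>j<dim_row A. (w i - w' i) * A $$ (i,j) * (w j - w' j))"

definition T_rc :: "real multiset \<Rightarrow> real \<Rightarrow> real" where
  "T_rc lam R = (THE T. T > 0 \<and>
      (1 / (2 * real (size lam))) * (\<Sum>l\<in>#lam. log 2 (1 + l * T)) = R)"

definition D_rc :: "real multiset \<Rightarrow> real \<Rightarrow> real" where
  "D_rc lam R = (1 / real (size lam)) * (\<Sum>l\<in>#lam. l / (1 + l * T_rc lam R))"

definition gauss :: "nat \<Rightarrow> (nat \<Rightarrow> real) measure" where
  "gauss n = PiM {..<n} (\<lambda>_. std_normal_distribution)"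

definition unif01 :: "real measure" where
  "unif01 = uniform_measure lborel {0..1}"

end

theory Submission
  imports Defs "HOL-Real_Asymp.Real_Asymp"
begin

text \<open>
  Diagonalise \<open>\<Sigma> = U\<^sup>T diag(\<lambda>) U\<close> and put \<open>x\<^sub>i = \<lambda>\<^sub>i T / (1 + \<lambda>\<^sub>i T)\<close>. For an isotropic Gaussian
  codebook of variance \<open>\<tau>\<^sup>2\<close>, tilting the codeword distribution by \<open>exp (- T d / (2 \<tau>\<^sup>2))\<close> gives a product
  Gaussian in the eigenbasis, under which the distortion and the log-density both concentrate. Compared with
  the target, \<open>T d\<close> exceeds by \<open>\<Sum> x\<^sub>i (\<tau>\<^sup>2 - x\<^sub>i)\<close> while the rate falls short by this quantity divided by
  \<open>2 \<tau>\<^sup>2\<close>. Hence \<open>\<tau>\<^sup>2 = \<Sum> x\<^sub>i\<^sup>2 / \<Sum> x\<^sub>i\<close> achieves both exactly, and rounding \<open>\<tau>\<^sup>2\<close> up to a grid with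
  constantly many points costs little. So a single Gaussian codeword of the right variance is good for a typical
  source word with probability at least about \<open>2 powr (- n R)\<close>.

  Choosing \<open>2 powr (n (R + \<epsilon>))\<close> codewords greedily leaves a doubly exponentially small fraction of
  source words uncovered, which beats the \<open>exp (O (n\<^sup>2 log n))\<close> cells of a net of the set of all
  \<open>\<Sigma>\<close>. One deterministic codebook therefore serves every \<open>\<Sigma>\<close>, and the shared randomness is ignored.
\<close>

section \<open>Rotations and the standard Gaussian measure\<close>

text \<open>The codebook is fixed before \<open>\<Sigma>\<close> is known, so it may depend neither
  on the eigenbasis nor on the best variance. Rotation invariance of the Gaussian disposes of the
  eigenbasis; one subcodebook for each grid variance disposes of the rest, at a constant factor in
  size. Because the tilt is a function of the distortion alone, distortion and log-density fluctuate
  through the same linear-quadratic statistic of the tilted word, and a single event controls both.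
  Second moments suffice for all concentration: atypical source words are estimated for each
  \<open>\<Sigma>\<close> separately and never summed over the net, so their probability need only
  tend to 0. Only typical but uncovered words are summed over the net, and for these the greedy
  choice gives the factor \<open>(1 - p) ^ m\<close>. Distortion is unbounded, so a set of small
  probability need not contribute little to the expectation. Adding the zero codeword and using
  fourth moments settles this.\<close>

lemma nn_integral_lborel_rotation:
  fixes H :: "real \<Rightarrow> real \<Rightarrow> ennreal" and c s :: real
  assumes H[measurable]: "case_prod H \<in> borel_measurable (borel \<Otimes>\<^sub>M borel)"
    and cs: "c\<^sup>2 + s\<^sup>2 = 1"
  shows "(\<integral>\<^sup>+a. \<integral>\<^sup>+b. H (c * a + s * b) (c * b - s * a) \<partial>lborel \<partial>lborel)
    = (\<integral>\<^sup>+a. \<integral>\<^sup>+b. H a b \<partial>lborel \<partial>lborel)"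
proof (cases "c = 0")
  case True
  then have s: "s\<^sup>2 = 1" using cs by simp
  then have s1: "\<bar>s\<bar> = 1" by (simp add: power2_eq_1_iff) auto
  have "(\<integral>\<^sup>+a. \<integral>\<^sup>+b. H (c * a + s * b) (c * b - s * a) \<partial>lborel \<partial>lborel)
     = (\<integral>\<^sup>+a. \<integral>\<^sup>+b. H (0 + s * b) (0 + (- s) * a) \<partial>lborel \<partial>lborel)" using True by simp
  also have "\<dots> = (\<integral>\<^sup>+b. \<integral>\<^sup>+a. H (0 + s * b) (0 + (- s) * a) \<partial>lborel \<partial>lborel)"
    by (rule lborel_pair.Fubini') simp
  also have "\<dots> = (\<integral>\<^sup>+b. \<integral>\<^sup>+a. H (0 + s * b) a \<partial>lborel \<partial>lborel)"
  proof (rule nn_integral_cong)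
    fix b
    have "(\<integral>\<^sup>+a. H (0 + s * b) a \<partial>lborel) = ennreal \<bar>- s\<bar> * (\<integral>\<^sup>+a. H (0 + s * b) (0 + (- s) * a) \<partial>lborel)"
      using s1 by (intro nn_integral_real_affine) auto
    then show "(\<integral>\<^sup>+a. H (0 + s * b) (0 + (- s) * a) \<partial>lborel) = (\<integral>\<^sup>+a. H (0 + s * b) a \<partial>lborel)"
      using s1 by simp
  qed
  also have "\<dots> = (\<integral>\<^sup>+b. \<integral>\<^sup>+a. H b a \<partial>lborel \<partial>lborel)"
    using nn_integral_real_affine[of "\<lambda>b. \<integral>\<^sup>+a. H b a \<partial>lborel" s 0] s1 by auto
  finally show ?thesis .
next
  case c: False
  \<comment> \<open>For \<open>c \<noteq> 0\<close> the rotation is two one-variable substitutions: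
    \<open>u = c * a + s * b\<close> at fixed \<open>b\<close>, then \<open>(b - s * u) / c\<close>
    at fixed \<open>u\<close>. Their factors \<open>1 / \<bar>c\<bar>\<close> and
    \<open>\<bar>c\<bar>\<close> cancel. For \<open>c = 0\<close> it is a swap with signs.\<close>
  have e1: "(\<integral>\<^sup>+a. H (c * a + s * b) (c * b - s * a) \<partial>lborel) 
      = ennreal (1 / \<bar>c\<bar>) * (\<integral>\<^sup>+u. H u ((b - s * u) / c) \<partial>lborel)" for b
  proof -
    have *: "(b - s * (s * b + c * a)) / c = c * b - s * a" for a
    proof -
      have "b = (c\<^sup>2 + s\<^sup>2) * b" using cs by simp
      then have "b - s * (s * b + c * a) = c * (c * b - s * a)"
        by (simp add: power2_eq_square algebra_simps)
      then show ?thesis using c by simp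
    qed
    have "(\<integral>\<^sup>+u. H u ((b - s * u) / c) \<partial>lborel) 
      = ennreal \<bar>c\<bar> * (\<integral>\<^sup>+a. H (s * b + c * a) ((b - s * (s * b + c * a)) / c) \<partial>lborel)"
      using nn_integral_real_affine[of "\<lambda>u. H u ((b - s * u) / c)" c "s * b"] c by simp
    then have "ennreal (1/\<bar>c\<bar>) * (\<integral>\<^sup>+u. H u ((b - s * u) / c) \<partial>lborel) 
      = (ennreal (1/\<bar>c\<bar>) * ennreal \<bar>c\<bar>) * (\<integral>\<^sup>+a. H (s * b + c * a) ((b - s * (s * b + c * a)) / c) \<partial>lborel)"
      by (simp add: mult.assoc)
    then show ?thesis using c unfolding * by (simp add: ennreal_mult[symmetric] add.commute)
  qed
  have e2: "ennreal (1 / \<bar>c\<bar>) * (\<integral>\<^sup>+b. H u ((b - s * u) / c) \<partial>lborel) = (\<integral>\<^sup>+b. H u b \<partial>lborel)" for u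
    using nn_integral_real_affine[of "\<lambda>v. H u v" "1/c" "- (s * u) / c"] c 
    by (simp add: diff_divide_distrib)
  have "(\<integral>\<^sup>+a. \<integral>\<^sup>+b. H (c * a + s * b) (c * b - s * a) \<partial>lborel \<partial>lborel)
     = (\<integral>\<^sup>+b. \<integral>\<^sup>+a. H (c * a + s * b) (c * b - s * a) \<partial>lborel \<partial>lborel)"
    by (rule lborel_pair.Fubini') simp
  also have "\<dots> = ennreal (1 / \<bar>c\<bar>) * (\<integral>\<^sup>+b. (\<integral>\<^sup>+u. H u ((b - s * u) / c) \<partial>lborel) \<partial>lborel)"
    unfolding e1 by (rule nn_integral_cmult) simp
  also have "\<dots> = ennreal (1 / \<bar>c\<bar>) * (\<integral>\<^sup>+u. (\<integral>\<^sup>+b. H u ((b - s * u) / c) \<partial>lborel) \<partial>lborel)"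
    by (subst lborel_pair.Fubini') simp_all
  also have "\<dots> = (\<integral>\<^sup>+u. ennreal (1 / \<bar>c\<bar>) * (\<integral>\<^sup>+b. H u ((b - s * u) / c) \<partial>lborel) \<partial>lborel)"
    by (rule nn_integral_cmult[symmetric]) simp
  finally show ?thesis by (simp add: e2)
qed

lemma std_normal_density_rotation:
  assumes "c\<^sup>2 + s\<^sup>2 = (1::real)"
  shows "std_normal_density (c * a + s * b) * std_normal_density (c * b - s * a)
    = std_normal_density a * std_normal_density b"
proof -
  have "(c * a + s * b)\<^sup>2 + (c * b - s * a)\<^sup>2 = (c\<^sup>2 + s\<^sup>2) * (a\<^sup>2 + b\<^sup>2)"
    by (simp add: power2_eq_square algebra_simps)
  then have "- (c * a + s * b)\<^sup>2 / 2 + - (c * b - s * a)\<^sup>2 / 2 = - a\<^sup>2 / 2 + - b\<^sup>2 / 2"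
    using assms by simp
  then have "exp (- (c * a + s * b)\<^sup>2 / 2) * exp (- (c * b - s * a)\<^sup>2 / 2) = exp (- a\<^sup>2 / 2) * exp (- b\<^sup>2 / 2)"
    by (simp only: exp_add[symmetric])
  then show ?thesis unfolding std_normal_density_def by simp
qed

abbreviation stdn :: "real measure" where "stdn \<equiv> std_normal_distribution"

lemma prob_space_stdn: "prob_space stdn"
  by (simp add: prob_space_normal_density)

lemma nn_integral_stdn_rotation:
  fixes F :: "real \<Rightarrow> real \<Rightarrow> ennreal" and c s :: real
  assumes F[measurable]: "case_prod F \<in> borel_measurable (borel \<Otimes>\<^sub>M borel)"
    and cs: "c\<^sup>2 + s\<^sup>2 = 1"
  shows "(\<integral>\<^sup>+a. \<integral>\<^sup>+b. F (c * a + s * b) (c * b - s * a) \<partial>stdn \<partial>stdn)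
    = (\<integral>\<^sup>+a. \<integral>\<^sup>+b. F a b \<partial>stdn \<partial>stdn)"
proof -
  define H where "H u v = ennreal (std_normal_density u * std_normal_density v) * F u v" for u v
  have H[measurable]: "case_prod H \<in> borel_measurable (borel \<Otimes>\<^sub>M borel)"
    unfolding H_def by measurable
  have eq: "(\<integral>\<^sup>+a. \<integral>\<^sup>+b. G a b \<partial>stdn \<partial>stdn)
    = (\<integral>\<^sup>+a. \<integral>\<^sup>+b. ennreal (std_normal_density a * std_normal_density b) * G a b \<partial>lborel \<partial>lborel)"
    if [measurable]: "case_prod G \<in> borel_measurable (borel \<Otimes>\<^sub>M borel)" for G :: "real \<Rightarrow> real \<Rightarrow> ennreal"
    by (simp add: nn_integral_density nn_integral_cmult[symmetric] ennreal_mult mult.assoc)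
  show ?thesis
    using nn_integral_lborel_rotation[OF H cs]
    by (subst (1 2) eq) (simp_all add: H_def std_normal_density_rotation[OF cs])
qed

lemma sets_gauss [measurable_cong]: "sets (gauss n) = sets (PiM {..<n} (\<lambda>_. borel))"
  unfolding gauss_def by (intro sets_PiM_cong) auto

lemma space_gauss: "space (gauss n) = PiE {..<n} (\<lambda>_. UNIV)"
  unfolding gauss_def by (simp add: space_PiM)

interpretation stdn_prod: product_prob_space "\<lambda>_::nat. stdn" "{..<n}" for n
  by (intro product_prob_spaceI prob_space_stdn)

lemma prob_space_gauss: "prob_space (gauss n)"
  unfolding gauss_def by (rule stdn_prod.P.prob_space_axioms)

text \<open>Fubini isolates the coordinates \<open>p\<close> and \<open>q\<close>, and the plane is
  rotated with all other coordinates fixed.\<close>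

lemma nn_integral_gauss_rotation:
  fixes F :: "(nat \<Rightarrow> real) \<Rightarrow> ennreal" and c s :: real
  assumes F: "F \<in> borel_measurable (gauss n)"
    and cs: "c\<^sup>2 + s\<^sup>2 = 1" and pq: "p < n" "q < n" "p \<noteq> q"
  shows "(\<integral>\<^sup>+w. F (w(p := c * w p + s * w q, q := c * w q - s * w p)) \<partial>gauss n)
    = (\<integral>\<^sup>+w. F w \<partial>gauss n)"
proof -
  define J where "J = {..<n} - {p,q}"
  have J: "finite J" "q \<notin> J" "p \<notin> insert q J" "{..<n} = insert p (insert q J)" 
    unfolding J_def using pq by auto
  have split: "(\<integral>\<^sup>+w. G w \<partial>gauss n) = (\<integral>\<^sup>+x. \<integral>\<^sup>+b. \<integral>\<^sup>+a. G (x(q := b, p := a)) \<partial>stdn \<partial>stdn \<partial>PiM J (\<lambda>_. stdn))"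
    if G: "G \<in> borel_measurable (gauss n)" for G
  proof -
    have G': "G \<in> borel_measurable (PiM (insert p (insert q J)) (\<lambda>_. stdn))"
      using G unfolding gauss_def J(4) .
    have G'[measurable]: "G \<in> borel_measurable (PiM (insert p (insert q J)) (\<lambda>_. borel))"
      using G' by (simp cong: measurable_cong_sets sets_PiM_cong)
    have "(\<integral>\<^sup>+w. G w \<partial>gauss n) = (\<integral>\<^sup>+w. G w \<partial>PiM (insert p (insert q J)) (\<lambda>_. stdn))"
      unfolding gauss_def J(4) ..
    also have "\<dots> = (\<integral>\<^sup>+x. \<integral>\<^sup>+a. G (x(p := a)) \<partial>stdn \<partial>PiM (insert q J) (\<lambda>_. stdn))"
      using J by (intro stdn_prod.product_nn_integral_insert) (auto cong: measurable_cong_sets)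
    also have "\<dots> = (\<integral>\<^sup>+x. \<integral>\<^sup>+b. \<integral>\<^sup>+a. G (x(q := b, p := a)) \<partial>stdn \<partial>stdn \<partial>PiM J (\<lambda>_. stdn))"
      using J by (subst stdn_prod.product_nn_integral_insert) auto
    finally show ?thesis .
  qed
  have F': "F \<in> borel_measurable (PiM (insert p (insert q J)) (\<lambda>_. stdn))"
      using F unfolding gauss_def J(4) .
  have [measurable]: "F \<in> borel_measurable (PiM (insert p (insert q J)) (\<lambda>_. borel))"
    using F' by (simp cong: measurable_cong_sets sets_PiM_cong)
  have m: "(\<lambda>w. F (w(p := c * w p + s * w q, q := c * w q - s * w p))) \<in> borel_measurable (gauss n)"
  proof -
    have "(\<lambda>w. w(p := c * w p + s * w q, q := c * w q - s * w p)) \<in>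
      gauss n \<rightarrow>\<^sub>M PiM (insert p (insert q J)) (\<lambda>_. borel::real measure)"
      by (intro measurable_fun_upd[where J="insert p (insert q J)"])
        (auto simp: gauss_def J(4) simp del: fun_upd_apply cong: measurable_cong_sets)
    then show ?thesis by measurable
  qed
  show ?thesis unfolding split[OF F] split[OF m]
  proof (rule nn_integral_cong)
    fix x assume x: "x \<in> space (PiM J (\<lambda>_. stdn))"
    have x': "x \<in> space (PiM J (\<lambda>_. borel))" using x by (simp add: space_PiM)
    have [measurable]: "(\<lambda>z. F (x(q := fst z, p := snd z))) \<in> borel_measurable (borel \<Otimes>\<^sub>M borel)"
    proof -
      have "(\<lambda>z. (x(q := fst z))(p := snd z)) \<in> borel \<Otimes>\<^sub>M borel \<rightarrow>\<^sub>M PiM (insert p (insert q J)) (\<lambda>_. borel::real measure)"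
        using x' by (intro measurable_fun_upd[where J="insert q J"] measurable_fun_upd[where J=J]) auto
      then show ?thesis by measurable
    qed
    have M: "case_prod (\<lambda>b a. F (x(q := b, p := a))) \<in> borel_measurable (borel \<Otimes>\<^sub>M borel)"
      unfolding case_prod_beta by measurable
    \<comment> \<open>The coordinate \<open>q\<close> is the outer variable of the iterated
      integral, so in the order \<open>(b, a)\<close> the plane is rotated with sine
      \<open>- s\<close>.\<close>
    have *: "(x(q := b, p := a)) (p := c * (x(q := b, p := a)) p + s * (x(q := b, p := a)) q, 
              q := c * (x(q := b, p := a)) q - s * (x(q := b, p := a)) p)
           = x(q := c * b + (-s) * a, p := c * a - (-s) * b)" for a b using pq by auto
    have cs': "c\<^sup>2 + (-s)\<^sup>2 = 1" using cs by simp
    show "(\<integral>\<^sup>+b. \<integral>\<^sup>+a. F ((x(q := b, p := a)) (p := c * (x(q := b, p := a)) p + s * (x(q := b, p := a)) q, 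
              q := c * (x(q := b, p := a)) q - s * (x(q := b, p := a)) p)) \<partial>stdn \<partial>stdn)
       = (\<integral>\<^sup>+b. \<integral>\<^sup>+a. F (x(q := b, p := a)) \<partial>stdn \<partial>stdn)"
      unfolding * by (rule nn_integral_stdn_rotation[OF M cs'])
  qed
qed

text \<open>The restriction keeps the result in \<open>space (gauss n)\<close>, whose points are
  extensional functions on \<open>{..<n}\<close>.\<close>

definition act :: "nat \<Rightarrow> real mat \<Rightarrow> (nat \<Rightarrow> real) \<Rightarrow> nat \<Rightarrow> real" where
  "act n U w = (\<lambda>i\<in>{..<n}. \<Sum>j<n. U $$ (i,j) * w j)"

text \<open>Invariance of the Gaussian measure is built in: it is checked for plane rotations and
  inherited by products, so no change of variables for a general orthogonal matrix is ever
  made.\<close>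

definition rotations :: "nat \<Rightarrow> real mat set" where
  "rotations n = {U \<in> carrier_mat n n. U * U\<^sup>T = 1\<^sub>m n \<and> U\<^sup>T * U = 1\<^sub>m n \<and>
     (\<forall>h\<in>borel_measurable (gauss n). (\<integral>\<^sup>+w. h (act n U w) \<partial>gauss n) = (\<integral>\<^sup>+w. h w \<partial>gauss n))}"

lemma measurable_gauss_component [measurable]: "i < n \<Longrightarrow> (\<lambda>w. w i) \<in> borel_measurable (gauss n)"
  by (simp cong: measurable_cong_sets)

lemma act_measurable [measurable]: "act n U \<in> gauss n \<rightarrow>\<^sub>M gauss n"
proof -
  have "(\<lambda>w. \<lambda>i\<in>{..<n}. \<Sum>j<n. U $$ (i,j) * w j) \<in> gauss n \<rightarrow>\<^sub>M PiM {..<n} (\<lambda>_. borel::real measure)"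
    by (intro measurable_restrict) auto
  then show ?thesis unfolding act_def[abs_def] by (simp cong: measurable_cong_sets)
qed

lemma act_in_space: "act n U w \<in> space (gauss n)"
  by (auto simp: act_def space_gauss)

lemma act_mult:
  assumes "U \<in> carrier_mat n n" "V \<in> carrier_mat n n"
  shows "act n (U * V) w = act n U (act n V w)"
proof
  fix i
  show "act n (U * V) w i = act n U (act n V w) i"
  proof (cases "i < n")
    case True
    have "act n (U * V) w i = (\<Sum>j<n. (\<Sum>k<n. U $$ (i,k) * V $$ (k,j)) * w j)"
      using assms True by (auto simp: act_def scalar_prod_def lessThan_atLeast0 intro!: sum.cong)
    also have "\<dots> = (\<Sum>k<n. \<Sum>j<n. U $$ (i,k) * V $$ (k,j) * w j)"
      unfolding sum_distrib_right by (rule sum.swap)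
    also have "\<dots> = act n U (act n V w) i"
      using True by (simp add: act_def sum_distrib_left mult.assoc)
    finally show ?thesis .
  qed (simp add: act_def)
qed

lemma act_one_component: 
  assumes "i < n"
  shows "act n (1\<^sub>m n) w i = w i"
proof -
  have "(\<Sum>j<n. (1\<^sub>m n :: real mat) $$ (i,j) * w j) = (\<Sum>j<n. if j = i then w j else 0)"
    using assms by (intro sum.cong) auto
  then show ?thesis using assms by (simp add: act_def)
qed

lemma act_one: 
  assumes "w \<in> space (gauss n)"
  shows "act n (1\<^sub>m n) w = w"
proof
  fix i
  show "act n (1\<^sub>m n) w i = w i"
  proof (cases "i < n")
    case False
    then show ?thesis using assms by (auto simp: act_def space_gauss PiE_def extensional_def)
  qed (rule act_one_component)
qed

lemma one_in_rotations: "1\<^sub>m n \<in> rotations n"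
  by (auto simp: rotations_def act_one intro!: nn_integral_cong)

lemma mult_in_rotations:
  assumes U: "U \<in> rotations n" and V: "V \<in> rotations n"
  shows "U * V \<in> rotations n"
proof -
  have c: "U \<in> carrier_mat n n" "V \<in> carrier_mat n n" 
    and o: "U * U\<^sup>T = 1\<^sub>m n" "U\<^sup>T * U = 1\<^sub>m n" "V * V\<^sup>T = 1\<^sub>m n" "V\<^sup>T * V = 1\<^sub>m n"
    and g: "\<And>h. h\<in>borel_measurable (gauss n) \<Longrightarrow> (\<integral>\<^sup>+w. h (act n U w) \<partial>gauss n) = (\<integral>\<^sup>+w. h w \<partial>gauss n)"
       "\<And>h. h\<in>borel_measurable (gauss n) \<Longrightarrow> (\<integral>\<^sup>+w. h (act n V w) \<partial>gauss n) = (\<integral>\<^sup>+w. h w \<partial>gauss n)"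
    using U V by (auto simp: rotations_def)
  have ct: "U\<^sup>T \<in> carrier_mat n n" "V\<^sup>T \<in> carrier_mat n n" using c by auto
  have t: "(U * V)\<^sup>T = V\<^sup>T * U\<^sup>T" using c by (rule transpose_mult)
  have "(U * V) * (V\<^sup>T * U\<^sup>T) = U * (V * V\<^sup>T) * U\<^sup>T"
    using c ct by (simp add: assoc_mult_mat[of _ n n _ n _ n])
  then have 1: "(U * V) * (U * V)\<^sup>T = 1\<^sub>m n" using c ct o t by simp
  have "(V\<^sup>T * U\<^sup>T) * (U * V) = V\<^sup>T * (U\<^sup>T * U) * V"
    using c ct by (simp add: assoc_mult_mat[of _ n n _ n _ n])
  then have 2: "(U * V)\<^sup>T * (U * V) = 1\<^sub>m n" using c ct o t by simp
  have 3: "(\<integral>\<^sup>+w. h (act n (U * V) w) \<partial>gauss n) = (\<integral>\<^sup>+w. h w \<partial>gauss n)" 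
    if [measurable]: "h\<in>borel_measurable (gauss n)" for h
    using g(2)[of "\<lambda>w. h (act n U w)"] g(1)[of h] by (simp add: act_mult[OF c])
  show ?thesis using c 1 2 3 by (auto simp: rotations_def)
qed

definition givens :: "nat \<Rightarrow> nat \<Rightarrow> nat \<Rightarrow> real \<Rightarrow> real \<Rightarrow> real mat" where
  "givens n p q c s = mat n n (\<lambda>(i,j). if i = p \<and> j = p \<or> i = q \<and> j = q then c
     else if i = p \<and> j = q then s else if i = q \<and> j = p then - s 
     else if i = j then 1 else 0)"

lemma sum_two_deltas:
  fixes f :: "nat \<Rightarrow> real"
  assumes "p < n" "q < n" "p \<noteq> q" "\<And>j. j < n \<Longrightarrow> j \<noteq> p \<Longrightarrow> j \<noteq> q \<Longrightarrow> f j = 0"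
  shows "(\<Sum>j<n. f j) = f p + f q"
proof -
  have "(\<Sum>j<n. f j) = (\<Sum>j\<in>{p,q}. f j)"
    using assms by (intro sum.mono_neutral_right) auto
  then show ?thesis using assms by simp
qed

lemma act_givens:
  assumes "p < n" "q < n" "p \<noteq> q" "w \<in> space (gauss n)"
  shows "act n (givens n p q c s) w = w(p := c * w p + s * w q, q := c * w q - s * w p)"
proof
  fix i
  consider "i = p" | "i = q" | "i < n" "i \<noteq> p" "i \<noteq> q" | "\<not> i < n" by blast
  then show "act n (givens n p q c s) w i = (w(p := c * w p + s * w q, q := c * w q - s * w p)) i"
  proof cases
    case 3
    have "(\<Sum>j<n. givens n p q c s $$ (i,j) * w j) = (\<Sum>j<n. if i = j then w j else 0)"
      using 3 by (intro sum.cong) (auto simp: givens_def)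
    then show ?thesis using 3 by (simp add: act_def)
  next
    case 4
    then show ?thesis using assms by (auto simp: act_def space_gauss PiE_def extensional_def)
  next
    case 1
    have "(\<Sum>j<n. givens n p q c s $$ (i,j) * w j) = givens n p q c s $$ (i,p) * w p + givens n p q c s $$ (i,q) * w q"
      using 1 assms by (intro sum_two_deltas) (auto simp: givens_def)
    then show ?thesis using 1 assms by (simp add: act_def givens_def)
  next
    case 2
    have "(\<Sum>j<n. givens n p q c s $$ (i,j) * w j) = givens n p q c s $$ (i,p) * w p + givens n p q c s $$ (i,q) * w q"
      using 2 assms by (intro sum_two_deltas) (auto simp: givens_def)
    then show ?thesis using 2 assms by (simp add: act_def givens_def)
  qed
qed

lemma givens_in_rotations:
  assumes pq: "p < n" "q < n" "p \<noteq> q" and cs: "c\<^sup>2 + s\<^sup>2 = 1"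
  shows "givens n p q c s \<in> rotations n"
proof -
  let ?G = "givens n p q"
  have c: "?G c s \<in> carrier_mat n n" for c s by (simp add: givens_def)
  have t: "(?G c s)\<^sup>T = ?G c (- s)" for c s using pq by (intro eq_matI) (auto simp: givens_def)
  have 1: "?G c s * ?G c (- s) = 1\<^sub>m n" if cs: "c\<^sup>2 + s\<^sup>2 = 1" for c s
  proof (rule eq_matI)
    fix i j assume ij: "i < dim_row (1\<^sub>m n :: real mat)" "j < dim_col (1\<^sub>m n :: real mat)"
    have "(?G c s * ?G c (- s)) $$ (i,j) = (\<Sum>k<n. ?G c s $$ (i,k) * ?G c (- s) $$ (k,j))"
      using ij c by (auto simp: givens_def scalar_prod_def lessThan_atLeast0)
    also have "\<dots> = (1\<^sub>m n :: real mat) $$ (i,j)"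
    proof (cases "i = p \<or> i = q")
      case True
      have "(\<Sum>k<n. ?G c s $$ (i,k) * ?G c (- s) $$ (k,j)) 
         = ?G c s $$ (i,p) * ?G c (- s) $$ (p,j) + ?G c s $$ (i,q) * ?G c (- s) $$ (q,j)"
        using pq ij True by (intro sum_two_deltas) (auto simp: givens_def)
      then show ?thesis using True pq ij cs by (auto simp: givens_def power2_eq_square algebra_simps)
    next
      case False
      have "(\<Sum>k<n. ?G c s $$ (i,k) * ?G c (- s) $$ (k,j)) = (\<Sum>k<n. if i = k then ?G c (- s) $$ (k,j) else 0)"
        using pq ij False by (intro sum.cong) (auto simp: givens_def)
      then show ?thesis using False pq ij by (auto simp: givens_def)
    qed
    finally show "(?G c s * ?G c (- s)) $$ (i,j) = (1\<^sub>m n :: real mat) $$ (i,j)" .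
  qed (auto simp: givens_def)
  have 2: "?G c (- s) * ?G c s = 1\<^sub>m n" using 1[of c "- s"] cs by simp
  have 3: "(\<integral>\<^sup>+w. h (act n (?G c s) w) \<partial>gauss n) = (\<integral>\<^sup>+w. h w \<partial>gauss n)" 
    if "h\<in>borel_measurable (gauss n)" for h
    using nn_integral_gauss_rotation[OF that cs pq] act_givens[OF pq]
    by (simp cong: nn_integral_cong)
  show ?thesis using c 1[OF cs] 2 3 t by (auto simp: rotations_def)
qed

section \<open>Diagonalisation by rotations\<close>

text \<open>The first-order condition at a maximum, for a quadratic polynomial. At
  \<open>t = b / d\<close> with \<open>d > \<bar>a\<bar>\<close> the linear term would dominate and
  make the value positive.\<close>

lemma zero_linear_coeff:
  fixes a b :: real
  assumes "\<And>t. a * t\<^sup>2 + b * t \<le> 0"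
  shows "b = 0"
proof (rule ccontr)
  assume b: "b \<noteq> 0"
  define d where "d = \<bar>a\<bar> + 1"
  have d: "d > 0" "a + d > 0" unfolding d_def by auto
  have "a * (b / d)\<^sup>2 + b * (b / d) = (b / d)\<^sup>2 * (a + d)"
    using d by (simp add: power2_eq_square field_simps)
  moreover have "(b / d)\<^sup>2 * (a + d) > 0" using b d by (intro mult_pos_pos) auto
  ultimately show False using assms[of "b / d"] by simp
qed

text \<open>A closed subset of the product of intervals \<open>{-1..1}\<close>, which is compact by
  Tychonoff. Vectors are functions on all naturals, so that the dimension \<open>k\<close> can be a
  variable.\<close>

lemma compact_unit_sphere:
  "compact {v :: nat \<Rightarrow> real. (\<forall>i>k. v i = 0) \<and> (\<Sum>i\<le>k. (v i)\<^sup>2) = 1}" (is "compact ?S")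
proof -
  have "compactin (product_topology (\<lambda>i::nat. euclideanreal) UNIV) (PiE UNIV (\<lambda>_. {-1..1::real}))"
    by (subst compactin_PiE) auto
  then have c: "compact (PiE UNIV (\<lambda>_::nat. {-1..1::real}))"
    by (simp add: euclidean_product_topology)
  have cont: "continuous_on UNIV (\<lambda>v::nat \<Rightarrow> real. v i)" for i
    by (rule continuous_on_product_coordinates)
  have "closed (\<Inter>i\<in>{k<..}. {v::nat \<Rightarrow> real. v i = 0})"
    by (intro closed_INT ballI closed_Collect_eq cont continuous_on_const)
  moreover have "closed {v :: nat \<Rightarrow> real. (\<Sum>i\<le>k. (v i)\<^sup>2) = 1}"
    by (intro closed_Collect_eq continuous_intros cont)
  ultimately have "closed ((\<Inter>i\<in>{k<..}. {v::nat \<Rightarrow> real. v i = 0}) \<inter> {v. (\<Sum>i\<le>k. (v i)\<^sup>2) = 1})"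
    by (rule closed_Int)
  also have "(\<Inter>i\<in>{k<..}. {v::nat \<Rightarrow> real. v i = 0}) \<inter> {v. (\<Sum>i\<le>k. (v i)\<^sup>2) = 1} = ?S" by auto
  finally have cl: "closed ?S" .
  have "v \<in> PiE UNIV (\<lambda>_. {-1..1})" if v: "v \<in> ?S" for v
  proof -
    have "(v i)\<^sup>2 \<le> 1" for i
    proof (cases "i \<le> k")
      case True
      have "(v i)\<^sup>2 \<le> (\<Sum>i\<le>k. (v i)\<^sup>2)" using True by (intro member_le_sum) auto
      then show ?thesis using v by simp
    qed (use v in auto)
    then show ?thesis by (auto simp: abs_square_le_1 abs_le_iff)
  qed
  then have "?S = PiE UNIV (\<lambda>_. {-1..1}) \<inter> ?S" by blast
  then show ?thesis using compact_Int_closed[OF c cl] by simp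
qed

text \<open>A maximiser of the quadratic form on the unit sphere is an eigenvector: its first-order
  condition in the direction of the \<open>i\<close>-th unit vector is the \<open>i\<close>-th
  coordinate of the eigenvalue equation.\<close>

lemma symmetric_eigenvector:
  fixes a :: "nat \<Rightarrow> nat \<Rightarrow> real"
  assumes sym: "\<And>i j. i \<le> k \<Longrightarrow> j \<le> k \<Longrightarrow> a i j = a j i"
  shows "\<exists>v \<mu>. (\<exists>i\<le>k. v i \<noteq> 0) \<and> (\<forall>i>k. v i = 0) \<and> (\<forall>i\<le>k. (\<Sum>j\<le>k. a i j * v j) = \<mu> * v i)"
proof -
  define q where "q v w = (\<Sum>i\<le>k. \<Sum>j\<le>k. v i * a i j * w j)" for v w :: "nat \<Rightarrow> real"
  define N where "N v = (\<Sum>i\<le>k. (v i)\<^sup>2)" for v :: "nat \<Rightarrow> real"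
  let ?S = "{v :: nat \<Rightarrow> real. (\<forall>i>k. v i = 0) \<and> (\<Sum>i\<le>k. (v i)\<^sup>2) = 1}"
  define e0 :: "nat \<Rightarrow> real" where "e0 i = (if i = 0 then 1 else 0)" for i
  have "(\<Sum>i\<le>k. (e0 i)\<^sup>2) = (\<Sum>i\<le>k. if i = 0 then 1 else 0)"
    by (intro sum.cong) (auto simp: e0_def)
  also have "\<dots> = 1" by simp
  finally have "e0 \<in> ?S" by (auto simp: e0_def)
  then have ne: "?S \<noteq> {}" by blast
  have cont: "continuous_on UNIV (\<lambda>v::nat \<Rightarrow> real. v i)" for i
    by (rule continuous_on_product_coordinates)
  have "continuous_on ?S (\<lambda>v. q v v)" unfolding q_def
    by (intro continuous_intros continuous_on_subset[OF cont]) auto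
  from continuous_attains_sup[OF compact_unit_sphere ne this]
  obtain v where v: "v \<in> ?S" and mx: "\<And>u. u \<in> ?S \<Longrightarrow> q u u \<le> q v v" by blast
  define \<mu> where "\<mu> = q v v"
  have Nv: "N v = 1" using v by (simp add: N_def)
  \<comment> \<open>Homogeneity turns the constrained maximum into an inequality for every
    \<open>u\<close>, so perturbations need not stay on the sphere and no multiplier argument is
    required.\<close>
  have le: "q u u \<le> \<mu> * N u" for u
  proof (cases "N u = 0")
    case True
    then have "\<forall>i\<le>k. u i = 0" unfolding N_def by (subst (asm) sum_nonneg_eq_0_iff) auto
    then show ?thesis using True by (simp add: q_def)
  next
    case False
    have "N u \<ge> 0" unfolding N_def by (intro sum_nonneg) auto
    then have Np: "N u > 0" using False by simp
    define u' where "u' = (\<lambda>i. if i \<le> k then u i / sqrt (N u) else 0)"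
    have "(\<Sum>i\<le>k. (u' i)\<^sup>2) = N u / N u"
      using Np by (simp add: u'_def power_divide sum_divide_distrib[symmetric] N_def)
    then have "u' \<in> ?S" using Np by (auto simp: u'_def)
    then have "q u' u' \<le> \<mu>" using mx by (simp add: \<mu>_def)
    moreover have "q u' u' = q u u / N u"
      using Np by (simp add: q_def u'_def sum_divide_distrib)
    ultimately show ?thesis using Np by (simp add: field_simps)
  qed
  have "(\<Sum>j\<le>k. a i j * v j) = \<mu> * v i" if i: "i \<le> k" for i
  proof -
    define e where "e = (\<lambda>j. if j = i then 1 else 0 :: real)"
    have exp: "q (\<lambda>j. v j + t * e j) (\<lambda>j. v j + t * e j) = q v v + t * q v e + t * q e v + t\<^sup>2 * q e e" for t
    proof -
      have "(v i + t * e i) * a i j * (v j + t * e j) = v i * a i j * v j + t * (v i * a i j * e j)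
         + t * (e i * a i j * v j) + t\<^sup>2 * (e i * a i j * e j)" for i j
        by (simp add: algebra_simps power2_eq_square)
      then show ?thesis by (simp only: q_def sum.distrib sum_distrib_left[symmetric])
    qed
    have eS: "(\<Sum>j\<le>k. x j * e j) = x i" "(\<Sum>j\<le>k. e j * x j) = x i" for x
    proof -
      have "(\<Sum>j\<le>k. x j * e j) = (\<Sum>j\<le>k. if j = i then x j else 0)"
        by (intro sum.cong) (auto simp: e_def)
      then show "(\<Sum>j\<le>k. x j * e j) = x i" using i by simp
      then show "(\<Sum>j\<le>k. e j * x j) = x i" by (simp add: mult.commute)
    qed
    have 1: "q e v = (\<Sum>j\<le>k. a i j * v j)"
      unfolding q_def using eS(2)[of "\<lambda>i. (\<Sum>j\<le>k. a i j * v j)"] by (simp add: sum_distrib_left mult.assoc)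
    have "q v e = q e v"
    proof -
      have "q v e = (\<Sum>j\<le>k. \<Sum>i\<le>k. v i * a i j * e j)" unfolding q_def by (rule sum.swap)
      also have "\<dots> = q e v" unfolding q_def using sym by (auto intro!: sum.cong)
      finally show ?thesis .
    qed
    moreover have "N (\<lambda>j. v j + t * e j) = 1 + 2 * t * v i + t\<^sup>2" for t
    proof -
      have "N (\<lambda>j. v j + t * e j) = N v + 2 * t * (\<Sum>j\<le>k. v j * e j) + t\<^sup>2 * (\<Sum>j\<le>k. e j * e j)"
      proof -
        have "(v j + t * e j)\<^sup>2 = (v j)\<^sup>2 + (2 * t) * (v j * e j) + t\<^sup>2 * (e j * e j)" for j
          by (simp add: algebra_simps power2_eq_square)
        then show ?thesis by (simp only: N_def sum.distrib sum_distrib_left[symmetric])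
      qed
      then show ?thesis by (simp add: Nv eS) (simp add: e_def)
    qed
    ultimately have "(q e e - \<mu>) * t\<^sup>2 + (2 * (q e v - \<mu> * v i)) * t \<le> 0" for t
      using le[of "\<lambda>j. v j + t * e j"] by (simp add: exp \<mu>_def[symmetric] algebra_simps)
    from zero_linear_coeff[OF this] show ?thesis using 1 by simp
  qed
  moreover have "\<exists>i\<le>k. v i \<noteq> 0"
  proof (rule ccontr)
    assume "\<not> ?thesis"
    then have "N v = 0" by (simp add: N_def)
    then show False using Nv by simp
  qed
  ultimately show ?thesis using v by blast
qed

text \<open>Rotations in the planes \<open>(m, k)\<close> for \<open>m < k\<close> move one
  coordinate after another into coordinate \<open>k\<close>. They never touch the axes beyond
  \<open>k\<close>; the second conclusion records this, so that axes decoupled earlier stay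
  decoupled.\<close>

lemma rotate_to_axis:
  fixes v :: "nat \<Rightarrow> real"
  assumes k: "k < n" and v: "\<And>i. i > k \<Longrightarrow> v i = 0"
  shows "\<exists>U\<in>rotations n. (\<forall>m<n. m \<noteq> k \<longrightarrow> act n U v m = 0) \<and>
     (\<forall>i<n. k < i \<longrightarrow> (\<forall>m<n. U $$ (m,i) = (if m = i then 1 else 0)))"
proof -
  have "m \<le> k \<Longrightarrow> \<exists>U\<in>rotations n. (\<forall>j<n. j < m \<or> k < j \<longrightarrow> act n U v j = 0) \<and>
     (\<forall>i<n. k < i \<longrightarrow> (\<forall>m<n. U $$ (m,i) = (if m = i then 1 else 0)))" for m
  proof (induction m)
    case 0
    have "act n (1\<^sub>m n) v j = v j" if "j < n" for j
      using that by (rule act_one_component)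
    then show ?case using v by (intro bexI[OF _ one_in_rotations]) auto
  next
    case (Suc m)
    then obtain U where U: "U \<in> rotations n" "\<And>j. j < n \<Longrightarrow> j < m \<or> k < j \<Longrightarrow> act n U v j = 0"
      "\<And>i m. i < n \<Longrightarrow> k < i \<Longrightarrow> m < n \<Longrightarrow> U $$ (m,i) = (if m = i then 1 else 0)" by auto
    define u where "u = act n U v"
    have mk: "m < n" "k < n" "m \<noteq> k" using Suc.prems k by auto
    show ?case
    proof (cases "u m = 0")
      case True
      then show ?thesis using U unfolding u_def by (intro bexI[OF _ U(1)]) (auto simp: less_Suc_eq)
    next
      case False
      define r where "r = sqrt ((u m)\<^sup>2 + (u k)\<^sup>2)"
      have "(u m)\<^sup>2 + (u k)\<^sup>2 > 0" using False by (simp add: add_pos_nonneg)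
      then have r: "r > 0" "r\<^sup>2 = (u m)\<^sup>2 + (u k)\<^sup>2" unfolding r_def by auto
      have cs: "(u k / r)\<^sup>2 + (- u m / r)\<^sup>2 = 1"
      proof -
        have "(u k / r)\<^sup>2 + (- u m / r)\<^sup>2 = ((u m)\<^sup>2 + (u k)\<^sup>2) / r\<^sup>2"
          by (simp add: power_divide add_divide_distrib)
        then show ?thesis using r(1) unfolding r(2)[symmetric] by simp
      qed
      define G where "G = givens n m k (u k / r) (- u m / r)"
      have G: "G \<in> rotations n" unfolding G_def using mk cs by (intro givens_in_rotations)
      have car: "G \<in> carrier_mat n n" "U \<in> carrier_mat n n" using G U(1) by (auto simp: rotations_def)
      have act: "act n (G * U) v = u(m := (u k / r) * u m + (- u m / r) * u k, k := (u k / r) * u k - (- u m / r) * u m)"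
        unfolding act_mult[OF car] u_def[symmetric] unfolding G_def
        using mk act_in_space[of n U v] by (intro act_givens) (auto simp: u_def)
      have "(G * U) $$ (j,i) = (if j = i then 1 else 0)" if i: "i < n" "k < i" "j < n" for i j
      proof -
        have "(G * U) $$ (j,i) = (\<Sum>l<n. G $$ (j,l) * U $$ (l,i))"
          using car i by (auto simp: scalar_prod_def lessThan_atLeast0)
        also have "\<dots> = (\<Sum>l<n. if l = i then G $$ (j,i) else 0)"
          using U(3)[OF i(1,2)] by (intro sum.cong) auto
        also have "\<dots> = G $$ (j,i)" using i by simp
        also have "\<dots> = (if j = i then 1 else 0)" using i mk Suc.prems by (auto simp: G_def givens_def)
        finally show ?thesis .
      qed
      moreover have "act n (G * U) v j = 0" if "j < n" "j < Suc m \<or> k < j" for j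
        using that U(2)[of j] mk Suc.prems unfolding act by (auto simp: u_def less_Suc_eq)
      ultimately show ?thesis by (intro bexI[OF _ mult_in_rotations[OF G U(1)]]) auto
    qed
  qed
  from this[of k] show ?thesis using nat_neq_iff by (metis order_refl)
qed

text \<open>Conjugation by \<open>U\<close> carries the eigenvector \<open>x\<close> to the
  eigenvector \<open>U *\<^sub>v x\<close>, here a multiple of an axis.\<close>

lemma conjugate_eigenvector:
  fixes A U :: "real mat"
  assumes c: "A \<in> carrier_mat n n" "U \<in> carrier_mat n n" and o: "U\<^sup>T * U = 1\<^sub>m n"
    and x: "x \<in> carrier_vec n" "U *\<^sub>v x = r \<cdot>\<^sub>v unit_vec n j" "r \<noteq> 0" "A *\<^sub>v x = \<mu> \<cdot>\<^sub>v x"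
  shows "(U * A * U\<^sup>T) *\<^sub>v unit_vec n j = \<mu> \<cdot>\<^sub>v unit_vec n j"
proof -
  have ct: "U\<^sup>T \<in> carrier_mat n n" using c by simp
  have uv: "unit_vec n j = (1 / r) \<cdot>\<^sub>v (U *\<^sub>v x)" using x by (simp add: smult_smult_assoc)
  have a: "U\<^sup>T *\<^sub>v (U *\<^sub>v x) = x"
    using c ct x(1) o by (simp add: assoc_mult_mat_vec[symmetric, of _ n n _ n])
  have *: "U\<^sup>T *\<^sub>v unit_vec n j = (1 / r) \<cdot>\<^sub>v x"
    unfolding uv using c ct x(1) a by (simp add: mult_mat_vec[of _ n n])
  have "(U * A * U\<^sup>T) *\<^sub>v unit_vec n j = U *\<^sub>v (A *\<^sub>v (U\<^sup>T *\<^sub>v unit_vec n j))"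
    using c ct by (simp add: assoc_mult_mat_vec[of _ n n _ n] assoc_mult_mat[of _ n n _ n _ n])
  also have "\<dots> = (1 / r) \<cdot>\<^sub>v (\<mu> \<cdot>\<^sub>v (U *\<^sub>v x))"
    unfolding * using c x by (simp add: mult_mat_vec[of _ n n])
  also have "\<dots> = \<mu> \<cdot>\<^sub>v unit_vec n j" unfolding x(2) using x(3) by (simp add: smult_smult_assoc)
  finally show ?thesis .
qed

lemma mat_entry_unit_vec:
  fixes B :: "real mat"
  assumes "B \<in> carrier_mat n n" "i < n" "j < n"
  shows "(B *\<^sub>v unit_vec n j) $ i = B $$ (i,j)"
  using assms by (simp add: scalar_prod_right_unit)

lemma act_mult_mat_vec: "U \<in> carrier_mat n n \<Longrightarrow> i < n \<Longrightarrow> (U *\<^sub>v vec n v) $ i = act n U v i"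
  by (auto simp: act_def scalar_prod_def lessThan_atLeast0)

text \<open>Rotating an eigenvector supported on the coordinates \<open>\<le> k\<close> onto axis \<open>k\<close> decouples that axis.\<close>

lemma deflation_step:
  fixes A :: "real mat"
  assumes A: "A \<in> carrier_mat n n" "A\<^sup>T = A" and k: "k < n"
    and off: "\<And>i j. i < n \<Longrightarrow> j < n \<Longrightarrow> i \<noteq> j \<Longrightarrow> k < j \<Longrightarrow> A $$ (i,j) = 0"
  shows "\<exists>U\<in>rotations n. \<forall>i<n. \<forall>j<n. i \<noteq> j \<longrightarrow> k \<le> j \<longrightarrow> (U * A * U\<^sup>T) $$ (i,j) = 0"
proof -
  have sym: "A $$ (i,j) = A $$ (j,i)" if "i < n" "j < n" for i j
    using A that by (metis carrier_matD index_transpose_mat(1))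
  from symmetric_eigenvector[of k "\<lambda>i j. A $$ (i,j)"] sym k
  obtain v \<mu> where v: "\<exists>i\<le>k. v i \<noteq> 0" "\<And>i. i > k \<Longrightarrow> v i = 0" 
    and ev: "\<And>i. i \<le> k \<Longrightarrow> (\<Sum>j\<le>k. A $$ (i,j) * v j) = \<mu> * v i" by auto
  from rotate_to_axis[of k n v, OF k v(2)] obtain U where U: "U \<in> rotations n"
    and U1: "\<And>m. m < n \<Longrightarrow> m \<noteq> k \<Longrightarrow> act n U v m = 0"
    and U2: "\<And>i m. i < n \<Longrightarrow> k < i \<Longrightarrow> m < n \<Longrightarrow> U $$ (m,i) = (if m = i then 1 else 0)" by auto
  have Uc: "U \<in> carrier_mat n n" "U\<^sup>T * U = 1\<^sub>m n" using U by (auto simp: rotations_def)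
  have B: "U * A * U\<^sup>T \<in> carrier_mat n n" using A Uc by auto
  \<comment> \<open>It is enough that every axis \<open>j \<ge> k\<close> is an eigenvector of the
    conjugate. For \<open>j > k\<close> the axis is already an eigenvector of \<open>A\<close> and
    is fixed by \<open>U\<close>; axis \<open>k\<close> is the direction of the image of
    \<open>v\<close>.\<close>
  have "\<exists>\<nu>. (U * A * U\<^sup>T) *\<^sub>v unit_vec n j = \<nu> \<cdot>\<^sub>v unit_vec n j" if j: "j < n" "k \<le> j" for j
  proof (cases "k = j")
    case False
    then have kj: "k < j" using j by simp
    have 1: "U *\<^sub>v unit_vec n j = 1 \<cdot>\<^sub>v unit_vec n j"
      using Uc j U2[OF j(1) kj] by (intro eq_vecI) (auto simp: scalar_prod_right_unit)
    have 2: "A *\<^sub>v unit_vec n j = A $$ (j,j) \<cdot>\<^sub>v unit_vec n j"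
      using A j off[OF _ j(1) _ kj] by (intro eq_vecI) (auto simp: scalar_prod_right_unit)
    show ?thesis using conjugate_eigenvector[OF A(1) Uc _ 1 _ 2] by auto
  next
    case True
    let ?x = "vec n v"
    have 1: "U *\<^sub>v ?x = act n U v k \<cdot>\<^sub>v unit_vec n k"
    proof (rule eq_vecI)
      fix i assume "i < dim_vec (act n U v k \<cdot>\<^sub>v unit_vec n k)"
      then show "(U *\<^sub>v ?x) $ i = (act n U v k \<cdot>\<^sub>v unit_vec n k) $ i"
        using Uc U1 k by (cases "i = k") (simp_all add: act_mult_mat_vec del: index_mult_mat_vec)
    qed (use Uc in auto)
    have 2: "A *\<^sub>v ?x = \<mu> \<cdot>\<^sub>v ?x"
    proof (rule eq_vecI)
      fix i assume "i < dim_vec (\<mu> \<cdot>\<^sub>v ?x)"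
      then have i: "i < n" by simp
      have "(A *\<^sub>v ?x) $ i = (\<Sum>j<n. A $$ (i,j) * v j)" using i A by (simp add: act_mult_mat_vec act_def del: index_mult_mat_vec)
      also have "\<dots> = (\<Sum>j\<le>k. A $$ (i,j) * v j)" using k v(2) by (intro sum.mono_neutral_right) auto
      also have "\<dots> = \<mu> * v i"
      proof (cases "i \<le> k")
        case False
        then have "A $$ (i,j) = 0" if "j \<le> k" for j using off[of j i] sym[of i j] i k that by auto
        then show ?thesis using v(2)[of i] False by simp
      qed (rule ev)
      finally show "(A *\<^sub>v ?x) $ i = (\<mu> \<cdot>\<^sub>v ?x) $ i" using i by simp
    qed (use A in auto)
    have "act n U v k \<noteq> 0"
    proof
      assume "act n U v k = 0"
      then have "U *\<^sub>v ?x = 0\<^sub>v n" using 1 by (intro eq_vecI) auto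
      then have "U\<^sup>T *\<^sub>v (U *\<^sub>v ?x) = 0\<^sub>v n" using Uc by (intro eq_vecI) auto
      then have "?x = 0\<^sub>v n" using Uc by (simp add: assoc_mult_mat_vec[symmetric, of _ n n _ n])
      then have "v i = 0" if "i < n" for i using that by (metis index_vec index_zero_vec(1))
      then show False using v(1) k by auto
    qed
    then show ?thesis using conjugate_eigenvector[OF A(1) Uc _ 1 _ 2] True by auto
  qed
  then have "(U * A * U\<^sup>T) $$ (i,j) = 0" if "i < n" "j < n" "i \<noteq> j" "k \<le> j" for i j
    using that mat_entry_unit_vec[OF B, of i j] by force
  then show ?thesis using U by blast
qed

text \<open>Induction on the number \<open>k\<close> of axes that may still be coupled: the axes
  from \<open>k\<close> on are decoupled, and each deflation step lowers \<open>k\<close> by one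
  while the rotations are multiplied up.\<close>

lemma symmetric_diagonalizable:
  fixes A :: "real mat"
  assumes A: "A \<in> carrier_mat n n" "A\<^sup>T = A"
  shows "\<exists>U\<in>rotations n. \<forall>i<n. \<forall>j<n. i \<noteq> j \<longrightarrow> (U * A * U\<^sup>T) $$ (i,j) = 0"
proof -
  have "k \<le> n \<Longrightarrow> A \<in> carrier_mat n n \<Longrightarrow> A\<^sup>T = A \<Longrightarrow> 
     (\<And>i j. i < n \<Longrightarrow> j < n \<Longrightarrow> i \<noteq> j \<Longrightarrow> k \<le> j \<Longrightarrow> A $$ (i,j) = 0) \<Longrightarrow>
     \<exists>U\<in>rotations n. \<forall>i<n. \<forall>j<n. i \<noteq> j \<longrightarrow> (U * A * U\<^sup>T) $$ (i,j) = 0" for k A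
  proof (induction k arbitrary: A)
    case 0
    then show ?case by (intro bexI[OF _ one_in_rotations]) auto
  next
    case (Suc k)
    then have k: "k < n" by simp
    from deflation_step[OF Suc.prems(2,3) k] Suc.prems(4) obtain U where U: "U \<in> rotations n"
      and off: "\<And>i j. i < n \<Longrightarrow> j < n \<Longrightarrow> i \<noteq> j \<Longrightarrow> k \<le> j \<Longrightarrow> (U * A * U\<^sup>T) $$ (i,j) = 0" by auto
    have c: "U \<in> carrier_mat n n" "U\<^sup>T \<in> carrier_mat n n" using U by (auto simp: rotations_def)
    have B: "U * A * U\<^sup>T \<in> carrier_mat n n" using c Suc.prems by auto
    have "(U * A * U\<^sup>T)\<^sup>T = U * A * U\<^sup>T"
      using c Suc.prems(2,3) by (simp add: transpose_mult[of _ n n _ n] assoc_mult_mat[of _ n n _ n _ n])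
    from Suc.IH[OF _ B this off] k obtain V where V: "V \<in> rotations n"
      and Voff: "\<forall>i<n. \<forall>j<n. i \<noteq> j \<longrightarrow> (V * (U * A * U\<^sup>T) * V\<^sup>T) $$ (i,j) = 0" by auto
    have d: "V \<in> carrier_mat n n" "V\<^sup>T \<in> carrier_mat n n" using V by (auto simp: rotations_def)
    have "V * (U * A * U\<^sup>T) * V\<^sup>T = (V * U) * A * (V * U)\<^sup>T"
      using c d Suc.prems(2) by (simp add: transpose_mult[of _ n n _ n] assoc_mult_mat[of _ n n _ n _ n])
    then show ?case using Voff mult_in_rotations[OF V U] by auto
  qed
  from this[of n A] A show ?thesis by auto
qed

section \<open>Spectrum, distortion and trace in an eigenbasis\<close>

lemma proots_prod_linear: "proots (\<Prod>a\<in>#M. [:- a, 1:]) = (M :: real multiset)"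
proof (induction M)
  case (add x M)
  have "(\<Prod>a\<in>#M. [:- a, 1:]) \<noteq> (0 :: real poly)" by (auto simp: prod_mset_zero_iff)
  then show ?case using add by (simp add: proots_mult proots_linear_factor del: mult_pCons_left)
qed simp

text \<open>A product of monic linear factors determines the multiset of its roots, so the choice
  made by \<open>SOME\<close> in \<open>spec\<close> is forced.\<close>

lemma spec_unique:
  assumes "size M = dim_row A" "char_poly A = (\<Prod>a\<in>#M. [:- a, 1:])"
  shows "spec A = M"
  unfolding spec_def
proof (rule some_equality)
  fix N :: "real multiset" assume "size N = dim_row A \<and> char_poly A = (\<Prod>a\<in>#N. [:- a, 1:])"
  then show "N = M" using assms proots_prod_linear[of N] proots_prod_linear[of M] by simp
qed (use assms in auto)

text \<open>Applied twice: with the eigenvalues as \<open>l\<close> it expresses the distortion,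
  with \<open>l = 1\<close> it shows that rotations preserve Euclidean distance.\<close>

lemma conjugated_quadratic_form:
  fixes U :: "nat \<Rightarrow> nat \<Rightarrow> real"
  shows "(\<Sum>k<n. l k * (\<Sum>j<n. U k j * v j)\<^sup>2) = (\<Sum>i<n. \<Sum>j<n. v i * (\<Sum>k<n. U k i * l k * U k j) * v j)"
proof -
  have "l k * (\<Sum>j<n. U k j * v j)\<^sup>2 = (\<Sum>i<n. \<Sum>j<n. v i * (U k i * l k * U k j) * v j)" for k
    by (simp add: power2_eq_square sum_product sum_distrib_left mult_ac)
  then have "(\<Sum>k<n. l k * (\<Sum>j<n. U k j * v j)\<^sup>2) = (\<Sum>k<n. \<Sum>i<n. \<Sum>j<n. v i * (U k i * l k * U k j) * v j)"
    by simp
  also have "\<dots> = (\<Sum>i<n. \<Sum>k<n. \<Sum>j<n. v i * (U k i * l k * U k j) * v j)" by (rule sum.swap)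
  also have "\<dots> = (\<Sum>i<n. \<Sum>j<n. \<Sum>k<n. v i * (U k i * l k * U k j) * v j)"
    by (intro sum.cong refl sum.swap)
  finally show ?thesis by (simp add: sum_distrib_left sum_distrib_right)
qed

lemma act_diff:
  assumes "k < n"
  shows "act n U w k - act n U w' k = (\<Sum>j<n. U $$ (k,j) * (w j - w' j))"
  using assms by (simp add: act_def right_diff_distrib sum_subtractf)

lemma transpose_mult_entry:
  assumes "U \<in> carrier_mat n n" "i < n" "j < n"
  shows "(U\<^sup>T * U) $$ (i,j) = (\<Sum>k<n. U $$ (k,i) * U $$ (k,j))"
  using assms by (auto simp: scalar_prod_def lessThan_atLeast0)

lemma sum_power2_act_diff:
  assumes U: "U \<in> rotations n"
  shows "(\<Sum>k<n. (act n U w k - act n U w' k)\<^sup>2) = (\<Sum>i<n. (w i - w' i)\<^sup>2)"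
proof -
  have c: "U \<in> carrier_mat n n" "U\<^sup>T * U = 1\<^sub>m n" using U by (auto simp: rotations_def)
  have "(\<Sum>k<n. (act n U w k - act n U w' k)\<^sup>2) = (\<Sum>k<n. 1 * (\<Sum>j<n. U $$ (k,j) * (w j - w' j))\<^sup>2)"
    by (simp add: act_diff)
  also have "\<dots> = (\<Sum>i<n. \<Sum>j<n. (w i - w' i) * (\<Sum>k<n. U $$ (k,i) * 1 * U $$ (k,j)) * (w j - w' j))"
    by (rule conjugated_quadratic_form)
  also have "\<dots> = (\<Sum>i<n. \<Sum>j<n. if j = i then (w i - w' i)\<^sup>2 else 0)"
  proof (intro sum.cong refl)
    fix i j assume "i \<in> {..<n}" "j \<in> {..<n}"
    then show "(w i - w' i) * (\<Sum>k<n. U $$ (k,i) * 1 * U $$ (k,j)) * (w j - w' j) = (if j = i then (w i - w' i)\<^sup>2 else 0)"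
      using transpose_mult_entry[OF c(1), of i j] c(2) by (cases "i = j") (simp_all add: power2_eq_square)
  qed
  finally show ?thesis by simp
qed

text \<open>Bridge from matrices to sums over eigenvalues. One pair \<open>U\<close>,
  \<open>l\<close> must serve the distortion, the spectrum and the trace at once, since the rate is
  computed from the spectrum and the covering from the distortion.\<close>

lemma psd_decomposition:
  assumes S: "S \<in> psd_mats n"
  shows "\<exists>U\<in>rotations n. \<exists>l::nat \<Rightarrow> real. (\<forall>i<n. 0 \<le> l i) \<and> 
    (\<forall>w w'. d_Sigma S w w' = (\<Sum>k<n. l k * (act n U w k - act n U w' k)\<^sup>2)) \<and>
    spec S = image_mset l (mset_set {..<n}) \<and> mat_trace S = (\<Sum>i<n. l i)"
proof -
  have A: "S \<in> carrier_mat n n" "S\<^sup>T = S" and psd: "\<And>v. v \<in> carrier_vec n \<Longrightarrow> 0 \<le> scalar_prod v (S *\<^sub>v v)"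
    using S by (auto simp: psd_mats_def)
  from symmetric_diagonalizable[OF A] obtain U where U: "U \<in> rotations n"
    and off: "\<And>i j. i < n \<Longrightarrow> j < n \<Longrightarrow> i \<noteq> j \<Longrightarrow> (U * S * U\<^sup>T) $$ (i,j) = 0" by auto
  define D where "D = U * S * U\<^sup>T"
  define l where "l i = D $$ (i,i)" for i
  have c: "U \<in> carrier_mat n n" "U\<^sup>T \<in> carrier_mat n n" "U\<^sup>T * U = 1\<^sub>m n" "U * U\<^sup>T = 1\<^sub>m n" "D \<in> carrier_mat n n" 
    using U A by (auto simp: rotations_def D_def)
  have "U\<^sup>T * D * U = (U\<^sup>T * U) * S * (U\<^sup>T * U)"
    unfolding D_def using c(1,2) A(1) by (simp add: assoc_mult_mat[of _ n n _ n _ n])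
  then have SD: "S = U\<^sup>T * D * U" using c A by simp
  have DU: "(D * U) $$ (k,j) = l k * U $$ (k,j)" if "k < n" "j < n" for k j
  proof -
    have "(D * U) $$ (k,j) = (\<Sum>m<n. D $$ (k,m) * U $$ (m,j))"
      using that c by (auto simp: scalar_prod_def lessThan_atLeast0)
    also have "\<dots> = (\<Sum>m<n. if m = k then l k * U $$ (k,j) else 0)"
      using off that by (intro sum.cong) (auto simp: D_def[symmetric] l_def)
    finally show ?thesis using that by simp
  qed
  have ent: "S $$ (i,j) = (\<Sum>k<n. U $$ (k,i) * l k * U $$ (k,j))" if "i < n" "j < n" for i j
  proof -
    have "S $$ (i,j) = (U\<^sup>T * (D * U)) $$ (i,j)" using SD c by (simp add: assoc_mult_mat[of _ n n _ n _ n])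
    also have "\<dots> = (\<Sum>k<n. U $$ (k,i) * (D * U) $$ (k,j))"
      using that c by (auto simp: scalar_prod_def lessThan_atLeast0)
    also have "\<dots> = (\<Sum>k<n. U $$ (k,i) * l k * U $$ (k,j))" using that by (simp add: DU mult.assoc)
    finally show ?thesis .
  qed
  have form: "d_Sigma S w w' = (\<Sum>k<n. l k * (act n U w k - act n U w' k)\<^sup>2)" for w w'
  proof -
    have "(\<Sum>k<n. l k * (act n U w k - act n U w' k)\<^sup>2) 
      = (\<Sum>i<n. \<Sum>j<n. (w i - w' i) * (\<Sum>k<n. U $$ (k,i) * l k * U $$ (k,j)) * (w j - w' j))"
      by (simp add: act_diff conjugated_quadratic_form)
    also have "\<dots> = d_Sigma S w w'" using A(1) ent by (simp add: d_Sigma_def)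
    finally show ?thesis by simp
  qed
  have "0 \<le> l i" if i: "i < n" for i
  proof -
    let ?v = "U\<^sup>T *\<^sub>v unit_vec n i"
    have v: "?v \<in> carrier_vec n" using c by simp
    have "l i = (D *\<^sub>v unit_vec n i) $ i" using i c by (simp add: l_def mat_entry_unit_vec)
    also have "\<dots> = (U *\<^sub>v (S *\<^sub>v ?v)) $ i"
      unfolding D_def using c(1,2) A(1) 
      by (simp add: assoc_mult_mat_vec[of _ n n _ n] assoc_mult_mat[of _ n n _ n _ n])
    also have "\<dots> = scalar_prod (row U i) (S *\<^sub>v ?v)" using i c A by simp
    also have "row U i = ?v" using i c by (intro eq_vecI) (auto simp: scalar_prod_right_unit)
    finally show ?thesis using psd[OF v] by simp
  qed
  moreover have "spec S = image_mset l (mset_set {..<n})"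
  proof (rule spec_unique)
    have "similar_mat_wit S D (U\<^sup>T) U" using SD c A by (auto simp: similar_mat_wit_def Let_def)
    then have "char_poly S = char_poly D" by (intro char_poly_similar) (auto simp: similar_mat_def)
    also have "\<dots> = (\<Prod>a\<leftarrow>diag_mat D. [:- a, 1:])"
      using c off by (intro char_poly_upper_triangular) (auto simp: D_def[symmetric])
    also have "diag_mat D = map l [0..<n]" using c by (auto simp: diag_mat_def l_def)
    also have "(\<Prod>a\<leftarrow>map l [0..<n]. [:- a, 1:]) = (\<Prod>a\<in>#mset (map l [0..<n]). [:- a, 1:])"
      by (metis mset_map prod_mset_prod_list)
    also have "mset (map l [0..<n]) = image_mset l (mset_set {..<n})"
      by (simp add: lessThan_atLeast0)
    finally show "char_poly S = (\<Prod>a\<in>#image_mset l (mset_set {..<n}). [:- a, 1:])" .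
  qed (use A in auto)
  moreover have "mat_trace S = (\<Sum>i<n. l i)"
  proof -
    have "mat_trace S = (\<Sum>i<n. \<Sum>k<n. l k * (U $$ (k,i) * U $$ (k,i)))"
      using A(1) by (auto simp: mat_trace_def ent mult_ac)
    also have "\<dots> = (\<Sum>k<n. \<Sum>i<n. l k * (U $$ (k,i) * U $$ (k,i)))" by (rule sum.swap)
    also have "\<dots> = (\<Sum>k<n. l k * (\<Sum>i<n. U $$ (k,i) * U $$ (k,i)))" by (simp add: sum_distrib_left)
    also have "\<dots> = (\<Sum>k<n. l k)"
    proof (intro sum.cong refl)
      fix k assume k: "k \<in> {..<n}"
      have "(U * U\<^sup>T) $$ (k,k) = (\<Sum>i<n. U $$ (k,i) * U $$ (k,i))"
        using k c(1) by (auto simp: scalar_prod_def lessThan_atLeast0)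
      then show "l k * (\<Sum>i<n. U $$ (k,i) * U $$ (k,i)) = l k" using k c(4) by simp
    qed
    finally show ?thesis .
  qed
  ultimately show ?thesis using U form by blast
qed

section \<open>The parameter T and the target distortion\<close>

lemma T_rc_exists:
  fixes l :: "nat \<Rightarrow> real"
  assumes l: "\<And>i. i < n \<Longrightarrow> 0 \<le> l i" and pos: "(\<Sum>i<n. l i) > 0" and n: "n > 0" and R: "R > 0"
  shows "\<exists>!T. T > 0 \<and> (1 / (2 * real n)) * (\<Sum>i<n. log 2 (1 + l i * T)) = R"
proof -
  define F where "F T = (1 / (2 * real n)) * (\<Sum>i<n. log 2 (1 + l i * T))" for T
  obtain k where k: "k < n" "l k > 0"
    using pos l by (metis finite_lessThan lessThan_iff linorder_not_le sum_nonpos)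
  have mono: "F S < F T" if "0 \<le> S" "S < T" for S T
  proof -
    have "(\<Sum>i<n. log 2 (1 + l i * S)) < (\<Sum>i<n. log 2 (1 + l i * T))"
    proof (rule sum_strict_mono_ex1)
      show "\<forall>i\<in>{..<n}. log 2 (1 + l i * S) \<le> log 2 (1 + l i * T)"
      proof
        fix i assume i: "i \<in> {..<n}"
        have "1 + l i * S > 0" using i l that by (simp add: add_pos_nonneg)
        moreover have "l i * S \<le> l i * T" using i l that by (intro mult_left_mono) auto
        ultimately show "log 2 (1 + l i * S) \<le> log 2 (1 + l i * T)" by simp
      qed
      have "1 + l k * S > 0" using k that by (simp add: add_pos_nonneg)
      moreover have "l k * S < l k * T" using k that by (intro mult_strict_left_mono) auto
      ultimately have "log 2 (1 + l k * S) < log 2 (1 + l k * T)" by simp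
      then show "\<exists>i\<in>{..<n}. log 2 (1 + l i * S) < log 2 (1 + l i * T)"
        using k that by (intro bexI[of _ k]) auto
    qed simp
    then show ?thesis unfolding F_def using n by (intro mult_strict_left_mono) auto
  qed
  \<comment> \<open>At this \<open>b\<close> the summand of the single positive eigenvalue
    \<open>l k\<close> alone already brings the sum up to \<open>2 * n * R\<close>, so the
    intermediate value theorem applies on \<open>{0..b}\<close>.\<close>
  define b where "b = 2 powr (2 * real n * R) / l k"
  have b: "b > 0" using k by (simp add: b_def)
  have "2 * real n * R = log 2 (l k * b)" using k by (simp add: b_def)
  also have "\<dots> \<le> log 2 (1 + l k * b)" 
    using mult_pos_pos[OF k(2) b] by (intro log_mono) auto
  also have "\<dots> \<le> (\<Sum>i<n. log 2 (1 + l i * b))" 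
  proof (rule member_le_sum[of k _ "\<lambda>i. log 2 (1 + l i * b)"])
    fix i assume "i \<in> {..<n} - {k}"
    then have "0 \<le> l i * b" using l b by simp
    then show "0 \<le> log 2 (1 + l i * b)" by simp
  qed (use k in auto)
  finally have "R \<le> F b" using n by (simp add: F_def field_simps)
  moreover have "F 0 \<le> R" using R by (simp add: F_def)
  moreover have "continuous_on {0..b} F"
  proof -
    have "1 + l i * T \<noteq> 0" if "i < n" "T \<in> {0..b}" for i T
      using that l by (smt (verit) atLeastAtMost_iff mult_nonneg_nonneg)
    then show ?thesis unfolding F_def log_def by (intro continuous_intros) auto
  qed
  ultimately obtain T where T: "0 \<le> T" "F T = R" using IVT'[of F 0 R b] b by auto
  have "T \<noteq> 0" using T R by (auto simp: F_def)
  then have "T > 0 \<and> F T = R" using T by simp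
  moreover have "S = T" if "S > 0 \<and> F S = R" for S
  proof (rule ccontr)
    assume "S \<noteq> T"
    then consider "S < T" | "T < S" by linarith
    then show False
    proof cases
      case 1
      from mono[OF _ this] that T show False by simp
    next
      case 2
      from mono[OF T(1) this] that T show False by simp
    qed
  qed
  ultimately have "\<exists>!T. T > 0 \<and> F T = R" by blast
  then show ?thesis unfolding F_def .
qed

text \<open>The lower bound on \<open>T\<close> follows from \<open>ln (1 + u) \<le> u\<close> and
  the trace normalisation. It does not depend on the spectrum, and later converts an excess in
  \<open>T\<close> times distortion into an excess in distortion.\<close>

lemma D_rc_multiset:
  fixes l :: "nat \<Rightarrow> real"
  assumes l: "\<And>i. i < n \<Longrightarrow> 0 \<le> l i" and tr: "(\<Sum>i<n. l i) = real n" and n: "n > 0" and R: "R > 0"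
  obtains T where "T \<ge> 2 * R * ln 2" "T > 0" "(\<Sum>i<n. ln (1 + l i * T)) = 2 * real n * R * ln 2"
    "real n * D_rc (image_mset l (mset_set {..<n})) R = (\<Sum>i<n. l i / (1 + l i * T))"
proof -
  let ?M = "image_mset l (mset_set {..<n})"
  define T where "T = T_rc ?M R"
  have sum: "(\<Sum>a\<in>#?M. f a) = (\<Sum>i<n. f (l i))" for f :: "real \<Rightarrow> real"
    unfolding sum_unfold_sum_mset by (simp add: image_mset.compositionality o_def)
  have "T > 0 \<and> (1 / (2 * real n)) * (\<Sum>i<n. log 2 (1 + l i * T)) = R"
    unfolding T_def T_rc_def sum using theI'[OF T_rc_exists[of n l R]] assms by simp
  then have T: "T > 0" "(\<Sum>i<n. log 2 (1 + l i * T)) = 2 * real n * R"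
    using n by (auto simp: field_simps)
  have 1: "(\<Sum>i<n. ln (1 + l i * T)) = 2 * real n * R * ln 2"
    using T(2) by (simp add: log_def sum_divide_distrib[symmetric] field_simps)
  have "2 * real n * R * ln 2 \<le> (\<Sum>i<n. l i * T)"
    unfolding 1[symmetric] using l T by (intro sum_mono ln_add_one_self_le_self) auto
  also have "\<dots> = real n * T" by (simp add: sum_distrib_right[symmetric] tr)
  finally have "T \<ge> 2 * R * ln 2" using n by (simp add: field_simps)
  moreover have "real n * D_rc ?M R = (\<Sum>i<n. l i / (1 + l i * T))"
    unfolding D_rc_def sum T_def[symmetric] using n by simp
  ultimately show ?thesis by (rule that[OF _ T(1) 1])
qed

section \<open>Affine images and concentration\<close>

text \<open>The weight is the Jacobian times the ratio of the normal densities at the image point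
  and at \<open>g\<close>. Both sides come from product measures, so it is enough to compare boxes
  by one-dimensional substitutions.\<close>

lemma nn_integral_gauss_affine:
  fixes F :: "(nat \<Rightarrow> real) \<Rightarrow> ennreal" and \<mu> \<sigma> :: "nat \<Rightarrow> real"
  assumes F[measurable]: "F \<in> borel_measurable (gauss n)" and \<sigma>: "\<And>i. i < n \<Longrightarrow> \<sigma> i > 0"
  shows "(\<integral>\<^sup>+z. F z \<partial>gauss n) = (\<integral>\<^sup>+g. ennreal (\<Prod>i<n. \<sigma> i * exp (((g i)\<^sup>2 - (\<mu> i + \<sigma> i * g i)\<^sup>2) / 2)) *
     F (\<lambda>i\<in>{..<n}. \<mu> i + \<sigma> i * g i) \<partial>gauss n)"
proof -
  define r where "r i x = \<sigma> i * exp ((x\<^sup>2 - (\<mu> i + \<sigma> i * x)\<^sup>2) / 2)" for i x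
  define A where "A g = (\<lambda>i\<in>{..<n}. \<mu> i + \<sigma> i * g i)" for g :: "nat \<Rightarrow> real"
  have r0: "r i x \<ge> 0" if "i < n" for i x using \<sigma>[OF that] by (simp add: r_def)
  have [measurable]: "r i \<in> borel_measurable borel" for i unfolding r_def by measurable
  have A[measurable]: "A \<in> gauss n \<rightarrow>\<^sub>M gauss n"
  proof -
    have "A \<in> gauss n \<rightarrow>\<^sub>M PiM {..<n} (\<lambda>_. borel::real measure)"
      unfolding A_def[abs_def] by (intro measurable_restrict) auto
    then show ?thesis by (simp cong: measurable_cong_sets)
  qed
  have R[measurable]: "(\<lambda>g. ennreal (\<Prod>i<n. r i (g i))) \<in> borel_measurable (gauss n)"
    by (intro measurable_compose[OF _ measurable_ennreal] borel_measurable_prod) auto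
  define P where "P = distr (density (gauss n) (\<lambda>g. ennreal (\<Prod>i<n. r i (g i)))) (gauss n) A"
  have "P = gauss n" unfolding gauss_def
  proof (rule stdn_prod.PiM_eqI)
    fix X :: "nat \<Rightarrow> real set" assume X: "\<And>i. i \<in> {..<n} \<Longrightarrow> X i \<in> sets stdn"
    have one: "(\<integral>\<^sup>+x. ennreal (r i x) * indicator (X i) (\<mu> i + \<sigma> i * x) \<partial>stdn) = emeasure stdn (X i)" if i: "i < n" for i
    proof -
      have [measurable]: "X i \<in> sets borel" using X i by simp
      have "emeasure stdn (X i) = (\<integral>\<^sup>+z. ennreal (std_normal_density z) * indicator (X i) z \<partial>lborel)"
        by (simp add: emeasure_density)
      also have "\<dots> = ennreal \<bar>\<sigma> i\<bar> * (\<integral>\<^sup>+x. ennreal (std_normal_density (\<mu> i + \<sigma> i * x)) * indicator (X i) (\<mu> i + \<sigma> i * x) \<partial>lborel)"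
        using \<sigma>[OF i] by (intro nn_integral_real_affine) auto
      also have "\<dots> = (\<integral>\<^sup>+x. ennreal (std_normal_density x) * (ennreal (r i x) * indicator (X i) (\<mu> i + \<sigma> i * x)) \<partial>lborel)"
      proof (subst nn_integral_cmult[symmetric], simp, intro nn_integral_cong)
        fix x
        have "exp (- (\<mu> i + \<sigma> i * x)\<^sup>2 / 2) = exp (- x\<^sup>2 / 2) * exp ((x\<^sup>2 - (\<mu> i + \<sigma> i * x)\<^sup>2) / 2)"
          by (subst exp_add[symmetric]) (simp add: diff_divide_distrib)
        then have "\<bar>\<sigma> i\<bar> * std_normal_density (\<mu> i + \<sigma> i * x) = std_normal_density x * r i x"
          using \<sigma>[OF i] by (simp add: std_normal_density_def r_def)
        then show "ennreal \<bar>\<sigma> i\<bar> * (ennreal (std_normal_density (\<mu> i + \<sigma> i * x)) * indicator (X i) (\<mu> i + \<sigma> i * x))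
          = ennreal (std_normal_density x) * (ennreal (r i x) * indicator (X i) (\<mu> i + \<sigma> i * x))"
          using r0[OF i] by (simp add: mult.assoc[symmetric] ennreal_mult[symmetric])
      qed
      also have "\<dots> = (\<integral>\<^sup>+x. ennreal (r i x) * indicator (X i) (\<mu> i + \<sigma> i * x) \<partial>stdn)"
        by (subst nn_integral_density) auto
      finally show ?thesis by simp
    qed
    have XS: "PiE {..<n} X \<in> sets (gauss n)" unfolding gauss_def using X by (intro sets_PiM_I_finite) auto
    have "emeasure P (PiE {..<n} X) = (\<integral>\<^sup>+g. indicator (PiE {..<n} X) g \<partial>P)"
      using XS by (subst nn_integral_indicator) (auto simp: P_def)
    also have "\<dots> = (\<integral>\<^sup>+g. ennreal (\<Prod>i<n. r i (g i)) * indicator (PiE {..<n} X) (A g) \<partial>gauss n)"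
      unfolding P_def using XS
      by (subst nn_integral_distr, simp, simp, subst nn_integral_density)
        (auto intro!: measurable_compose[OF A] borel_measurable_indicator)
    also have "\<dots> = (\<integral>\<^sup>+g. (\<Prod>i<n. ennreal (r i (g i)) * indicator (X i) (\<mu> i + \<sigma> i * g i)) \<partial>gauss n)"
    proof (intro nn_integral_cong)
      fix g
      have "indicator (PiE {..<n} X) (A g) = (\<Prod>i<n. indicator (X i) (\<mu> i + \<sigma> i * g i) :: ennreal)"
      proof (cases "A g \<in> PiE {..<n} X")
        case True
        then have "\<mu> i + \<sigma> i * g i \<in> X i" if "i < n" for i using that by (auto simp: A_def PiE_iff)
        then show ?thesis using True by simp
      next
        case False
        then obtain i where "i < n" "\<mu> i + \<sigma> i * g i \<notin> X i" by (auto simp: A_def PiE_iff)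
        then have "(\<Prod>i<n. indicator (X i) (\<mu> i + \<sigma> i * g i) :: ennreal) = 0" by (intro prod_zero bexI[of _ i]) auto
        then show ?thesis using False by simp
      qed
      moreover have "(\<Prod>i<n. ennreal (r i (g i))) = ennreal (\<Prod>i<n. r i (g i))"
        using r0 by (intro prod_ennreal) auto
      ultimately show "ennreal (\<Prod>i<n. r i (g i)) * indicator (PiE {..<n} X) (A g) = (\<Prod>i<n. ennreal (r i (g i)) * indicator (X i) (\<mu> i + \<sigma> i * g i))"
        by (simp add: prod.distrib)
    qed
    also have "\<dots> = (\<Prod>i<n. \<integral>\<^sup>+x. ennreal (r i x) * indicator (X i) (\<mu> i + \<sigma> i * x) \<partial>stdn)"
      unfolding gauss_def using X by (intro stdn_prod.product_nn_integral_prod) auto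
    also have "\<dots> = (\<Prod>i<n. emeasure stdn (X i))" using one by (intro prod.cong) auto
    finally show "emeasure P (PiE {..<n} X) = (\<Prod>i<n. emeasure stdn (X i))" .
  qed (auto simp: P_def gauss_def)
  then have "(\<integral>\<^sup>+z. F z \<partial>gauss n) = (\<integral>\<^sup>+z. F z \<partial>P)" by simp
  also have "\<dots> = (\<integral>\<^sup>+g. ennreal (\<Prod>i<n. r i (g i)) * F (A g) \<partial>gauss n)"
    unfolding P_def by (simp add: nn_integral_distr nn_integral_density)
  finally show ?thesis unfolding r_def A_def .
qed

lemma measure_stdn_UNIV: "measure stdn UNIV = 1"
  using prob_space.prob_space[OF prob_space_stdn] by simp

lemma stdn_moments:
  "integrable stdn (\<lambda>x. x ^ k)"
  "integral\<^sup>L stdn (\<lambda>x. x) = 0" "integral\<^sup>L stdn (\<lambda>x. x ^ 2) = 1" 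
  "integral\<^sup>L stdn (\<lambda>x. x ^ 3) = 0" "integral\<^sup>L stdn (\<lambda>x. x ^ 4) = 3"
proof -
  show "integrable stdn (\<lambda>x. x ^ k)"
    using integrable_std_normal_moment[of k] by (subst integrable_density) auto
  have *: "integral\<^sup>L stdn (\<lambda>x. x ^ k) = integral\<^sup>L lborel (\<lambda>x. std_normal_density x * x ^ k)" for k
    by (subst integral_density) auto
  show "integral\<^sup>L stdn (\<lambda>x. x) = 0" using *[of 1] integral_std_normal_moment_odd[of 0] by simp
  show "integral\<^sup>L stdn (\<lambda>x. x ^ 2) = 1" using *[of 2] integral_std_normal_moment_even[of 1] by (simp add: fact_numeral)
  show "integral\<^sup>L stdn (\<lambda>x. x ^ 3) = 0" using *[of 3] integral_std_normal_moment_odd[of 1] by simp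
  show "integral\<^sup>L stdn (\<lambda>x. x ^ 4) = 3" using *[of 4] integral_std_normal_moment_even[of 2] by (simp add: fact_numeral)
qed

lemma gauss_coordinate:
  fixes h :: "real \<Rightarrow> real"
  assumes i: "i < n" and h: "integrable stdn h"
  shows "integrable (gauss n) (\<lambda>w. h (w i))" "(\<integral>w. h (w i) \<partial>gauss n) = integral\<^sup>L stdn h"
proof -
  define p where "p m = (if m = i then h else (\<lambda>_. 1))" for m
  have p: "integrable stdn (p m)" for m using h by (auto simp: p_def)
  have *: "(\<Prod>m<n. f m) = f i" if "\<And>m. m \<noteq> i \<Longrightarrow> f m = 1" for f :: "nat \<Rightarrow> real"
    using i that by (subst prod.mono_neutral_right[of _ "{i}"]) auto
  have e: "(\<Prod>m<n. p m (w m)) = h (w i)" for w using *[of "\<lambda>m. p m (w m)"] by (simp add: p_def)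
  show "integrable (gauss n) (\<lambda>w. h (w i))"
    unfolding gauss_def e[symmetric] using p by (intro stdn_prod.product_integrable_prod) auto
  have "(\<integral>w. h (w i) \<partial>gauss n) = (\<Prod>m<n. integral\<^sup>L stdn (p m))"
    unfolding gauss_def e[symmetric] using p by (intro stdn_prod.product_integral_prod) auto
  also have "\<dots> = integral\<^sup>L stdn h" using *[of "\<lambda>m. integral\<^sup>L stdn (p m)"] by (simp add: p_def measure_stdn_UNIV)
  finally show "(\<integral>w. h (w i) \<partial>gauss n) = integral\<^sup>L stdn h" .
qed

lemma gauss_two_coordinates:
  fixes h k :: "real \<Rightarrow> real"
  assumes ij: "i < n" "j < n" "i \<noteq> j" and h: "integrable stdn h" and k: "integrable stdn k"
  shows "integrable (gauss n) (\<lambda>w. h (w i) * k (w j))" 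
    "(\<integral>w. h (w i) * k (w j) \<partial>gauss n) = integral\<^sup>L stdn h * integral\<^sup>L stdn k"
proof -
  define p where "p m = (if m = i then h else if m = j then k else (\<lambda>_. 1))" for m
  have p: "integrable stdn (p m)" for m using h k by (auto simp: p_def)
  have *: "(\<Prod>m<n. f m) = f i * f j" if "\<And>m. m \<noteq> i \<Longrightarrow> m \<noteq> j \<Longrightarrow> f m = 1" for f :: "nat \<Rightarrow> real"
    using ij that by (subst prod.mono_neutral_right[of _ "{i,j}"]) auto
  have e: "(\<Prod>m<n. p m (w m)) = h (w i) * k (w j)" for w using *[of "\<lambda>m. p m (w m)"] ij by (simp add: p_def)
  show "integrable (gauss n) (\<lambda>w. h (w i) * k (w j))"
    unfolding gauss_def e[symmetric] using p by (intro stdn_prod.product_integrable_prod) auto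
  have "(\<integral>w. h (w i) * k (w j) \<partial>gauss n) = (\<Prod>m<n. integral\<^sup>L stdn (p m))"
    unfolding gauss_def e[symmetric] using p by (intro stdn_prod.product_integral_prod) auto
  also have "\<dots> = integral\<^sup>L stdn h * integral\<^sup>L stdn k" 
    using *[of "\<lambda>m. integral\<^sup>L stdn (p m)"] ij by (simp add: p_def measure_stdn_UNIV)
  finally show "(\<integral>w. h (w i) * k (w j) \<partial>gauss n) = integral\<^sup>L stdn h * integral\<^sup>L stdn k" .
qed

text \<open>The functions \<open>x\<close> and \<open>x\<^sup>2 - 1\<close> are Hermite polynomials:
  centred and orthogonal under the Gaussian, with squared norms 1 and 2. Independent coordinates
  then give the variance in the numerator.\<close>

lemma gauss_chebyshev:
  fixes \<alpha> \<beta> :: "nat \<Rightarrow> real"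
  assumes t: "t > 0"
  shows "measure (gauss n) {w\<in>space (gauss n). t \<le> \<bar>\<Sum>i<n. \<alpha> i * w i + \<beta> i * ((w i)\<^sup>2 - 1)\<bar>}
    \<le> (\<Sum>i<n. (\<alpha> i)\<^sup>2 + 2 * (\<beta> i)\<^sup>2) / t\<^sup>2"
proof -
  interpret G: prob_space "gauss n" by (rule prob_space_gauss)
  define h where "h i x = \<alpha> i * x + \<beta> i * (x\<^sup>2 - 1)" for i and x :: real
  define f where "f w = (\<Sum>i<n. h i (w i))" for w
  have i1: "integrable stdn (\<lambda>x. x)" using stdn_moments(1)[of 1] by simp
  have h: "integrable stdn (h i)" for i
    unfolding h_def[abs_def] using stdn_moments(1)[of 2] i1 by (intro Bochner_Integration.integrable_add integrable_mult_right Bochner_Integration.integrable_diff) auto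
  have h0: "integral\<^sup>L stdn (h i) = 0" for i
    unfolding h_def[abs_def] using stdn_moments(1)[of 2] i1 by (simp add: stdn_moments measure_stdn_UNIV)
  have h2eq: "h i x * h i x = (\<beta> i)\<^sup>2 * x ^ 4 + 2 * \<alpha> i * \<beta> i * x ^ 3 + ((\<alpha> i)\<^sup>2 - 2 * (\<beta> i)\<^sup>2) * x ^ 2
      + (- 2 * \<alpha> i * \<beta> i) * x + (\<beta> i)\<^sup>2" for i x
    unfolding h_def by (simp add: algebra_simps power2_eq_square power3_eq_cube power4_eq_xxxx)
  have h2: "integrable stdn (\<lambda>x. h i x * h i x)" for i
    unfolding h2eq using stdn_moments(1) i1 by (intro Bochner_Integration.integrable_add integrable_mult_right) auto
  have h2i: "(\<integral>x. h i x * h i x \<partial>stdn) = (\<alpha> i)\<^sup>2 + 2 * (\<beta> i)\<^sup>2" for i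
    unfolding h2eq using stdn_moments(1) i1 by (simp add: stdn_moments measure_stdn_UNIV)
  have sq: "(f w)\<^sup>2 = (\<Sum>i<n. \<Sum>j<n. h i (w i) * h j (w j))" for w
    by (simp add: f_def power2_eq_square sum_product)
  have int2: "integrable (gauss n) (\<lambda>w. h i (w i) * h j (w j))" if "i < n" "j < n" for i j
    using that gauss_two_coordinates(1)[of i n j "h i" "h j"] gauss_coordinate(1)[of i n "\<lambda>x. h i x * h i x"] h h2
    by (cases "i = j") auto
  have val: "(\<integral>w. h i (w i) * h j (w j) \<partial>gauss n) = (if j = i then (\<alpha> i)\<^sup>2 + 2 * (\<beta> i)\<^sup>2 else 0)" if "i < n" "j < n" for i j
    using that gauss_two_coordinates(2)[of i n j "h i" "h j"] gauss_coordinate(2)[of i n "\<lambda>x. h i x * h i x"] h h2 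
    by (cases "i = j") (auto simp: h0 h2i)
  have if2: "integrable (gauss n) (\<lambda>w. (f w)\<^sup>2)" 
    unfolding sq using int2 by (intro Bochner_Integration.integrable_sum) auto
  have Ef: "G.expectation f = 0"
    unfolding f_def[abs_def] using gauss_coordinate[OF _ h] by (subst Bochner_Integration.integral_sum) (auto simp: h0)
  have "(\<integral>w. (f w)\<^sup>2 \<partial>gauss n) = (\<Sum>i<n. \<Sum>j<n. \<integral>w. h i (w i) * h j (w j) \<partial>gauss n)"
    unfolding sq using int2 
    by (subst Bochner_Integration.integral_sum; auto intro!: sum.cong Bochner_Integration.integral_sum Bochner_Integration.integrable_sum)
  also have "\<dots> = (\<Sum>i<n. \<Sum>j<n. if j = i then (\<alpha> i)\<^sup>2 + 2 * (\<beta> i)\<^sup>2 else 0)"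
    using val by (intro sum.cong) auto
  finally have Ef2: "(\<integral>w. (f w)\<^sup>2 \<partial>gauss n) = (\<Sum>i<n. (\<alpha> i)\<^sup>2 + 2 * (\<beta> i)\<^sup>2)" by simp
  have m: "f \<in> borel_measurable (gauss n)"
    unfolding f_def[abs_def] h_def by measurable
  show ?thesis
    using G.Chebyshev_inequality[OF m if2 t] unfolding Ef by (simp add: Ef2) (simp add: f_def h_def)
qed

section \<open>Probability that a random codeword is good\<close>

text \<open>Change of measure for one codeword \<open>sqrt t * z\<close>, with \<open>y i\<close>
  standing for eigenvalue times \<open>T\<close>. Under the tilted law \<open>T\<close> times the
  distortion is a constant plus the statistic with coefficients \<open>\<alpha>\<close> and
  \<open>\<beta>\<close>, and the log-density ratio is a constant plus the same statistic over
  \<open>2 * t\<close>. The event on the left therefore gives both the ball and the lower bound on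
  its weight.\<close>

lemma gauss_ball_lower_bound:
  fixes y w x \<alpha> \<beta> :: "nat \<Rightarrow> real" and t a b :: real
  assumes y: "\<And>i. i < n \<Longrightarrow> 0 \<le> y i" and t: "t > 0"
  defines "x \<equiv> \<lambda>i. y i / (1 + y i)"
  defines "\<alpha> \<equiv> \<lambda>i. - 2 * sqrt t * x i * sqrt (1 - x i) * w i"
  defines "\<beta> \<equiv> \<lambda>i. t * x i"
  shows "ennreal (exp (- (\<Sum>i<n. ln (1 + y i)) / 2 + (t * (\<Sum>i<n. x i) - (\<Sum>i<n. (x i)\<^sup>2 * (w i)\<^sup>2) - a) / (2 * t)) * 
        measure (gauss n) {g\<in>space (gauss n). \<bar>\<Sum>i<n. \<alpha> i * g i + \<beta> i * ((g i)\<^sup>2 - 1)\<bar> \<le> a \<and> (\<Sum>i<n. (g i)\<^sup>2 - 1) \<le> b})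
    \<le> emeasure (gauss n) {z\<in>space (gauss n). 
        (\<Sum>i<n. y i * (w i - sqrt t * z i)\<^sup>2) \<le> (\<Sum>i<n. x i * (1 - x i) * (w i)\<^sup>2) + t * (\<Sum>i<n. x i) + a \<and>
        (\<Sum>i<n. (w i - sqrt t * z i)\<^sup>2) \<le> 2 * (\<Sum>i<n. (w i)\<^sup>2) + 2 * t * (n + b)}"
    (is "ennreal (?c * measure _ ?G) \<le> emeasure _ ?Z")
proof -
  interpret G: prob_space "gauss n" by (rule prob_space_gauss)
  \<comment> \<open>Mean and standard deviation of the tilted coordinate: completing the square in
    \<open>z\<^sup>2 + y i * (w i - sqrt t * z)\<^sup>2 / t\<close> gives precision
    \<open>1 + y i\<close>, hence variance \<open>1 - x i\<close>, and mean
    \<open>x i * w i / sqrt t\<close>.\<close>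
  define \<mu> where "\<mu> i = x i * w i / sqrt t" for i
  define \<sigma> where "\<sigma> i = sqrt (1 - x i)" for i
  define A where "A g = (\<lambda>i\<in>{..<n}. \<mu> i + \<sigma> i * g i)" for g :: "nat \<Rightarrow> real"
  define r where "r g = (\<Prod>i<n. \<sigma> i * exp (((g i)\<^sup>2 - (\<mu> i + \<sigma> i * g i)\<^sup>2) / 2))" for g :: "nat \<Rightarrow> real"
  have x: "0 \<le> x i" "x i < 1" "1 - x i = 1 / (1 + y i)" "y i * (1 - x i) = x i" if "i < n" for i
    using y[OF that] by (auto simp: x_def field_simps add_nonneg_eq_0_iff)
  have \<sigma>: "\<sigma> i > 0" "(\<sigma> i)\<^sup>2 = 1 - x i" "\<sigma> i \<le> 1" if "i < n" for i using x(1,2)[OF that] by (auto simp: \<sigma>_def)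
  have st: "sqrt t > 0" "sqrt t * sqrt t = t" using t by auto
  have stm: "sqrt t * \<mu> i = x i * w i" for i using st by (simp add: \<mu>_def)
  have Zm: "?Z \<in> sets (gauss n)" by measurable
  have Gm: "?G \<in> sets (gauss n)" by measurable
  define E where "E g = (\<Sum>i<n. \<alpha> i * g i + \<beta> i * ((g i)\<^sup>2 - 1))" for g
  have AZ: "A g \<in> ?Z" and rc: "?c \<le> r g" if g: "g \<in> ?G" for g
  proof -
    have w: "w i - sqrt t * A g i = (1 - x i) * w i - sqrt t * \<sigma> i * g i" if "i < n" for i
      using that by (simp add: A_def distrib_left stm mult.assoc[symmetric]) (simp add: algebra_simps)
    have 1: "y i * (w i - sqrt t * A g i)\<^sup>2 = x i * (1 - x i) * (w i)\<^sup>2 + t * x i + (\<alpha> i * g i + \<beta> i * ((g i)\<^sup>2 - 1))"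
      if i: "i < n" for i
    proof -
      have "y i * (w i - sqrt t * A g i)\<^sup>2 = (y i * (1 - x i)) * (1 - x i) * (w i)\<^sup>2 
         - 2 * (y i * (1 - x i)) * w i * sqrt t * \<sigma> i * g i + (y i * (\<sigma> i)\<^sup>2) * (sqrt t * sqrt t) * (g i)\<^sup>2"
        unfolding w[OF i] by (simp add: algebra_simps power2_eq_square)
      also have "\<dots> = x i * (1 - x i) * (w i)\<^sup>2 
         - 2 * x i * w i * sqrt t * \<sigma> i * g i + x i * t * (g i)\<^sup>2"
        unfolding \<sigma>(2)[OF i] x(4)[OF i] st(2) by (simp only:)
      finally show ?thesis by (simp add: \<alpha>_def \<beta>_def \<sigma>_def algebra_simps)
    qed
    have "(\<Sum>i<n. y i * (w i - sqrt t * A g i)\<^sup>2) = (\<Sum>i<n. x i * (1 - x i) * (w i)\<^sup>2) + t * (\<Sum>i<n. x i) + E g"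
      using 1 by (simp add: sum.distrib sum_distrib_left E_def)
    moreover have "\<bar>E g\<bar> \<le> a" using g by (simp add: E_def)
    moreover have "(\<Sum>i<n. (w i - sqrt t * A g i)\<^sup>2) \<le> 2 * (\<Sum>i<n. (w i)\<^sup>2) + 2 * t * (n + b)"
    proof -
      have 2: "(w i - sqrt t * A g i)\<^sup>2 \<le> 2 * (w i)\<^sup>2 + 2 * t * (g i)\<^sup>2" if i: "i < n" for i
      proof -
        have "(w i - sqrt t * A g i)\<^sup>2 \<le> 2 * ((1 - x i) * w i)\<^sup>2 + 2 * (sqrt t * \<sigma> i * g i)\<^sup>2"
          unfolding w[OF i] using zero_le_power2[of "(1 - x i) * w i + sqrt t * \<sigma> i * g i"] 
          by (simp add: power2_eq_square algebra_simps)
        also have "((1 - x i) * w i)\<^sup>2 \<le> (w i)\<^sup>2"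
          using x(1,2)[OF i] by (simp add: power_mult_distrib mult_left_le_one_le power_le_one)
        also have "(sqrt t * \<sigma> i * g i)\<^sup>2 = (\<sigma> i)\<^sup>2 * (t * (g i)\<^sup>2)"
          using t by (simp add: power_mult_distrib)
        also have "\<dots> \<le> t * (g i)\<^sup>2" using x(1,2)[OF i] t \<sigma>(2)[OF i] by (simp add: mult_left_le_one_le)
        finally show ?thesis by simp
      qed
      have "(\<Sum>i<n. (w i - sqrt t * A g i)\<^sup>2) \<le> (\<Sum>i<n. 2 * (w i)\<^sup>2 + 2 * t * (g i)\<^sup>2)"
        using 2 by (intro sum_mono) auto
      also have "\<dots> = 2 * (\<Sum>i<n. (w i)\<^sup>2) + 2 * t * (n + (\<Sum>i<n. (g i)\<^sup>2 - 1))"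
        by (simp add: sum.distrib sum_distrib_left sum_subtractf)
      also have "\<dots> \<le> 2 * (\<Sum>i<n. (w i)\<^sup>2) + 2 * t * (n + b)" using g t by simp
      finally show ?thesis .
    qed
    ultimately show "A g \<in> ?Z" by (auto simp: A_def space_gauss)
    \<comment> \<open>The log-weight of coordinate \<open>i\<close> contains exactly the summand of
      \<open>E g\<close> that occurred in the distortion, divided by \<open>2 * t\<close>.\<close>
    have 3: "\<sigma> i * exp (((g i)\<^sup>2 - (\<mu> i + \<sigma> i * g i)\<^sup>2) / 2)
      = exp (- ln (1 + y i) / 2 + (t * x i - (x i)\<^sup>2 * (w i)\<^sup>2 + (\<alpha> i * g i + \<beta> i * ((g i)\<^sup>2 - 1))) / (2 * t))"
      if i: "i < n" for i
    proof -
      have "ln (\<sigma> i) = - ln (1 + y i) / 2"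
        using x[OF i] y[OF i] unfolding \<sigma>_def x(3)[OF i] by (subst ln_sqrt) (auto simp: ln_div)
      then have s: "\<sigma> i = exp (- ln (1 + y i) / 2)" using \<sigma>(1)[OF i] by (metis exp_ln)
      have "t * (\<mu> i)\<^sup>2 = (x i)\<^sup>2 * (w i)\<^sup>2" using t by (simp add: \<mu>_def power_divide power_mult_distrib)
      moreover have "t * \<mu> i = sqrt t * x i * w i" using st stm[of i] by (metis mult.assoc)
      ultimately have "t * ((g i)\<^sup>2 - (\<mu> i + \<sigma> i * g i)\<^sup>2) = t * (1 - (\<sigma> i)\<^sup>2) * (g i)\<^sup>2 - (x i)\<^sup>2 * (w i)\<^sup>2 
          - 2 * (sqrt t * x i * w i) * \<sigma> i * g i"
        by (simp add: power2_eq_square algebra_simps)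
      also have "\<dots> = t * x i - (x i)\<^sup>2 * (w i)\<^sup>2 + (\<alpha> i * g i + \<beta> i * ((g i)\<^sup>2 - 1))"
        unfolding \<sigma>(2)[OF i] by (simp add: \<alpha>_def \<beta>_def \<sigma>_def algebra_simps)
      finally have "((g i)\<^sup>2 - (\<mu> i + \<sigma> i * g i)\<^sup>2) / 2 = (t * x i - (x i)\<^sup>2 * (w i)\<^sup>2 + (\<alpha> i * g i + \<beta> i * ((g i)\<^sup>2 - 1))) / (2 * t)"
        using t by (simp add: field_simps)
      then show ?thesis by (simp only: exp_add flip: s)
    qed
    have "r g = exp (\<Sum>i<n. - ln (1 + y i) / 2 + (t * x i - (x i)\<^sup>2 * (w i)\<^sup>2 + (\<alpha> i * g i + \<beta> i * ((g i)\<^sup>2 - 1))) / (2 * t))"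
      unfolding r_def by (subst exp_sum) (auto intro!: prod.cong simp: 3)
    also have "(\<Sum>i<n. - ln (1 + y i) / 2 + (t * x i - (x i)\<^sup>2 * (w i)\<^sup>2 + (\<alpha> i * g i + \<beta> i * ((g i)\<^sup>2 - 1))) / (2 * t))
      = - (\<Sum>i<n. ln (1 + y i)) / 2 + (t * (\<Sum>i<n. x i) - (\<Sum>i<n. (x i)\<^sup>2 * (w i)\<^sup>2) + E g) / (2 * t)"
      unfolding E_def by (simp add: sum.distrib sum_subtractf sum_negf sum_divide_distrib[symmetric] sum_distrib_left[symmetric])
    finally have "r g = exp (- (\<Sum>i<n. ln (1 + y i)) / 2 + (t * (\<Sum>i<n. x i) - (\<Sum>i<n. (x i)\<^sup>2 * (w i)\<^sup>2) + E g) / (2 * t))" .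
    moreover have "(t * (\<Sum>i<n. x i) - (\<Sum>i<n. (x i)\<^sup>2 * (w i)\<^sup>2) - a) / (2 * t)
      \<le> (t * (\<Sum>i<n. x i) - (\<Sum>i<n. (x i)\<^sup>2 * (w i)\<^sup>2) + E g) / (2 * t)"
      using \<open>\<bar>E g\<bar> \<le> a\<close> t by (intro divide_right_mono) auto
    ultimately show "?c \<le> r g" by simp
  qed
  have "emeasure (gauss n) ?Z = (\<integral>\<^sup>+z. indicator ?Z z \<partial>gauss n)" using Zm by simp
  also have "\<dots> = (\<integral>\<^sup>+g. ennreal (r g) * indicator ?Z (A g) \<partial>gauss n)"
    unfolding r_def A_def using Zm \<sigma>(1) by (intro nn_integral_gauss_affine) auto
  also have "\<dots> \<ge> (\<integral>\<^sup>+g. ennreal ?c * indicator ?G g \<partial>gauss n)"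
  proof (rule nn_integral_mono)
    fix g
    show "ennreal ?c * indicator ?G g \<le> ennreal (r g) * indicator ?Z (A g)"
    proof (cases "g \<in> ?G")
      case True
      then show ?thesis using AZ[OF True] rc[OF True] by (simp only: indicator_simps mult_1_right ennreal_leI)
    next
      case False
      then have "indicator ?G g = (0::ennreal)" by (rule indicator_simps(2))
      then show ?thesis by (simp only: mult_zero_right zero_le)
    qed
  qed
  also have "(\<integral>\<^sup>+g. ennreal ?c * indicator ?G g \<partial>gauss n) = ennreal ?c * emeasure (gauss n) ?G"
    using Gm by (rule nn_integral_cmult_indicator)
  also have "\<dots> = ennreal (?c * measure (gauss n) ?G)"
    unfolding G.emeasure_eq_measure by (rule ennreal_mult[symmetric]) auto
  finally show ?thesis .
qed

text \<open>For a typical \<open>w\<close> the random sums in the change-of-measure bound are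
  replaced by their means. The hypothesis \<open>tx\<close> is what keeps the exponent at its
  nominal value; its price is the term
  \<open>t * (\<Sum>i<n. x i) - (\<Sum>i<n. (x i)\<^sup>2)\<close> in the distortion. By
  \<open>nl\<close> the tilted word behaves well with probability at least 1/2, whence the factor in
  front.\<close>

lemma gauss_ball_typical:
  fixes y w x :: "nat \<Rightarrow> real" and t \<delta> st :: real
  assumes y: "\<And>i. i < n \<Longrightarrow> 0 \<le> y i" and t: "0 < st" "st \<le> t" "t \<le> 2" and \<delta>: "0 < \<delta>" "\<delta> \<le> 1" and n: "n > 0"
    and nl: "24 / (n * \<delta>\<^sup>2) + 2 / n \<le> 1 / 2"
  defines "x \<equiv> \<lambda>i. y i / (1 + y i)"
  assumes w2: "(\<Sum>i<n. (w i)\<^sup>2) \<le> 2 * n"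
    and c: "(\<Sum>i<n. (x i)\<^sup>2 * (w i)\<^sup>2) \<le> (\<Sum>i<n. (x i)\<^sup>2) + n * \<delta>"
    and b: "(\<Sum>i<n. x i * (1 - x i) * (w i)\<^sup>2) \<le> (\<Sum>i<n. x i * (1 - x i)) + n * \<delta>"
    and tx: "(\<Sum>i<n. (x i)\<^sup>2) \<le> t * (\<Sum>i<n. x i)"
  shows "ennreal (exp (- (\<Sum>i<n. ln (1 + y i)) / 2 - n * \<delta> / st) / 2)
    \<le> emeasure (gauss n) {z\<in>space (gauss n). 
        (\<Sum>i<n. y i * (w i - sqrt t * z i)\<^sup>2) \<le> (\<Sum>i<n. x i) + (t * (\<Sum>i<n. x i) - (\<Sum>i<n. (x i)\<^sup>2)) + 2 * n * \<delta> \<and>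
        (\<Sum>i<n. (w i - sqrt t * z i)\<^sup>2) \<le> 12 * n}" (is "_ \<le> emeasure _ ?Z")
proof -
  interpret G: prob_space "gauss n" by (rule prob_space_gauss)
  have t0: "t > 0" using t by simp
  have x: "0 \<le> x i" "x i < 1" if "i < n" for i
    using y[OF that] by (auto simp: x_def field_simps add_nonneg_eq_0_iff)
  define \<alpha> where "\<alpha> i = - 2 * sqrt t * x i * sqrt (1 - x i) * w i" for i
  define \<beta> where "\<beta> i = t * x i" for i
  let ?G = "{g\<in>space (gauss n). \<bar>\<Sum>i<n. \<alpha> i * g i + \<beta> i * ((g i)\<^sup>2 - 1)\<bar> \<le> n * \<delta> \<and> (\<Sum>i<n. (g i)\<^sup>2 - 1) \<le> real n}"
  let ?B1 = "{g\<in>space (gauss n). n * \<delta> \<le> \<bar>\<Sum>i<n. \<alpha> i * g i + \<beta> i * ((g i)\<^sup>2 - 1)\<bar>}"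
  let ?B2 = "{g\<in>space (gauss n). real n \<le> \<bar>\<Sum>i<n. (0::real) * g i + 1 * ((g i)\<^sup>2 - 1)\<bar>}"
  \<comment> \<open>Variance of the statistic. Since \<open>t * x i \<le> 2\<close>, the linear part
    costs at most 8 times the summand of hypothesis \<open>b\<close>, in total
    \<open>16 * n\<close>, and the quadratic part at most 8 per coordinate. This is the origin of
    the 24 in \<open>nl\<close>.\<close>
  have "(\<Sum>i<n. (\<alpha> i)\<^sup>2 + 2 * (\<beta> i)\<^sup>2) \<le> (\<Sum>i<n. 8 * (x i * (1 - x i) * (w i)\<^sup>2) + 8)"
  proof (rule sum_mono)
    fix i assume i: "i \<in> {..<n}"
    have xi: "0 \<le> x i" "x i \<le> 1" using x[of i] i by auto
    have "(\<alpha> i)\<^sup>2 = 4 * (t * x i) * (x i * (1 - x i) * (w i)\<^sup>2)"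
      using t0 xi unfolding \<alpha>_def by (simp add: power_mult_distrib) (simp add: power2_eq_square)
    also have "\<dots> \<le> 8 * (x i * (1 - x i) * (w i)\<^sup>2)"
      using xi t t0 mult_mono[of t 2 "x i" 1] by (intro mult_right_mono mult_nonneg_nonneg) auto
    finally have 1: "(\<alpha> i)\<^sup>2 \<le> 8 * (x i * (1 - x i) * (w i)\<^sup>2)" .
    have "t * x i \<le> 2 * 1" using xi t t0 by (intro mult_mono) auto
    then have "(\<beta> i)\<^sup>2 \<le> 2\<^sup>2" unfolding \<beta>_def using xi t0 by (intro power_mono) auto
    then show "(\<alpha> i)\<^sup>2 + 2 * (\<beta> i)\<^sup>2 \<le> 8 * (x i * (1 - x i) * (w i)\<^sup>2) + 8" using 1 by simp
  qed
  also have "\<dots> = 8 * (\<Sum>i<n. x i * (1 - x i) * (w i)\<^sup>2) + 8 * n"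
    by (simp add: sum.distrib sum_distrib_left)
  also have "\<dots> \<le> 24 * n"
  proof -
    have "(\<Sum>i<n. x i * (1 - x i)) \<le> (\<Sum>i<n. 1)" using x 
      by (intro sum_mono mult_le_one) (auto simp: less_imp_le)
    moreover have "n * \<delta> \<le> real n * 1" using \<delta> by (intro mult_left_mono) auto
    ultimately show ?thesis using b by simp
  qed
  finally have var: "(\<Sum>i<n. (\<alpha> i)\<^sup>2 + 2 * (\<beta> i)\<^sup>2) \<le> 24 * n" .
  have "G.prob ?B1 \<le> (\<Sum>i<n. (\<alpha> i)\<^sup>2 + 2 * (\<beta> i)\<^sup>2) / (n * \<delta>)\<^sup>2"
    using n \<delta> by (intro gauss_chebyshev) auto
  also have "\<dots> \<le> 24 * n / (n * \<delta>)\<^sup>2" using var by (intro divide_right_mono) auto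
  also have "\<dots> = 24 / (n * \<delta>\<^sup>2)" using n by (simp add: power2_eq_square)
  finally have B1: "G.prob ?B1 \<le> 24 / (n * \<delta>\<^sup>2)" .
  have "G.prob ?B2 \<le> (\<Sum>i<n. (0::real)\<^sup>2 + 2 * 1\<^sup>2) / (real n)\<^sup>2"
    using n by (intro gauss_chebyshev) auto
  also have "\<dots> = 2 / n" using n by (simp add: power2_eq_square)
  finally have B2: "G.prob ?B2 \<le> 2 / n" .
  have "space (gauss n) - ?G \<subseteq> ?B1 \<union> ?B2" by auto
  then have "G.prob (space (gauss n) - ?G) \<le> G.prob (?B1 \<union> ?B2)"
    by (intro G.finite_measure_mono) measurable
  also have "\<dots> \<le> G.prob ?B1 + G.prob ?B2" by (intro measure_Un_le) measurable
  finally have "G.prob (space (gauss n) - ?G) \<le> 1 / 2" using B1 B2 nl by linarith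
  moreover have "?G \<in> sets (gauss n)" by measurable
  ultimately have G: "G.prob ?G \<ge> 1 / 2" using G.prob_compl[of ?G] by linarith
  let ?c = "exp (- (\<Sum>i<n. ln (1 + y i)) / 2 + (t * (\<Sum>i<n. x i) - (\<Sum>i<n. (x i)\<^sup>2 * (w i)\<^sup>2) - n * \<delta>) / (2 * t))"
  let ?Y = "{z\<in>space (gauss n). 
        (\<Sum>i<n. y i * (w i - sqrt t * z i)\<^sup>2) \<le> (\<Sum>i<n. x i * (1 - x i) * (w i)\<^sup>2) + t * (\<Sum>i<n. x i) + n * \<delta> \<and>
        (\<Sum>i<n. (w i - sqrt t * z i)\<^sup>2) \<le> 2 * (\<Sum>i<n. (w i)\<^sup>2) + 2 * t * (n + real n)}"
  have "exp (- (\<Sum>i<n. ln (1 + y i)) / 2 - n * \<delta> / st) \<le> ?c"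
  proof -
    have "- n * \<delta> / st \<le> - n * \<delta> / t" using t \<delta> by (simp add: frac_le)
    also have "\<dots> = (- 2 * n * \<delta>) / (2 * t)" by simp
    also have "\<dots> \<le> (t * (\<Sum>i<n. x i) - (\<Sum>i<n. (x i)\<^sup>2 * (w i)\<^sup>2) - n * \<delta>) / (2 * t)"
    proof (rule divide_right_mono)
      \<comment> \<open>One \<open>n * \<delta>\<close> comes from the typicality of
        \<open>w\<close>, the other from the fluctuation of the tilted word.\<close>
      show "- 2 * n * \<delta> \<le> t * (\<Sum>i<n. x i) - (\<Sum>i<n. (x i)\<^sup>2 * (w i)\<^sup>2) - n * \<delta>"
        using c tx by (simp add: algebra_simps)
    qed (use t0 in auto)
    finally show ?thesis by simp
  qed
  then have "exp (- (\<Sum>i<n. ln (1 + y i)) / 2 - n * \<delta> / st) * (1 / 2) \<le> ?c * G.prob ?G"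
    using G by (intro mult_mono) auto
  then have "ennreal (exp (- (\<Sum>i<n. ln (1 + y i)) / 2 - n * \<delta> / st) / 2) \<le> ennreal (?c * G.prob ?G)"
    by (intro ennreal_leI) simp
  also have "\<dots> \<le> emeasure (gauss n) ?Y"
    unfolding \<alpha>_def \<beta>_def x_def
    by (rule gauss_ball_lower_bound) (use y t0 in auto)
  also have "\<dots> \<le> emeasure (gauss n) ?Z"
  proof (rule emeasure_mono)
    have "(\<Sum>i<n. x i * (1 - x i)) = (\<Sum>i<n. x i) - (\<Sum>i<n. (x i)\<^sup>2)"
      by (simp add: algebra_simps power2_eq_square sum_subtractf)
    \<comment> \<open>Together with \<open>2 * (2 * n)\<close> from \<open>w2\<close> this gives the
      radius \<open>12 * n\<close>.\<close>
    moreover have "2 * t * (n + real n) \<le> 8 * n" using t by (simp add: mult_right_mono)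
    ultimately show "?Y \<subseteq> ?Z" using b w2 by auto
    show "?Z \<in> sets (gauss n)" by measurable
  qed
  finally show ?thesis .
qed

text \<open>Used for the source word and for the codeword alike: each may be drawn directly in the
  eigenbasis.\<close>

lemma emeasure_gauss_act:
  assumes U: "U \<in> rotations n" and P: "{w\<in>space (gauss n). P w} \<in> sets (gauss n)"
  shows "emeasure (gauss n) {w\<in>space (gauss n). P (act n U w)} = emeasure (gauss n) {w\<in>space (gauss n). P w}"
proof -
  let ?h = "indicator {w\<in>space (gauss n). P w} :: _ \<Rightarrow> ennreal"
  have m: "{w\<in>space (gauss n). P (act n U w)} \<in> sets (gauss n)"
  proof -
    have "{w\<in>space (gauss n). P (act n U w)} = act n U -` {w\<in>space (gauss n). P w} \<inter> space (gauss n)"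
      using act_in_space by auto
    then show ?thesis using measurable_sets[OF act_measurable P] by simp
  qed
  have "(\<integral>\<^sup>+w. ?h (act n U w) \<partial>gauss n) = (\<integral>\<^sup>+w. ?h w \<partial>gauss n)"
    using U P by (auto simp: rotations_def)
  moreover have "(\<integral>\<^sup>+w. ?h (act n U w) \<partial>gauss n) = (\<integral>\<^sup>+w. indicator {w\<in>space (gauss n). P (act n U w)} w \<partial>gauss n)"
    by (intro nn_integral_cong) (auto simp: indicator_def act_in_space)
  ultimately show ?thesis using P m by simp
qed

lemma act_scale: "k < n \<Longrightarrow> act n U (\<lambda>i. c * z i) k = c * act n U z k"
  by (simp add: act_def sum_distrib_left mult_ac)

lemma weighted_chi_square_tail:
  fixes \<theta> :: "nat \<Rightarrow> real"
  assumes \<theta>: "\<And>i. i < n \<Longrightarrow> 0 \<le> \<theta> i \<and> \<theta> i \<le> 1" and n: "n > 0" and \<delta>: "\<delta> > 0"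
  shows "measure (gauss n) {w\<in>space (gauss n). \<not> (\<Sum>i<n. \<theta> i * (w i)\<^sup>2) \<le> (\<Sum>i<n. \<theta> i) + n * \<delta>} \<le> 2 / (n * \<delta>\<^sup>2)"
proof -
  interpret G: prob_space "gauss n" by (rule prob_space_gauss)
  have "{w\<in>space (gauss n). \<not> (\<Sum>i<n. \<theta> i * (w i)\<^sup>2) \<le> (\<Sum>i<n. \<theta> i) + n * \<delta>}
    \<subseteq> {w\<in>space (gauss n). n * \<delta> \<le> \<bar>\<Sum>i<n. (0::real) * w i + \<theta> i * ((w i)\<^sup>2 - 1)\<bar>}"
    by (auto simp: algebra_simps sum_subtractf)
  then have "G.prob {w\<in>space (gauss n). \<not> (\<Sum>i<n. \<theta> i * (w i)\<^sup>2) \<le> (\<Sum>i<n. \<theta> i) + n * \<delta>}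
    \<le> G.prob {w\<in>space (gauss n). n * \<delta> \<le> \<bar>\<Sum>i<n. (0::real) * w i + \<theta> i * ((w i)\<^sup>2 - 1)\<bar>}"
    by (intro G.finite_measure_mono) measurable
  also have "\<dots> \<le> (\<Sum>i<n. (0::real)\<^sup>2 + 2 * (\<theta> i)\<^sup>2) / (n * \<delta>)\<^sup>2"
    using n \<delta> by (intro gauss_chebyshev) auto
  also have "\<dots> \<le> (\<Sum>i<n. 2) / (n * \<delta>)\<^sup>2"
    using \<theta> by (intro divide_right_mono sum_mono) (auto simp: power_le_one)
  also have "\<dots> = 2 / (n * \<delta>\<^sup>2)" using n by (simp add: power2_eq_square)
  finally show ?thesis .
qed

text \<open>The bound on the Euclidean distance makes the distortion stable under perturbations of \<open>S\<close>.\<close>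

definition covers :: "nat \<Rightarrow> real \<Rightarrow> real mat \<Rightarrow> (nat \<Rightarrow> real) \<Rightarrow> (nat \<Rightarrow> real) \<Rightarrow> bool" where
  "covers n D S w c \<longleftrightarrow> d_Sigma S w c \<le> n * D \<and> (\<Sum>i<n. (w i - c i)\<^sup>2) \<le> 12 * n"

text \<open>Only the grid index \<open>k\<close> and the typical set \<open>X\<close> depend on
  \<open>S\<close>; the law of \<open>z\<close> does not. The rate loss is
  \<open>\<delta> / st\<close> because the fluctuation in the exponent is divided by a variance that
  may be as small as \<open>st\<close>. The distortion loss combines the variance rounding
  \<open>st\<close> with two fluctuations \<open>\<delta>\<close>, of the source and of the
  codeword.\<close>

lemma psd_cover_probability:
  fixes S :: "real mat" and R \<delta> st :: real
  assumes R: "R > 0" and \<delta>: "0 < \<delta>" "\<delta> \<le> 1" and st: "0 < st" "st \<le> 1" and n: "n > 0" 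
    and nl: "24 / (n * \<delta>\<^sup>2) + 2 / n \<le> 1 / 2"
    and S: "S \<in> psd_mats n" "mat_trace S = real n"
  defines "D \<equiv> D_rc (spec S) R + (st + 2 * \<delta>) / (2 * R * ln 2)"
  shows "\<exists>k\<in>{1..nat \<lceil>1 / st\<rceil>}. \<exists>X\<in>sets (gauss n). 
     measure (gauss n) (space (gauss n) - X) \<le> 6 / (n * \<delta>\<^sup>2) \<and>
     (\<forall>w\<in>X. ennreal (exp (- (n * (R * ln 2 + \<delta> / st))) / 2)
        \<le> emeasure (gauss n) {z\<in>space (gauss n). covers n D S w (\<lambda>i. sqrt (k * st) * z i)})"
proof -
  interpret G: prob_space "gauss n" by (rule prob_space_gauss)
  from psd_decomposition[OF S(1)] obtain U l where U: "U \<in> rotations n" and l: "\<And>i. i < n \<Longrightarrow> 0 \<le> l i"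
    and form: "\<And>w w'. d_Sigma S w w' = (\<Sum>k<n. l k * (act n U w k - act n U w' k)\<^sup>2)"
    and sp: "spec S = image_mset l (mset_set {..<n})" and tr': "mat_trace S = (\<Sum>i<n. l i)"
    by blast
  have tr: "(\<Sum>i<n. l i) = real n" using tr' S(2) by simp
  obtain T where T: "T \<ge> 2 * R * ln 2" "T > 0" and lnT: "(\<Sum>i<n. ln (1 + l i * T)) = 2 * real n * R * ln 2"
    and DT: "real n * D_rc (spec S) R = (\<Sum>i<n. l i / (1 + l i * T))"
    using D_rc_multiset[OF l tr n R] unfolding sp by blast
  define y where "y i = l i * T" for i
  define x where "x i = y i / (1 + y i)" for i
  have y: "0 \<le> y i" if "i < n" for i using l[OF that] T by (simp add: y_def)
  have x: "0 \<le> x i" "x i < 1" if "i < n" for i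
    using y[OF that] by (auto simp: x_def field_simps add_nonneg_eq_0_iff)
  have x1: "0 \<le> x i * (1 - x i)" "x i * (1 - x i) \<le> 1" "(x i)\<^sup>2 \<le> 1" if "i < n" for i 
    using x[OF that] by (auto intro!: mult_le_one simp: power_le_one less_imp_le)
  have X0: "(\<Sum>i<n. x i) > 0"
  proof -
    obtain i where i: "i < n" "l i > 0"
      using tr n l by (metis finite_lessThan lessThan_iff linorder_not_le of_nat_0_less_iff sum_nonpos)
    then have "x i > 0" using T by (simp add: x_def y_def add_pos_nonneg)
    then show ?thesis using i x by (intro sum_pos2[of _ i]) auto
  qed
  have Xn: "(\<Sum>i<n. x i) \<le> n" using sum_mono[of "{..<n}" x "\<lambda>_. 1"] x by (auto simp: less_imp_le)
  have X2: "(\<Sum>i<n. (x i)\<^sup>2) \<le> (\<Sum>i<n. x i)"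
    using x by (intro sum_mono) (auto simp: power2_eq_square mult_left_le less_imp_le)
  define s where "s = (\<Sum>i<n. (x i)\<^sup>2) / (\<Sum>i<n. x i)"
  have s: "0 \<le> s" "s \<le> 1" using X0 X2 by (auto simp: s_def sum_nonneg)
  \<comment> \<open>The variance is rounded up: \<open>t \<ge> s\<close> is the inequality
    \<open>tx\<close> on which the rate depends, while the excess \<open>t - s \<le> st\<close> is
    paid in distortion, see \<open>tx2\<close>.\<close>
  define k where "k = max 1 (nat \<lceil>s / st\<rceil>)"
  have k1: "real k \<ge> s / st" "real k \<ge> 1" unfolding k_def by linarith+
  have k2: "real k \<le> s / st + 1" using s st unfolding k_def by (auto simp: max_def)
  have kr: "k \<in> {1..nat \<lceil>1 / st\<rceil>}"
  proof -
    have "s / st \<le> 1 / st" using s st by (simp add: divide_right_mono)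
    moreover have "1 \<le> 1 / st" using st by simp
    ultimately show ?thesis unfolding k_def
      by (auto intro!: nat_mono ceiling_mono) linarith+
  qed
  define t where "t = k * st"
  have t: "st \<le> t" "s \<le> t" "t \<le> s + st" 
    using k1 k2 st by (auto simp: t_def field_simps)
  have t2: "t \<le> 2" using t s st by simp
  have tx: "(\<Sum>i<n. (x i)\<^sup>2) \<le> t * (\<Sum>i<n. x i)" 
    using t(2) X0 by (simp add: s_def field_simps)
  have tx2: "t * (\<Sum>i<n. x i) - (\<Sum>i<n. (x i)\<^sup>2) \<le> st * n"
  proof -
    have "t * (\<Sum>i<n. x i) \<le> (s + st) * (\<Sum>i<n. x i)" using t X0 by (intro mult_right_mono) auto
    also have "\<dots> = (\<Sum>i<n. (x i)\<^sup>2) + st * (\<Sum>i<n. x i)" using X0 by (simp add: s_def distrib_right)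
    also have "st * (\<Sum>i<n. x i) \<le> st * n" using Xn st by (intro mult_left_mono) auto
    finally show ?thesis by simp
  qed
  \<comment> \<open>Typicality of the source word in the eigenbasis: \<open>P1\<close> controls the
    Euclidean radius, \<open>P2\<close> the rate and \<open>P3\<close> the distortion. All weights
    lie in the unit interval, so each fails with probability at most
    \<open>2 / (n * \<delta>\<^sup>2)\<close>.\<close>
  define P1 where "P1 u \<longleftrightarrow> (\<Sum>i<n. 1 * (u i)\<^sup>2) \<le> (\<Sum>i<n. 1) + n * \<delta>" for u :: "nat \<Rightarrow> real"
  define P2 where "P2 u \<longleftrightarrow> (\<Sum>i<n. (x i)\<^sup>2 * (u i)\<^sup>2) \<le> (\<Sum>i<n. (x i)\<^sup>2) + n * \<delta>" for u :: "nat \<Rightarrow> real"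
  define P3 where "P3 u \<longleftrightarrow> (\<Sum>i<n. x i * (1 - x i) * (u i)\<^sup>2) \<le> (\<Sum>i<n. x i * (1 - x i)) + n * \<delta>" for u :: "nat \<Rightarrow> real"
  have [measurable]: "Measurable.pred (gauss n) P1" "Measurable.pred (gauss n) P2" "Measurable.pred (gauss n) P3"
    unfolding P1_def P2_def P3_def by measurable
  define X where "X = {w\<in>space (gauss n). P1 (act n U w) \<and> P2 (act n U w) \<and> P3 (act n U w)}"
  have Xm: "X \<in> sets (gauss n)" unfolding X_def by measurable
  have "emeasure (gauss n) (space (gauss n) - X) = 
    emeasure (gauss n) {w\<in>space (gauss n). \<not> (P1 (act n U w) \<and> P2 (act n U w) \<and> P3 (act n U w))}"
    by (rule arg_cong[of _ _ "emeasure (gauss n)"]) (auto simp: X_def)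
  also have "\<dots> = emeasure (gauss n) {w\<in>space (gauss n). \<not> (P1 w \<and> P2 w \<and> P3 w)}"
    by (rule emeasure_gauss_act[OF U]) measurable
  finally have "G.prob (space (gauss n) - X) = G.prob {w\<in>space (gauss n). \<not> (P1 w \<and> P2 w \<and> P3 w)}"
    by (simp add: measure_def)
  also have "{w\<in>space (gauss n). \<not> (P1 w \<and> P2 w \<and> P3 w)} 
    = {w\<in>space (gauss n). \<not> P1 w} \<union> ({w\<in>space (gauss n). \<not> P2 w} \<union> {w\<in>space (gauss n). \<not> P3 w})" by auto
  also have "G.prob \<dots> \<le> G.prob {w\<in>space (gauss n). \<not> P1 w} + G.prob ({w\<in>space (gauss n). \<not> P2 w} \<union> {w\<in>space (gauss n). \<not> P3 w})"
    by (intro measure_Un_le) measurable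
  also have "\<dots> \<le> G.prob {w\<in>space (gauss n). \<not> P1 w} + (G.prob {w\<in>space (gauss n). \<not> P2 w} + G.prob {w\<in>space (gauss n). \<not> P3 w})"
    by (intro add_left_mono measure_Un_le) measurable
  also have "\<dots> \<le> 2 / (n * \<delta>\<^sup>2) + (2 / (n * \<delta>\<^sup>2) + 2 / (n * \<delta>\<^sup>2))"
    unfolding P1_def P2_def P3_def using x1 n \<delta>
    by (intro add_mono weighted_chi_square_tail) auto
  finally have Xp: "G.prob (space (gauss n) - X) \<le> 6 / (n * \<delta>\<^sup>2)" by simp
  have cov: "ennreal (exp (- (n * (R * ln 2 + \<delta> / st))) / 2)
        \<le> emeasure (gauss n) {z\<in>space (gauss n). covers n D S w (\<lambda>i. sqrt (k * st) * z i)}" if w: "w \<in> X" for w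
  proof -
    define u where "u = act n U w"
    have u: "P1 u" "P2 u" "P3 u" using w by (auto simp: X_def u_def)
    define Q where "Q z \<longleftrightarrow> 
        (\<Sum>i<n. y i * (u i - sqrt t * z i)\<^sup>2) \<le> (\<Sum>i<n. x i) + (t * (\<Sum>i<n. x i) - (\<Sum>i<n. (x i)\<^sup>2)) + 2 * real n * \<delta> \<and>
        (\<Sum>i<n. (u i - sqrt t * z i)\<^sup>2) \<le> 12 * real n" for z
    have Qm: "{z\<in>space (gauss n). Q z} \<in> sets (gauss n)" unfolding Q_def by measurable
    have "- (\<Sum>i<n. ln (1 + y i)) / 2 - n * \<delta> / st = - (n * (R * ln 2 + \<delta> / st))"
      unfolding y_def lnT by (simp add: algebra_simps)
    moreover have "ennreal (exp (- (\<Sum>i<n. ln (1 + y i)) / 2 - n * \<delta> / st) / 2) \<le> emeasure (gauss n) {z\<in>space (gauss n). Q z}"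
      unfolding Q_def x_def
    proof (rule gauss_ball_typical)
      show "(\<Sum>i<n. (u i)\<^sup>2) \<le> 2 * real n" 
      proof -
        have "real n * \<delta> \<le> real n * 1" using \<delta> by (intro mult_left_mono) auto
        then show ?thesis using u(1) unfolding P1_def by simp
      qed
    qed (use y st t t2 \<delta> n nl u tx in \<open>auto simp: P2_def P3_def x_def\<close>)
    moreover have "emeasure (gauss n) {z\<in>space (gauss n). Q z} = emeasure (gauss n) {z\<in>space (gauss n). Q (act n U z)}"
      by (rule emeasure_gauss_act[OF U Qm, symmetric])
    moreover have "\<dots> \<le> emeasure (gauss n) {z\<in>space (gauss n). covers n D S w (\<lambda>i. sqrt (k * st) * z i)}"
    proof (rule emeasure_mono)
      show "{z\<in>space (gauss n). covers n D S w (\<lambda>i. sqrt (k * st) * z i)} \<in> sets (gauss n)"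
      proof -
        have "dim_row S = n" using S(1) by (auto simp: psd_mats_def)
        then show ?thesis unfolding covers_def d_Sigma_def by simp measurable
      qed
      show "{z\<in>space (gauss n). Q (act n U z)} \<subseteq> {z\<in>space (gauss n). covers n D S w (\<lambda>i. sqrt (k * st) * z i)}"
      proof safe
        fix z assume z: "Q (act n U z)"
        let ?c = "\<lambda>i. sqrt (k * st) * z i"
        have c: "act n U ?c i = sqrt t * act n U z i" if "i < n" for i
          using act_scale[OF that] by (simp add: t_def)
        have "(\<Sum>i<n. (w i - ?c i)\<^sup>2) = (\<Sum>i<n. (u i - sqrt t * act n U z i)\<^sup>2)"
          using sum_power2_act_diff[OF U, of w ?c] c by (simp add: u_def)
        then have 1: "(\<Sum>i<n. (w i - ?c i)\<^sup>2) \<le> 12 * n" using z by (simp add: Q_def)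
        have "T * d_Sigma S w ?c = (\<Sum>i<n. y i * (u i - sqrt t * act n U z i)\<^sup>2)"
          unfolding form using c by (simp add: u_def y_def sum_distrib_left mult_ac)
        also have "\<dots> \<le> (\<Sum>i<n. x i) + (t * (\<Sum>i<n. x i) - (\<Sum>i<n. (x i)\<^sup>2)) + 2 * n * \<delta>"
          using z by (simp add: Q_def)
        also have "\<dots> \<le> (\<Sum>i<n. x i) + n * (st + 2 * \<delta>)" using tx2 by (simp add: algebra_simps)
        also have "(\<Sum>i<n. x i) = T * (n * D_rc (spec S) R)"
          unfolding DT by (simp add: sum_distrib_left x_def y_def mult_ac)
        finally have "d_Sigma S w ?c \<le> n * D_rc (spec S) R + n * (st + 2 * \<delta>) / T"
          using T by (simp add: field_simps)
        \<comment> \<open>The spectrum-free lower bound on \<open>T\<close> makes the loss uniform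
          over all covariance matrices.\<close>
        also have "n * (st + 2 * \<delta>) / T \<le> n * (st + 2 * \<delta>) / (2 * R * ln 2)"
          using T R st \<delta> by (intro divide_left_mono) auto
        finally have "d_Sigma S w ?c \<le> n * D" by (simp add: D_def algebra_simps)
        then show "covers n D S w ?c" using 1 by (simp add: covers_def)
      qed
    qed
    ultimately show ?thesis by simp
  qed
  show ?thesis using kr Xm Xp cov by blast
qed

section \<open>Greedy covering and the net of covariance matrices\<close>

text \<open>The averaging principle by which each codeword is chosen: if \<open>f > c\<close> held
  everywhere, the positive function \<open>f - c\<close> would have integral 0.\<close>

lemma (in prob_space) nn_integral_le_imp_exists:
  assumes [measurable]: "f \<in> borel_measurable M" and le: "(\<integral>\<^sup>+x. f x \<partial>M) \<le> c" and c: "c < \<infinity>"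
  shows "\<exists>x\<in>space M. f x \<le> c"
proof (rule ccontr)
  assume "\<not> ?thesis"
  then have gt: "\<And>x. x \<in> space M \<Longrightarrow> c < f x" by (auto simp: not_le)
  have ic: "(\<integral>\<^sup>+x. c \<partial>M) = c" by (simp add: emeasure_space_1)
  have "(\<integral>\<^sup>+x. f x - c \<partial>M) = (\<integral>\<^sup>+x. f x \<partial>M) - (\<integral>\<^sup>+x. c \<partial>M)"
    using c gt by (intro nn_integral_diff) (auto simp: emeasure_space_1 intro: less_imp_le)
  also have "\<dots> = 0" using le c by (simp add: emeasure_space_1 ennreal_minus_eq_0 diff_eq_0_ennreal)
  finally have "AE x in M. f x - c = 0" by (subst (asm) nn_integral_0_iff_AE) auto
  then have "AE x in M. False"
    by (rule AE_mp) (use gt in \<open>auto intro!: AE_I2 simp: not_le dest!: ennreal_minus_eq_0 dest: leD\<close>)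
  then show False by simp
qed

text \<open>The potential is the total uncovered mass, summed over all \<open>a\<close> in
  \<open>I\<close>. A random further codeword shrinks every uncovered part by the factor
  \<open>1 - p\<close> on average, so by linearity some codeword shrinks the whole sum by it. The
  one sum acts as a union bound over the net.\<close>

lemma greedy_cover:
  fixes Q :: "'z measure" and M :: "'x measure" and X :: "'i \<Rightarrow> 'x set" and p :: real
  assumes "prob_space Q" "prob_space M" and I: "finite I" and p: "0 \<le> p" "p \<le> 1"
    and X: "\<And>a. a \<in> I \<Longrightarrow> X a \<in> sets M"
    and cov: "\<And>a. a \<in> I \<Longrightarrow> Measurable.pred (M \<Otimes>\<^sub>M Q) (\<lambda>(x,z). cov a x z)"
    and prob: "\<And>a x. a \<in> I \<Longrightarrow> x \<in> X a \<Longrightarrow> ennreal p \<le> emeasure Q {z\<in>space Q. cov a x z}"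
  shows "\<exists>C. finite C \<and> card C \<le> m \<and> C \<subseteq> space Q \<and>
    (\<forall>a\<in>I. {x\<in>X a. \<forall>z\<in>C. \<not> cov a x z} \<in> sets M) \<and>
    (\<Sum>a\<in>I. emeasure M {x\<in>X a. \<forall>z\<in>C. \<not> cov a x z}) \<le> ennreal ((1 - p) ^ m * card I)"
proof (induction m)
  interpret M: prob_space M by fact
  case 0
  have "(\<Sum>a\<in>I. emeasure M (X a)) \<le> (\<Sum>a\<in>I. 1)"
    by (intro sum_mono M.emeasure_le_1)
  then show ?case using X by (intro exI[of _ "{}"]) (auto simp: ennreal_of_nat_eq_real_of_nat)
next
  interpret Q: prob_space Q by fact
  interpret M: prob_space M by fact
  interpret P: pair_prob_space M Q ..
  case (Suc m)
  then obtain C where C: "finite C" "card C \<le> m" "C \<subseteq> space Q" 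
    and Um: "\<And>a. a \<in> I \<Longrightarrow> {x\<in>X a. \<forall>z\<in>C. \<not> cov a x z} \<in> sets M"
    and le: "(\<Sum>a\<in>I. emeasure M {x\<in>X a. \<forall>z\<in>C. \<not> cov a x z}) \<le> ennreal ((1 - p) ^ m * card I)"
    by blast
  define U where "U a = {x\<in>X a. \<forall>z\<in>C. \<not> cov a x z}" for a
  \<comment> \<open>Indicator of the pairs in which \<open>x\<close> stays uncovered after
    \<open>z\<close> is added. Integrating over \<open>x\<close> first gives the new uncovered mass,
    over \<open>z\<close> first the factor \<open>1 - p\<close>; Fubini compares the two.\<close>
  define h where "h a x z = indicator (U a) x * (if cov a x z then 0 else 1 :: ennreal)" for a x z
  have h: "case_prod (h a) \<in> borel_measurable (M \<Otimes>\<^sub>M Q)" if a: "a \<in> I" for a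
  proof -
    note [measurable] = cov[OF a] Um[OF a, folded U_def]
    show ?thesis unfolding h_def case_prod_beta using cov[OF a] by (simp add: case_prod_beta)
  qed
  have sec: "{x\<in>U a. \<not> cov a x z} \<in> sets M" if a: "a \<in> I" and z: "z \<in> space Q" for a z
  proof -
    have "(\<lambda>x. (\<lambda>(x,z). cov a x z) (x, z)) \<in> measurable M (count_space UNIV)"
      by (rule measurable_compose[OF _ cov[OF a]]) (use z in auto)
    then have "{x\<in>space M. \<not> cov a x z} \<in> sets M" by simp
    moreover have "{x\<in>U a. \<not> cov a x z} = U a \<inter> {x\<in>space M. \<not> cov a x z}"
      using Um[OF a] sets.sets_into_space by (fastforce simp: U_def)
    ultimately show ?thesis using Um[OF a] by (auto simp: U_def)
  qed
  have he: "(\<integral>\<^sup>+x. h a x z \<partial>M) = emeasure M {x\<in>U a. \<not> cov a x z}" if "a \<in> I" "z \<in> space Q" for a z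
  proof -
    have "(\<integral>\<^sup>+x. h a x z \<partial>M) = (\<integral>\<^sup>+x. indicator {x\<in>U a. \<not> cov a x z} x \<partial>M)"
      by (intro nn_integral_cong) (auto simp: h_def indicator_def)
    then show ?thesis using sec[OF that] by simp
  qed
  have hq: "(\<integral>\<^sup>+z. h a x z \<partial>Q) \<le> ennreal (1 - p) * indicator (U a) x" if a: "a \<in> I" and xs: "x \<in> space M" for a x
  proof (cases "x \<in> U a")
    case True
    have "(\<lambda>z. (\<lambda>(x,z). cov a x z) (x, z)) \<in> measurable Q (count_space UNIV)"
      by (rule measurable_compose[OF _ cov[OF a]]) (use xs in auto)
    then have m: "{z\<in>space Q. cov a x z} \<in> sets Q" by simp
    have "(\<integral>\<^sup>+z. h a x z \<partial>Q) = (\<integral>\<^sup>+z. indicator (space Q - {z\<in>space Q. cov a x z}) z \<partial>Q)"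
      using True by (intro nn_integral_cong) (auto simp: h_def indicator_def)
    also have "\<dots> = emeasure Q (space Q - {z\<in>space Q. cov a x z})" using m by simp
    also have "\<dots> = 1 - emeasure Q {z\<in>space Q. cov a x z}"
      using m by (subst emeasure_compl) (auto simp: Q.emeasure_space_1)
    also have "\<dots> \<le> 1 - ennreal p" using prob[OF a, of x] True by (intro ennreal_minus_mono) (auto simp: U_def)
    also have "\<dots> = ennreal (1 - p)" using p by (simp add: ennreal_minus flip: ennreal_1)
    finally show ?thesis using True by simp
  qed (simp add: h_def)
  define \<phi> where "\<phi> z = (\<Sum>a\<in>I. \<integral>\<^sup>+x. h a x z \<partial>M)" for z
  have hm: "(\<lambda>z. \<integral>\<^sup>+x. h a x z \<partial>M) \<in> borel_measurable Q" if "a \<in> I" for a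
  proof (rule M.borel_measurable_nn_integral)
    show "(\<lambda>(z,x). h a x z) \<in> borel_measurable (Q \<Otimes>\<^sub>M M)"
      using measurable_pair_swap[OF h[OF that]] by (simp add: case_prod_beta')
  qed
  have \<phi>: "\<phi> \<in> borel_measurable Q" unfolding \<phi>_def[abs_def] using hm by (intro borel_measurable_sum) auto
  have "(\<integral>\<^sup>+z. \<phi> z \<partial>Q) = (\<Sum>a\<in>I. \<integral>\<^sup>+z. \<integral>\<^sup>+x. h a x z \<partial>M \<partial>Q)"
    unfolding \<phi>_def using hm by (intro nn_integral_sum) auto
  also have "\<dots> = (\<Sum>a\<in>I. \<integral>\<^sup>+x. \<integral>\<^sup>+z. h a x z \<partial>Q \<partial>M)"
    using h by (intro sum.cong refl P.Fubini') auto
  also have "\<dots> \<le> (\<Sum>a\<in>I. \<integral>\<^sup>+x. ennreal (1 - p) * indicator (U a) x \<partial>M)"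
    using hq by (intro sum_mono nn_integral_mono) auto
  also have "\<dots> = ennreal (1 - p) * (\<Sum>a\<in>I. emeasure M (U a))"
    using Um by (simp add: nn_integral_cmult_indicator U_def sum_distrib_left)
  also have "\<dots> \<le> ennreal (1 - p) * ennreal ((1 - p) ^ m * card I)"
    using le by (intro mult_left_mono) (auto simp: U_def)
  also have "\<dots> = ennreal ((1 - p) ^ Suc m * card I)"
    using p by (subst ennreal_mult[symmetric]) (auto simp: mult.assoc)
  finally obtain z where z: "z \<in> space Q" "\<phi> z \<le> ennreal ((1 - p) ^ Suc m * card I)"
    using Q.nn_integral_le_imp_exists[OF \<phi>] by force
  have Ue: "{x\<in>X a. \<forall>z'\<in>insert z C. \<not> cov a x z'} = {x\<in>U a. \<not> cov a x z}" for a
    by (auto simp: U_def)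
  have "(\<Sum>a\<in>I. emeasure M {x\<in>X a. \<forall>z'\<in>insert z C. \<not> cov a x z'}) = \<phi> z"
    unfolding \<phi>_def Ue using he z by (intro sum.cong) auto
  moreover have "card (insert z C) \<le> Suc m" using C by (simp add: card_insert_if)
  moreover have "{x\<in>X a. \<forall>z'\<in>insert z C. \<not> cov a x z'} \<in> sets M" if "a \<in> I" for a
    unfolding Ue using sec[OF that z(1)] .
  ultimately show ?case using C z by (intro exI[of _ "insert z C"]) auto
qed

section \<open>A finite net of the covariance matrices of trace n\<close>

lemma d_Sigma_nonneg: "S \<in> psd_mats n \<Longrightarrow> 0 \<le> d_Sigma S w w'"
  using psd_decomposition[of S n] by (fastforce intro!: sum_nonneg mult_nonneg_nonneg)

lemma sum_one_delta:
  fixes f :: "nat \<Rightarrow> real"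
  assumes "p < n" "\<And>j. j < n \<Longrightarrow> j \<noteq> p \<Longrightarrow> f j = 0"
  shows "(\<Sum>j<n. f j) = f p"
proof -
  have "(\<Sum>j<n. f j) = (\<Sum>j\<in>{p}. f j)"
    using assms by (intro sum.mono_neutral_right) auto
  then show ?thesis by simp
qed

text \<open>Diagonal entries are nonnegative and add up to \<open>n\<close>. Nonnegativity of the
  form at the sum and the difference of two unit vectors bounds an off-diagonal entry by the mean of
  two diagonal ones.\<close>

lemma psd_entry_bound:
  assumes S: "S \<in> psd_mats n" and tr: "mat_trace S = real n" and ij: "i < n" "j < n"
  shows "\<bar>S $$ (i,j)\<bar> \<le> n"
proof -
  have dr: "dim_row S = n" using S by (auto simp: psd_mats_def)
  have sym: "S $$ (i,j) = S $$ (j,i)" using S ij by (auto simp: psd_mats_def) (metis carrier_matD index_transpose_mat(1))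
  have diag: "0 \<le> S $$ (k,k)" if k: "k < n" for k
  proof -
    have "0 \<le> d_Sigma S (\<lambda>m. if m = k then 1 else 0) (\<lambda>_. 0)" by (rule d_Sigma_nonneg[OF S])
    also have "\<dots> = (\<Sum>j<n. (if k = k then 1 else 0) * S $$ (k,j) * (if j = k then 1 else 0))"
      unfolding d_Sigma_def dr using k by (subst sum_one_delta[of k]) auto
    also have "\<dots> = S $$ (k,k)" using k by (subst sum_one_delta[of k]) auto
    finally show ?thesis .
  qed
  have dle: "S $$ (k,k) \<le> n" if k: "k < n" for k
  proof -
    have "S $$ (k,k) \<le> (\<Sum>k<n. S $$ (k,k))"
      using diag k by (intro member_le_sum[of k _ "\<lambda>k. S $$ (k,k)"]) auto
    then show ?thesis using tr dr by (simp add: mat_trace_def)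
  qed
  show ?thesis
  proof (cases "i = j")
    case True
    then show ?thesis using diag[OF ij(1)] dle[OF ij(1)] by simp
  next
    case False
    have "0 \<le> S $$ (i,i) + 2 * s * S $$ (i,j) + s\<^sup>2 * S $$ (j,j)" for s
    proof -
      define v where "v m = (if m = i then 1 else if m = j then s else 0)" for m
      have two: "(\<Sum>m<n. f m) = f i + f j" if "\<And>m. v m = 0 \<Longrightarrow> f m = 0" for f :: "nat \<Rightarrow> real"
        using ij False that by (intro sum_two_deltas) (auto simp: v_def)
      have "0 \<le> d_Sigma S v (\<lambda>_. 0)" by (rule d_Sigma_nonneg[OF S])
      also have "\<dots> = (\<Sum>a<n. \<Sum>b<n. v a * S $$ (a,b) * v b)" by (simp add: d_Sigma_def dr)
      also have "\<dots> = (v i * S $$ (i,i) * v i + v i * S $$ (i,j) * v j) + (v j * S $$ (j,i) * v i + v j * S $$ (j,j) * v j)"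
        by (subst two, simp, subst two, simp, subst two, simp) simp
      finally show ?thesis using False sym by (simp add: v_def power2_eq_square algebra_simps)
    qed
    from this[of 1] this[of "-1"] show ?thesis using dle[OF ij(1)] dle[OF ij(2)] by auto
  qed
qed

text \<open>Each product \<open>v i * v j\<close> is at most the mean of the two squares, and every
  index occurs \<open>n\<close> times. For \<open>h = 1 / n\<^sup>2\<close> and the radius
  \<open>12 * n\<close> of \<open>covers\<close> the error is 12 in total, hence
  \<open>12 / n\<close> per coordinate.\<close>

lemma d_Sigma_perturb:
  assumes "dim_row S = n" "dim_row S' = n" and h: "\<And>i j. i < n \<Longrightarrow> j < n \<Longrightarrow> \<bar>S $$ (i,j) - S' $$ (i,j)\<bar> \<le> h"
  shows "d_Sigma S w c \<le> d_Sigma S' w c + h * n * (\<Sum>i<n. (w i - c i)\<^sup>2)"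
proof -
  define v where "v i = w i - c i" for i
  have "v i * S $$ (i,j) * v j \<le> v i * S' $$ (i,j) * v j + h / 2 * ((v i)\<^sup>2 + (v j)\<^sup>2)" if ij: "i < n" "j < n" for i j
  proof -
    have h0: "0 \<le> h" using h[OF ij] by linarith
    have "v i * S $$ (i,j) * v j - v i * S' $$ (i,j) * v j = (S $$ (i,j) - S' $$ (i,j)) * (v i * v j)"
      by (simp add: algebra_simps)
    also have "\<dots> \<le> \<bar>S $$ (i,j) - S' $$ (i,j)\<bar> * \<bar>v i * v j\<bar>" by (metis abs_ge_self abs_mult)
    also have "\<dots> \<le> h * \<bar>v i * v j\<bar>" using h[OF ij] by (intro mult_right_mono) auto
    also have "\<bar>v i * v j\<bar> \<le> ((v i)\<^sup>2 + (v j)\<^sup>2) / 2"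
      using zero_le_power2[of "\<bar>v i\<bar> - \<bar>v j\<bar>"] by (simp add: power2_diff abs_mult)
    finally show ?thesis using h0 by (simp add: mult_left_mono)
  qed
  then have "d_Sigma S w c \<le> (\<Sum>i<n. \<Sum>j<n. v i * S' $$ (i,j) * v j + h / 2 * ((v i)\<^sup>2 + (v j)\<^sup>2))"
    unfolding d_Sigma_def assms(1) v_def[symmetric] by (intro sum_mono) auto
  also have "\<dots> = d_Sigma S' w c + h / 2 * (\<Sum>i<n. \<Sum>j<n. (v i)\<^sup>2 + (v j)\<^sup>2)"
    by (simp only: d_Sigma_def assms(2) v_def[symmetric] sum.distrib sum_distrib_left distrib_left)
  also have "(\<Sum>i<n. \<Sum>j<n. (v i)\<^sup>2 + (v j)\<^sup>2) = 2 * n * (\<Sum>i<n. (v i)\<^sup>2)"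
    by (simp add: sum.distrib sum_distrib_left mult.assoc)
  finally show ?thesis by (simp add: v_def)
qed

text \<open>Each cell is represented by a near minimiser of \<open>F\<close>; for \<open>F S = D_rc (spec S) R\<close> this replaces
  any continuity of the spectrum.\<close>

lemma psd_net:
  fixes F :: "real mat \<Rightarrow> real"
  assumes n: "n > 0" and e: "e > 0" and F: "\<And>S. S \<in> psd_mats n \<Longrightarrow> mat_trace S = real n \<Longrightarrow> 0 \<le> F S"
  obtains Rep where "finite Rep" "Rep \<subseteq> {S\<in>psd_mats n. mat_trace S = real n}" "card Rep \<le> (2 * n ^ 3 + 1) ^ (n\<^sup>2)"
    "\<And>S. S \<in> psd_mats n \<Longrightarrow> mat_trace S = real n \<Longrightarrow>
      \<exists>S'\<in>Rep. (\<forall>i<n. \<forall>j<n. \<bar>S $$ (i,j) - S' $$ (i,j)\<bar> \<le> 1 / (real n)\<^sup>2) \<and> F S' \<le> F S + e"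
proof -
  define P where "P = {S\<in>psd_mats n. mat_trace S = real n}"
  \<comment> \<open>Cell of \<open>S\<close> in the grid of mesh \<open>1 / n\<^sup>2\<close>.
    Entries are at most \<open>n\<close> in absolute value, so each of the \<open>n\<^sup>2\<close>
    labels lies between \<open>- n ^ 3\<close> and \<open>n ^ 3\<close>.\<close>
  define \<kappa> where "\<kappa> S = (\<lambda>ij\<in>{..<n} \<times> {..<n}. \<lfloor>(real n)\<^sup>2 * S $$ ij\<rfloor>)" for S :: "real mat"
  define K where "K = PiE ({..<n} \<times> {..<n}) (\<lambda>_. {- int (n ^ 3)..int (n ^ 3)})"
  have fK: "finite K" unfolding K_def by (intro finite_PiE) auto
  have "card K = (2 * n ^ 3 + 1) ^ (n\<^sup>2)"
  proof -
    have "card {- int (n ^ 3)..int (n ^ 3)} = 2 * n ^ 3 + 1" by (simp add: nat_eq_iff)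
    then show ?thesis unfolding K_def by (subst card_PiE) (simp_all add: power2_eq_square)
  qed
  moreover have \<kappa>K: "\<kappa> ` P \<subseteq> K"
  proof -
    have "\<lfloor>(real n)\<^sup>2 * S $$ (i,j)\<rfloor> \<in> {- int (n ^ 3)..int (n ^ 3)}" if "S \<in> P" "i < n" "j < n" for S i j
    proof -
      have "\<bar>S $$ (i,j)\<bar> \<le> n" using that by (intro psd_entry_bound) (auto simp: P_def)
      then have "(real n)\<^sup>2 * \<bar>S $$ (i,j)\<bar> \<le> (real n)\<^sup>2 * n" by (intro mult_left_mono) auto
      then have "\<bar>(real n)\<^sup>2 * S $$ (i,j)\<bar> \<le> real (n ^ 3)" by (simp add: abs_mult power2_eq_square power3_eq_cube mult.assoc)
      then show ?thesis by (auto simp: abs_le_iff le_floor_iff floor_le_iff)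
    qed
    then show ?thesis unfolding \<kappa>_def K_def
      by (intro image_subsetI restrict_PiE_iff[THEN iffD2]) auto
  qed
  ultimately have cK: "finite (\<kappa> ` P)" "card (\<kappa> ` P) \<le> (2 * n ^ 3 + 1) ^ (n\<^sup>2)"
    using fK card_mono[OF fK \<kappa>K] finite_subset by auto
  have "\<forall>t\<in>\<kappa> ` P. \<exists>r. r \<in> P \<and> \<kappa> r = t \<and> (\<forall>S\<in>P. \<kappa> S = t \<longrightarrow> F r \<le> F S + e)"
  proof
    fix t assume t: "t \<in> \<kappa> ` P"
    let ?A = "F ` {S\<in>P. \<kappa> S = t}"
    have ne: "?A \<noteq> {}" using t by auto
    have bdd: "bdd_below ?A" using F by (intro bdd_belowI[of _ 0]) (auto simp: P_def)
    \<comment> \<open>The infimum over a cell need not be attained; the slack \<open>e\<close> makes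
      up for it.\<close>
    have "Inf ?A < Inf ?A + e" using e by simp
    then obtain a where "a \<in> ?A" "a < Inf ?A + e" using cInf_lessD[OF ne] by blast
    then obtain r where r: "r \<in> P" "\<kappa> r = t" "F r < Inf ?A + e" by auto
    have "F r \<le> F S + e" if "S \<in> P" "\<kappa> S = t" for S
      using cInf_lower[OF _ bdd, of "F S"] that r(3) by auto
    then show "\<exists>r. r \<in> P \<and> \<kappa> r = t \<and> (\<forall>S\<in>P. \<kappa> S = t \<longrightarrow> F r \<le> F S + e)" using r by blast
  qed
  from bchoice[OF this] obtain r where r: "\<And>t. t \<in> \<kappa> ` P \<Longrightarrow> r t \<in> P" "\<And>t. t \<in> \<kappa> ` P \<Longrightarrow> \<kappa> (r t) = t"
    "\<And>t S. t \<in> \<kappa> ` P \<Longrightarrow> S \<in> P \<Longrightarrow> \<kappa> S = t \<Longrightarrow> F (r t) \<le> F S + e" by blast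
  show ?thesis
  proof (rule that)
    show "finite (r ` \<kappa> ` P)" using cK by simp
    show "r ` \<kappa> ` P \<subseteq> {S\<in>psd_mats n. mat_trace S = real n}" using r(1) by (auto simp: P_def)
    show "card (r ` \<kappa> ` P) \<le> (2 * n ^ 3 + 1) ^ (n\<^sup>2)" using card_image_le[OF cK(1), of r] cK(2) by linarith
  next
    fix S assume "S \<in> psd_mats n" "mat_trace S = real n"
    then have S: "S \<in> P" "\<kappa> S \<in> \<kappa> ` P" by (auto simp: P_def)
    have "\<bar>S $$ (i,j) - r (\<kappa> S) $$ (i,j)\<bar> \<le> 1 / (real n)\<^sup>2" if "i < n" "j < n" for i j
    proof -
      have "\<kappa> S (i,j) = \<kappa> (r (\<kappa> S)) (i,j)" using r(2)[OF S(2)] by simp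
      then have "\<lfloor>(real n)\<^sup>2 * S $$ (i,j)\<rfloor> = \<lfloor>(real n)\<^sup>2 * r (\<kappa> S) $$ (i,j)\<rfloor>" using that by (simp add: \<kappa>_def)
      then have "\<bar>(real n)\<^sup>2 * S $$ (i,j) - (real n)\<^sup>2 * r (\<kappa> S) $$ (i,j)\<bar> \<le> 1" by linarith
      then have "(real n)\<^sup>2 * \<bar>S $$ (i,j) - r (\<kappa> S) $$ (i,j)\<bar> \<le> 1" 
        by (metis abs_mult abs_power2 right_diff_distrib)
      then show ?thesis using n by (simp add: field_simps)
    qed
    then show "\<exists>S'\<in>r ` \<kappa> ` P. (\<forall>i<n. \<forall>j<n. \<bar>S $$ (i,j) - S' $$ (i,j)\<bar> \<le> 1 / (real n)\<^sup>2) \<and> F S' \<le> F S + e"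
      using r(3)[OF S(2) S(1)] S by blast
  qed
qed

section \<open>Expected distortion on an exceptional set\<close>

lemma act_zero: "k < n \<Longrightarrow> act n U (\<lambda>_. 0) k = 0"
  by (simp add: act_def)

text \<open>Bounds the cost of sending the zero codeword on \<open>B\<close>. The truncation
  \<open>u\<^sup>2 \<le> A + u ^ 4 / A\<close> separates a part proportional to the probability of
  \<open>B\<close> from a part that is small for large \<open>A\<close>. The fourth moment is 3 in
  every rotated coordinate, and the eigenvalues sum to \<open>n\<close>.\<close>

lemma nn_integral_quadratic_form_le:
  assumes S: "S \<in> psd_mats n" "mat_trace S = real n" and B[measurable]: "B \<in> sets (gauss n)" and A: "A > 0"
  shows "(\<integral>\<^sup>+w. ennreal (d_Sigma S w (\<lambda>_. 0)) * indicator B w \<partial>gauss n) 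
    \<le> ennreal (n * (A * measure (gauss n) B + 3 / A))"
proof -
  interpret G: prob_space "gauss n" by (rule prob_space_gauss)
  from psd_decomposition[OF S(1)] obtain U l where U: "U \<in> rotations n" and l: "\<And>i. i < n \<Longrightarrow> 0 \<le> l i"
    and form: "\<And>w w'. d_Sigma S w w' = (\<Sum>k<n. l k * (act n U w k - act n U w' k)\<^sup>2)"
    and tr: "mat_trace S = (\<Sum>i<n. l i)"
    by blast
  have [measurable]: "(\<lambda>w. act n U w k) \<in> borel_measurable (gauss n)" if "k < n" for k
    using measurable_compose[OF act_measurable measurable_gauss_component[OF that]] .
  have m4: "(\<integral>\<^sup>+w. ennreal ((act n U w k) ^ 4) \<partial>gauss n) = 3" if k: "k < n" for k
  proof -
    have [measurable]: "(\<lambda>w. w k) \<in> borel_measurable (gauss n)" using k by measurable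
    have "(\<integral>\<^sup>+w. ennreal ((act n U w k) ^ 4) \<partial>gauss n) = (\<integral>\<^sup>+w. ennreal ((w k) ^ 4) \<partial>gauss n)"
      using U by (auto simp: rotations_def dest: bspec[where x="\<lambda>w. ennreal ((w k) ^ 4)"])
    also have "\<dots> = ennreal (\<integral>w. (w k) ^ 4 \<partial>gauss n)"
      using gauss_coordinate(1)[OF k stdn_moments(1)[of 4]] by (intro nn_integral_eq_integral) auto
    also have "(\<integral>w. (w k) ^ 4 \<partial>gauss n) = 3"
      using gauss_coordinate(2)[OF k stdn_moments(1)[of 4]] stdn_moments by simp
    finally show ?thesis by simp
  qed
  have trunc: "u\<^sup>2 \<le> A + u ^ 4 / A" for u :: real
  proof (cases "u\<^sup>2 \<le> A")
    case False
    then have "A * u\<^sup>2 \<le> u\<^sup>2 * u\<^sup>2" by (intro mult_right_mono) auto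
    then have "u\<^sup>2 \<le> u ^ 4 / A" using A by (simp add: field_simps power4_eq_xxxx power2_eq_square)
    then show ?thesis using A by simp
  next
    case True
    then show ?thesis using A by (simp add: add_increasing2)
  qed
  have pt: "ennreal (d_Sigma S w (\<lambda>_. 0)) * indicator B w 
    \<le> (\<Sum>k<n. ennreal (l k) * (ennreal A * indicator B w + ennreal (1 / A) * ennreal ((act n U w k) ^ 4)))" for w
  proof (cases "w \<in> B")
    case True
    have "d_Sigma S w (\<lambda>_. 0) = (\<Sum>k<n. l k * (act n U w k)\<^sup>2)" unfolding form by (simp add: act_zero)
    also have "\<dots> \<le> (\<Sum>k<n. l k * (A + 1 / A * (act n U w k) ^ 4))"
      using l trunc by (intro sum_mono mult_left_mono) auto
    finally have "ennreal (d_Sigma S w (\<lambda>_. 0)) \<le> ennreal (\<Sum>k<n. l k * (A + 1 / A * (act n U w k) ^ 4))"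
      by (rule ennreal_leI)
    also have "\<dots> = (\<Sum>k<n. ennreal (l k * (A + 1 / A * (act n U w k) ^ 4)))"
      using l A by (intro sum_ennreal[symmetric]) auto
    also have "\<dots> = (\<Sum>k<n. ennreal (l k) * (ennreal A * indicator B w + ennreal (1 / A) * ennreal ((act n U w k) ^ 4)))"
    proof (intro sum.cong refl)
      fix k assume "k \<in> {..<n}"
      then have lk: "0 \<le> l k" using l by simp
      have "ennreal (l k * (A + 1 / A * (act n U w k) ^ 4)) = ennreal (l k) * ennreal (A + 1 / A * (act n U w k) ^ 4)"
        using A lk by (intro ennreal_mult) auto
      also have "ennreal (A + 1 / A * (act n U w k) ^ 4) = ennreal A + ennreal (1 / A * (act n U w k) ^ 4)"
        using A by (intro ennreal_plus) auto
      also have "ennreal (1 / A * (act n U w k) ^ 4) = ennreal (1 / A) * ennreal ((act n U w k) ^ 4)"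
        using A by (intro ennreal_mult) auto
      finally show "ennreal (l k * (A + 1 / A * (act n U w k) ^ 4)) =
        ennreal (l k) * (ennreal A * indicator B w + ennreal (1 / A) * ennreal ((act n U w k) ^ 4))"
        using True by simp
    qed
    finally show ?thesis using True by simp
  qed simp
  have "(\<integral>\<^sup>+w. ennreal (d_Sigma S w (\<lambda>_. 0)) * indicator B w \<partial>gauss n)
    \<le> (\<integral>\<^sup>+w. (\<Sum>k<n. ennreal (l k) * (ennreal A * indicator B w + ennreal (1 / A) * ennreal ((act n U w k) ^ 4))) \<partial>gauss n)"
    by (intro nn_integral_mono pt)
  also have "\<dots> = (\<Sum>k<n. ennreal (l k) * (ennreal A * emeasure (gauss n) B + ennreal (1 / A) * 3))"
    by (subst nn_integral_sum, measurable, auto intro!: sum.cong simp: nn_integral_cmult nn_integral_add m4)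
  also have "\<dots> = (\<Sum>k<n. ennreal (l k) * ennreal (A * G.prob B + 3 / A))"
  proof -
    have "ennreal A * emeasure (gauss n) B + ennreal (1 / A) * 3 = ennreal (A * G.prob B) + ennreal (1 / A * 3)"
      using A by (subst (1 2) ennreal_mult) (auto simp: G.emeasure_eq_measure)
    also have "\<dots> = ennreal (A * G.prob B + 3 / A)" using A by (subst ennreal_plus[symmetric]) auto
    finally show ?thesis by simp
  qed
  also have "\<dots> = (\<Sum>k<n. ennreal (l k)) * ennreal (A * G.prob B + 3 / A)"
    by (simp add: sum_distrib_right)
  also have "(\<Sum>k<n. ennreal (l k)) = ennreal n" using l tr S(2) by (subst sum_ennreal) auto
  also have "ennreal n * ennreal (A * G.prob B + 3 / A) = ennreal (n * (A * G.prob B + 3 / A))"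
    using A by (intro ennreal_mult[symmetric]) auto
  finally show ?thesis .
qed

lemma D_rc_nonneg:
  assumes S: "S \<in> psd_mats n" "mat_trace S = real n" and n: "n > 0" and R: "R > 0"
  shows "0 \<le> D_rc (spec S) R"
proof -
  from psd_decomposition[OF S(1)] obtain l where l: "\<And>i. i < n \<Longrightarrow> 0 \<le> l i"
    and sp: "spec S = image_mset l (mset_set {..<n})" and tr: "mat_trace S = (\<Sum>i<n. l i)" by blast
  have tr': "(\<Sum>i<n. l i) = real n" using tr S(2) by simp
  obtain T where T: "T > 0" "real n * D_rc (spec S) R = (\<Sum>i<n. l i / (1 + l i * T))"
    using D_rc_multiset[OF l tr' n R] unfolding sp by blast
  have "0 \<le> (\<Sum>i<n. l i / (1 + l i * T))" using l T by (intro sum_nonneg) auto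
  then have "0 \<le> real n * D_rc (spec S) R" unfolding T(2) .
  then show ?thesis using n by (simp add: zero_le_mult_iff)
qed

section \<open>The codebook\<close>

text \<open>The loss \<open>eta\<close> is spent in four quarters: variance rounding and
  fluctuations (\<open>dist\<close>), passage to the representative of a cell, perturbation of the
  matrix entries (\<open>12 / n\<close>), and the exceptional set (\<open>small\<close>).\<close>

lemma codebook_exists:
  fixes R \<delta> st eta A :: real
  assumes R: "R > 0" and \<delta>: "0 < \<delta>" "\<delta> \<le> 1" and st: "0 < st" "st \<le> 1" and n: "n > 0" and eta: "eta > 0" and A: "A > 0"
    and nl: "24 / (n * \<delta>\<^sup>2) + 2 / n \<le> 1 / 2" "12 / n \<le> eta / 4"
    and dist: "(st + 2 * \<delta>) / (2 * R * ln 2) \<le> eta / 4"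
  defines "p \<equiv> exp (- (n * (R * ln 2 + \<delta> / st))) / 2"
  assumes small: "A * (6 / (n * \<delta>\<^sup>2) + (1 - p) ^ m * real ((2 * n ^ 3 + 1) ^ (n\<^sup>2))) + 3 / A \<le> eta / 4"
  shows "\<exists>C :: (nat \<Rightarrow> real) set. finite C \<and> C \<noteq> {} \<and> card C \<le> 1 + nat \<lceil>1 / st\<rceil> * m \<and>
    (\<forall>S\<in>psd_mats n. mat_trace S = real n \<longrightarrow>
      (\<integral>\<^sup>+w. ennreal (Min (d_Sigma S w ` C)) \<partial>gauss n) \<le> ennreal (n * (D_rc (spec S) R + eta)))"
proof -
  interpret G: prob_space "gauss n" by (rule prob_space_gauss)
  define D where "D S = D_rc (spec S) R + (st + 2 * \<delta>) / (2 * R * ln 2)" for S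
  define K where "K = nat \<lceil>1 / st\<rceil>"
  have p: "0 \<le> p" "p \<le> 1"
  proof -
    have "0 \<le> n * (R * ln 2 + \<delta> / st)" using R \<delta> st by (intro mult_nonneg_nonneg add_nonneg_nonneg) auto
    then have "exp (- (n * (R * ln 2 + \<delta> / st))) \<le> 1" by simp
    then show "p \<le> 1" unfolding p_def by linarith
  qed (simp add: p_def)
  obtain Rep where Rep: "finite Rep" "Rep \<subseteq> {S\<in>psd_mats n. mat_trace S = real n}" 
    "card Rep \<le> (2 * n ^ 3 + 1) ^ (n\<^sup>2)"
    and net: "\<And>S. S \<in> psd_mats n \<Longrightarrow> mat_trace S = real n \<Longrightarrow>
      \<exists>S'\<in>Rep. (\<forall>i<n. \<forall>j<n. \<bar>S $$ (i,j) - S' $$ (i,j)\<bar> \<le> 1 / (real n)\<^sup>2) \<and> D_rc (spec S') R \<le> D_rc (spec S) R + eta / 4"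
    by (rule psd_net[of n "eta / 4" "\<lambda>S. D_rc (spec S) R"]) (use n eta D_rc_nonneg[OF _ _ n R] in auto)
  have "\<forall>S\<in>Rep. \<exists>kX. fst kX \<in> {1..K} \<and> snd kX \<in> sets (gauss n) \<and>
     measure (gauss n) (space (gauss n) - snd kX) \<le> 6 / (n * \<delta>\<^sup>2) \<and>
     (\<forall>w\<in>snd kX. ennreal p \<le> emeasure (gauss n) {z\<in>space (gauss n). covers n (D S) S w (\<lambda>i. sqrt (real (fst kX) * st) * z i)})"
  proof
    fix S assume "S \<in> Rep"
    then have S: "S \<in> psd_mats n" "mat_trace S = real n" using Rep by auto
    from psd_cover_probability[OF R \<delta> st n nl(1) S]
    obtain k X where "k \<in> {1..K}" "X \<in> sets (gauss n)" "measure (gauss n) (space (gauss n) - X) \<le> 6 / (n * \<delta>\<^sup>2)"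
      "\<forall>w\<in>X. ennreal p \<le> emeasure (gauss n) {z\<in>space (gauss n). covers n (D S) S w (\<lambda>i. sqrt (k * st) * z i)}"
      unfolding p_def D_def K_def by blast
    then show "\<exists>kX. fst kX \<in> {1..K} \<and> snd kX \<in> sets (gauss n) \<and>
     measure (gauss n) (space (gauss n) - snd kX) \<le> 6 / (n * \<delta>\<^sup>2) \<and>
     (\<forall>w\<in>snd kX. ennreal p \<le> emeasure (gauss n) {z\<in>space (gauss n). covers n (D S) S w (\<lambda>i. sqrt (real (fst kX) * st) * z i)})"
      by (intro exI[of _ "(k, X)"]) auto
  qed
  from bchoice[OF this] obtain kX where kX: 
    "\<And>S. S \<in> Rep \<Longrightarrow> fst (kX S) \<in> {1..K}" "\<And>S. S \<in> Rep \<Longrightarrow> snd (kX S) \<in> sets (gauss n)"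
    "\<And>S. S \<in> Rep \<Longrightarrow> measure (gauss n) (space (gauss n) - snd (kX S)) \<le> 6 / (n * \<delta>\<^sup>2)"
    "\<And>S w. S \<in> Rep \<Longrightarrow> w \<in> snd (kX S) \<Longrightarrow> 
      ennreal p \<le> emeasure (gauss n) {z\<in>space (gauss n). covers n (D S) S w (\<lambda>i. sqrt (real (fst (kX S)) * st) * z i)}"
    by blast
  define \<kappa> X where "\<kappa> = fst \<circ> kX" and "X = snd \<circ> kX"
  define cov where "cov S w z \<longleftrightarrow> covers n (D S) S w (\<lambda>i. sqrt (\<kappa> S * st) * z i)" for S w z
  have \<kappa>: "\<kappa> S \<in> {1..K}" and X: "X S \<in> sets (gauss n)" and Xp: "measure (gauss n) (space (gauss n) - X S) \<le> 6 / (n * \<delta>\<^sup>2)"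
    and cv: "\<And>w. w \<in> X S \<Longrightarrow> ennreal p \<le> emeasure (gauss n) {z\<in>space (gauss n). cov S w z}" if "S \<in> Rep" for S
    using kX[OF that] by (auto simp: \<kappa>_def X_def cov_def)
  \<comment> \<open>Representatives are grouped by grid variance, because all words of one greedy
    book are scaled by the same factor. This gives \<open>K\<close> books of at most
    \<open>m\<close> words.\<close>
  define I where "I k = {S\<in>Rep. \<kappa> S = k}" for k
  have cm: "Measurable.pred (gauss n \<Otimes>\<^sub>M gauss n) (\<lambda>(w,z). cov S w z)" if "S \<in> Rep" for S
  proof -
    have dr: "dim_row S = n" using that Rep by (auto simp: psd_mats_def)
    show ?thesis unfolding cov_def covers_def d_Sigma_def dr case_prod_beta by measurable
  qed
  have "\<forall>k. \<exists>C. finite C \<and> card C \<le> m \<and> C \<subseteq> space (gauss n) \<and>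
    (\<forall>a\<in>I k. {x\<in>X a. \<forall>z\<in>C. \<not> cov a x z} \<in> sets (gauss n)) \<and>
    (\<Sum>a\<in>I k. emeasure (gauss n) {x\<in>X a. \<forall>z\<in>C. \<not> cov a x z}) \<le> ennreal ((1 - p) ^ m * card (I k))"
  proof
    fix k
    show "\<exists>C. finite C \<and> card C \<le> m \<and> C \<subseteq> space (gauss n) \<and>
    (\<forall>a\<in>I k. {x\<in>X a. \<forall>z\<in>C. \<not> cov a x z} \<in> sets (gauss n)) \<and>
    (\<Sum>a\<in>I k. emeasure (gauss n) {x\<in>X a. \<forall>z\<in>C. \<not> cov a x z}) \<le> ennreal ((1 - p) ^ m * card (I k))"
      using Rep(1) p X cm cv by (intro greedy_cover) (auto simp: I_def prob_space_gauss)
  qed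
  from choice[OF this] obtain Cc where Cc: "\<And>k. finite (Cc k)" "\<And>k. card (Cc k) \<le> m"
     "\<And>k a. a \<in> I k \<Longrightarrow> {x\<in>X a. \<forall>z\<in>Cc k. \<not> cov a x z} \<in> sets (gauss n)"
     "\<And>k. (\<Sum>a\<in>I k. emeasure (gauss n) {x\<in>X a. \<forall>z\<in>Cc k. \<not> cov a x z}) \<le> ennreal ((1 - p) ^ m * card (I k))"
    by blast
  \<comment> \<open>The zero word, the extra 1 in the size bound, is the fallback on the exceptional
    set.\<close>
  define C where "C = insert (\<lambda>_. 0) (\<Union>k\<in>{1..K}. (\<lambda>z i. sqrt (k * st) * z i) ` Cc k)"
  have fC: "finite C" unfolding C_def using Cc(1) by auto
  have "card C \<le> Suc (card (\<Union>k\<in>{1..K}. (\<lambda>z i. sqrt (k * st) * z i) ` Cc k))"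
    unfolding C_def using Cc(1) by (intro card_insert_le_m1) auto
  also have "card (\<Union>k\<in>{1..K}. (\<lambda>z i. sqrt (k * st) * z i) ` Cc k) \<le> (\<Sum>k\<in>{1..K}. card ((\<lambda>z i. sqrt (k * st) * z i) ` Cc k))"
    by (rule card_UN_le) simp
  also have "\<dots> \<le> (\<Sum>k\<in>{1..K}. m)"
    using card_image_le[OF Cc(1)] Cc(2) by (intro sum_mono) (rule order_trans)
  finally have cC: "card C \<le> 1 + K * m" by simp
  have main: "(\<integral>\<^sup>+w. ennreal (Min (d_Sigma S w ` C)) \<partial>gauss n) \<le> ennreal (n * (D_rc (spec S) R + eta))"
    if S: "S \<in> psd_mats n" "mat_trace S = real n" for S
  proof -
    from net[OF S] obtain S' where S': "S' \<in> Rep" 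
      and close: "\<And>i j. i < n \<Longrightarrow> j < n \<Longrightarrow> \<bar>S $$ (i,j) - S' $$ (i,j)\<bar> \<le> 1 / (real n)\<^sup>2"
      and DS': "D_rc (spec S') R \<le> D_rc (spec S) R + eta / 4" by blast
    define k where "k = \<kappa> S'"
    have Ik: "S' \<in> I k" "finite (I k)" "I k \<subseteq> Rep" using S' Rep(1) by (auto simp: I_def k_def)
    define B1 where "B1 = {x\<in>X S'. \<forall>z\<in>Cc k. \<not> cov S' x z}"
    define B where "B = (space (gauss n) - X S') \<union> B1"
    have B1m: "B1 \<in> sets (gauss n)" unfolding B1_def by (rule Cc(3)[OF Ik(1)])
    have Bm: "B \<in> sets (gauss n)" unfolding B_def using B1m X[OF S'] by auto
    have "emeasure (gauss n) B1 \<le> (\<Sum>a\<in>I k. emeasure (gauss n) {x\<in>X a. \<forall>z\<in>Cc k. \<not> cov a x z})"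
      unfolding B1_def using Ik by (intro member_le_sum[of S' "I k" "\<lambda>a. emeasure (gauss n) {x\<in>X a. \<forall>z\<in>Cc k. \<not> cov a x z}"]) auto
    also note Cc(4)[of k]
    finally have "G.prob B1 \<le> (1 - p) ^ m * card (I k)"
      using p by (simp add: G.emeasure_eq_measure)
    also have "\<dots> \<le> (1 - p) ^ m * real ((2 * n ^ 3 + 1) ^ (n\<^sup>2))"
    proof (intro mult_left_mono)
      have "card (I k) \<le> card Rep" by (intro card_mono Ik Rep)
      also note Rep(3)
      finally show "real (card (I k)) \<le> real ((2 * n ^ 3 + 1) ^ (n\<^sup>2))" by (simp only: of_nat_le_iff)
    qed (use p in auto)
    finally have "G.prob B1 \<le> (1 - p) ^ m * real ((2 * n ^ 3 + 1) ^ (n\<^sup>2))" .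
    moreover have "G.prob B \<le> G.prob (space (gauss n) - X S') + G.prob B1"
      unfolding B_def using B1m X[OF S'] by (intro measure_Un_le) auto
    ultimately have "G.prob B \<le> 6 / (n * \<delta>\<^sup>2) + (1 - p) ^ m * real ((2 * n ^ 3 + 1) ^ (n\<^sup>2))"
      using Xp[OF S'] by linarith
    then have "A * G.prob B + 3 / A \<le> eta / 4"
      using small A by (meson add_right_mono le_less mult_left_mono order_trans)
    then have "n * (A * G.prob B + 3 / A) \<le> n * (eta / 4)" by (intro mult_left_mono) auto
    then have tail: "(\<integral>\<^sup>+w. ennreal (d_Sigma S w (\<lambda>_. 0)) * indicator B w \<partial>gauss n) \<le> ennreal (n * (eta / 4))"
      using nn_integral_quadratic_form_le[OF S Bm A] by (meson ennreal_leI order_trans)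
    \<comment> \<open>Off the exceptional set three quarters of \<open>eta\<close> suffice; the
      fourth has gone into \<open>tail\<close>.\<close>
    let ?b = "n * (D_rc (spec S) R + 3 * eta / 4)"
    have b0: "0 \<le> ?b" using D_rc_nonneg[OF S n R] eta by simp
    have pt: "ennreal (Min (d_Sigma S w ` C)) \<le> ennreal ?b + ennreal (d_Sigma S w (\<lambda>_. 0)) * indicator B w"
      if w: "w \<in> space (gauss n)" for w
    proof (cases "w \<in> B")
      case True
      have "Min (d_Sigma S w ` C) \<le> d_Sigma S w (\<lambda>_. 0)" using fC by (intro Min_le) (auto simp: C_def)
      then have "ennreal (Min (d_Sigma S w ` C)) \<le> ennreal (d_Sigma S w (\<lambda>_. 0))" by (rule ennreal_leI)
      then show ?thesis using True by (simp add: add_increasing)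
    next
      case False
      then obtain z where z: "z \<in> Cc k" "cov S' w z" using w by (auto simp: B_def B1_def)
      define c where "c = (\<lambda>i. sqrt (k * st) * z i)"
      have c: "covers n (D S') S' w c" using z(2) by (simp add: cov_def c_def k_def)
      have cin: "c \<in> C" using z(1) \<kappa>[OF S'] by (auto simp: C_def c_def k_def)
      have "d_Sigma S w c \<le> d_Sigma S' w c + 1 / (real n)\<^sup>2 * n * (\<Sum>i<n. (w i - c i)\<^sup>2)"
        using S S' Rep close by (intro d_Sigma_perturb) (auto simp: psd_mats_def)
      also have "\<dots> \<le> n * D S' + 1 / (real n)\<^sup>2 * n * (12 * n)"
        using c by (intro add_mono mult_left_mono) (auto simp: covers_def)
      also have "1 / (real n)\<^sup>2 * n * (12 * n) = n * (12 / n)" using n by (simp add: power2_eq_square)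
      also have "n * D S' + n * (12 / n) = n * (D S' + 12 / n)" by (simp add: distrib_left)
      also have "\<dots> \<le> ?b"
      proof (intro mult_left_mono)
        show "D S' + 12 / n \<le> D_rc (spec S) R + 3 * eta / 4"
          using DS' dist nl(2) unfolding D_def by linarith
      qed simp
      finally have "d_Sigma S w c \<le> ?b" .
      moreover have "Min (d_Sigma S w ` C) \<le> d_Sigma S w c" using fC cin by (intro Min_le) auto
      ultimately have "ennreal (Min (d_Sigma S w ` C)) \<le> ennreal ?b" by (intro ennreal_leI) simp
      then show ?thesis using False by simp
    qed
    have [measurable]: "(\<lambda>w. ennreal (d_Sigma S w (\<lambda>_. 0))) \<in> borel_measurable (gauss n)"
    proof -
      have "dim_row S = n" using S by (auto simp: psd_mats_def)
      then show ?thesis unfolding d_Sigma_def by simp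
    qed
    note [measurable] = Bm
    have "(\<integral>\<^sup>+w. ennreal (Min (d_Sigma S w ` C)) \<partial>gauss n) 
      \<le> (\<integral>\<^sup>+w. ennreal ?b + ennreal (d_Sigma S w (\<lambda>_. 0)) * indicator B w \<partial>gauss n)"
      by (intro nn_integral_mono pt)
    also have "\<dots> = ennreal ?b + (\<integral>\<^sup>+w. ennreal (d_Sigma S w (\<lambda>_. 0)) * indicator B w \<partial>gauss n)"
      by (subst nn_integral_add) (auto simp: G.emeasure_space_1)
    also have "\<dots> \<le> ennreal ?b + ennreal (n * (eta / 4))" by (intro add_left_mono tail)
    also have "\<dots> = ennreal (?b + n * (eta / 4))" using b0 eta by (intro ennreal_plus[symmetric]) auto
    also have "?b + n * (eta / 4) = n * (D_rc (spec S) R + eta)" by (simp add: algebra_simps)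
    finally show ?thesis .
  qed
  show ?thesis using fC cC main unfolding K_def by (intro exI[of _ C]) (auto simp: C_def)
qed

section \<open>Asymptotics and the coding theorem\<close>

lemma tendsto_double_exp:
  fixes c :: real
  assumes c: "c > 0"
  shows "(\<lambda>n::nat. exp (- exp (c * real n) / 2) * real ((2 * n ^ 3 + 1) ^ (n\<^sup>2))) \<longlonglongrightarrow> 0"
proof -
  have "(\<lambda>n::nat. exp (- exp (c * real n) / 2) * (2 * real n ^ 3 + 1) powr (real n ^ 2)) \<longlonglongrightarrow> 0"
    using c by real_asymp
  moreover have "(2 * real n ^ 3 + 1) powr (real n ^ 2) = real ((2 * n ^ 3 + 1) ^ (n\<^sup>2))" for n :: nat
  proof -
    have "(2 * real n ^ 3 + 1) powr real (n ^ 2) = (2 * real n ^ 3 + 1) ^ (n ^ 2)"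
      by (rule powr_realpow) (simp add: add_nonneg_pos)
    then show ?thesis by (simp add: add.commute)
  qed
  ultimately show ?thesis by simp
qed

text \<open>Half of the rate slack \<open>eps\<close> enlarges the greedy books; the other half, the
  exponent \<open>b\<close> in the proof, absorbs the number \<open>k\<close> of books, the zero
  word and the rounding to an integer.\<close>

lemma eventually_codebook_fits:
  fixes R eps k :: real
  assumes R: "R > 0" and eps: "eps > 0" and k: "k \<ge> 0"
  shows "eventually (\<lambda>n::nat. 1 + k * (exp (n * (R * ln 2 + eps * ln 2 / 2)) + 1) \<le> 2 powr (n * (R + eps))) sequentially"
proof -
  define a b where "a = R * ln 2 + eps * ln 2 / 2" and "b = eps * ln 2 / 2"
  have ab: "a > 0" "b > 0" using R eps by (auto simp: a_def b_def intro!: add_pos_pos)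
  have "(\<lambda>n::nat. (1 + k) * exp (- (a + b) * real n) + k * exp (- b * real n)) \<longlonglongrightarrow> (1 + k) * 0 + k * 0"
  proof (intro tendsto_add tendsto_mult tendsto_const)
    show "(\<lambda>n::nat. exp (- (a + b) * real n)) \<longlonglongrightarrow> 0" using ab by real_asymp
    show "(\<lambda>n::nat. exp (- b * real n)) \<longlonglongrightarrow> 0" using ab by real_asymp
  qed
  then have "eventually (\<lambda>n::nat. (1 + k) * exp (- (a + b) * real n) + k * exp (- b * real n) < 1) sequentially"
    by (intro order_tendstoD(2)) auto
  then show ?thesis
  proof eventually_elim
    case (elim n)
    have "((1 + k) * exp (- (a + b) * real n) + k * exp (- b * real n)) * exp ((a + b) * real n)
      = 1 + k * (exp (n * a) + 1)"
      by (simp add: distrib_right mult.assoc flip: exp_add) (simp add: algebra_simps)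
    moreover have "((1 + k) * exp (- (a + b) * real n) + k * exp (- b * real n)) * exp ((a + b) * real n)
       \<le> 1 * exp ((a + b) * real n)" using elim by (intro mult_right_mono) auto
    moreover have "exp ((a + b) * real n) = 2 powr (n * (R + eps))"
      by (simp add: powr_def a_def b_def algebra_simps)
    ultimately show ?case by (simp add: a_def)
  qed
qed

lemma eventually_le_of_nat_divide:
  fixes c e :: real
  assumes "e > 0"
  shows "eventually (\<lambda>n::nat. c / n \<le> e) sequentially"
proof -
  have "(\<lambda>n::nat. c / n) \<longlonglongrightarrow> 0" by (rule lim_const_over_n)
  then have "eventually (\<lambda>n::nat. c / n < e) sequentially" using assms by (intro order_tendstoD(2)) auto
  then show ?thesis by eventually_elim simp
qed

lemma measure_unif01_Icc: "measure unif01 {0..1} = 1"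
  unfolding unif01_def by (simp add: measure_def emeasure_uniform_measure)

text \<open>Nearest-codeword encoding with ties broken towards the least index. This rule makes the
  encoder measurable in \<open>w\<close>, since it is decided by finitely many inequalities between
  measurable functions.\<close>

lemma minimal_index_encoder:
  fixes C :: "(nat \<Rightarrow> real) set"
  assumes C: "finite C" "C \<noteq> {}" "card C \<le> N"
  obtains f :: "(nat \<Rightarrow> real) \<Rightarrow> real mat \<Rightarrow> nat" and g :: "nat \<Rightarrow> nat \<Rightarrow> real"
  where "\<And>w S. f w S \<in> {1..N}" "\<And>w S. d_Sigma S w (g (f w S)) = Min (d_Sigma S w ` C)"
    "\<And>S n. dim_row S = n \<Longrightarrow> (\<lambda>w. f w S) \<in> measurable (gauss n) (count_space UNIV)"
proof -
  from ex_bij_betw_nat_finite_1[OF C(1)] obtain g where g: "bij_betw g {1..card C} C" by blast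
  define P where "P w S m \<longleftrightarrow> m \<in> {1..card C} \<and> (\<forall>j\<in>{1..card C}. d_Sigma S w (g m) \<le> d_Sigma S w (g j))" for w S m
  define f where "f w S = (LEAST m. P w S m)" for w S
  have gC: "g ` {1..card C} = C" using g by (simp add: bij_betw_def)
  have P: "P w S (f w S)" for w S
  proof -
    have "Min (d_Sigma S w ` C) \<in> d_Sigma S w ` C" using C by (intro Min_in) auto
    then have "Min (d_Sigma S w ` C) \<in> d_Sigma S w ` g ` {1..card C}" unfolding gC .
    then obtain m where m: "m \<in> {1..card C}" "Min (d_Sigma S w ` C) = d_Sigma S w (g m)" by blast
    have "d_Sigma S w (g m) \<le> d_Sigma S w (g j)" if "j \<in> {1..card C}" for j
      unfolding m(2)[symmetric] using that gC C(1) by (intro Min_le) auto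
    then have "P w S m" using m(1) by (simp add: P_def)
    then show ?thesis unfolding f_def by (rule LeastI)
  qed
  show ?thesis
  proof (rule that)
    show "f w S \<in> {1..N}" for w S using P[of w S] C(3) by (auto simp: P_def)
    show "d_Sigma S w (g (f w S)) = Min (d_Sigma S w ` C)" for w S
    proof (rule Min_eqI[symmetric])
      show "d_Sigma S w (g (f w S)) \<in> d_Sigma S w ` C" using P[of w S] gC by (auto simp: P_def)
      fix y assume "y \<in> d_Sigma S w ` C"
      then have "y \<in> d_Sigma S w ` g ` {1..card C}" unfolding gC .
      then show "d_Sigma S w (g (f w S)) \<le> y" using P[of w S] by (auto simp: P_def)
    qed (use C in auto)
    show "(\<lambda>w. f w S) \<in> measurable (gauss n) (count_space UNIV)" if "dim_row S = n" for S n
    proof -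
      have "(\<lambda>w. d_Sigma S w c) \<in> borel_measurable (gauss n)" for c
        unfolding d_Sigma_def that by measurable
      then have "Measurable.pred (gauss n) (\<lambda>w. d_Sigma S w c \<le> d_Sigma S w c')" for c c'
        unfolding pred_def by (intro borel_measurable_le)
      then have "Measurable.pred (gauss n) (\<lambda>w. P w S k)" for k
        unfolding P_def by (intro pred_intros_logic pred_intros_finite) auto
      then show ?thesis unfolding f_def by (rule measurable_Least)
    qed
  qed
qed

lemma one_minus_power_le_exp:
  fixes p :: real
  assumes "0 \<le> p" "p \<le> 1"
  shows "(1 - p) ^ m \<le> exp (- (p * m))"
proof -
  have "(1 - p) ^ m \<le> exp (- p) ^ m"
    using exp_ge_add_one_self[of "- p"] assms by (intro power_mono) auto
  also have "\<dots> = exp (- (p * m))" by (simp add: exp_of_nat_mult[symmetric] mult.commute)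
  finally show ?thesis .
qed

text \<open>The set of good \<open>s\<close> is all of \<open>{0..1}\<close>, so its measurability is no concern.\<close>

theorem theoremC1:
  fixes Rstar eps eta B :: real
  assumes "Rstar > 0" and "eps > 0" and "eta > 0" and "B > 0"
  shows "\<exists>n0::nat. \<forall>n\<ge>n0. \<exists>(R::real) (f :: (nat \<Rightarrow> real) \<Rightarrow> real mat \<Rightarrow> real \<Rightarrow> nat)
           (g :: nat \<Rightarrow> real \<Rightarrow> (nat \<Rightarrow> real)).
     R \<le> Rstar + eps \<and>
     (\<forall>w \<in> space (gauss n). \<forall>Sigma \<in> psd_mats n. \<forall>s \<in> {0..1}.
         f w Sigma s \<in> {1..nat \<lfloor>2 powr (real n * R)\<rfloor>}) \<and>
     (\<forall>Sigma \<in> psd_mats n. \<forall>s \<in> {0..1}.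
         (\<lambda>w. f w Sigma s) \<in> measurable (gauss n) (count_space UNIV)) \<and>
     (\<forall>Sigma \<in> psd_mats n. mat_trace Sigma = real n \<longrightarrow>
        measure unif01
          {s \<in> {0..1}. (\<integral>\<^sup>+ w. ennreal (d_Sigma Sigma w (g (f w Sigma s) s)) \<partial>gauss n)
                         \<le> ennreal (real n * (D_rc (spec Sigma) Rstar + eta))}
        \<ge> 1 - exp (- (real n powr B)))"
proof -
  \<comment> \<open>The size of a book has exponent \<open>a = Rstar * ln 2 + 2 * \<gamma>\<close>,
    while \<open>\<delta> \<le> st * \<gamma>\<close> keeps the covering exponent below
    \<open>Rstar * ln 2 + \<gamma>\<close>. The expected number of covering words
    \<open>p n * m n\<close> is therefore at least \<open>exp (\<gamma> * n) / 2\<close>.\<close>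
  define \<gamma> where "\<gamma> = eps * ln 2 / 4"
  \<comment> \<open>The bounds on \<open>st\<close> and \<open>\<delta>\<close> each contribute at
    most half of \<open>eta / 4\<close> in \<open>dist\<close>, after division by
    \<open>2 * Rstar * ln 2\<close>.\<close>
  define st where "st = min 1 (eta * Rstar * ln 2 / 4)"
  define \<delta> where "\<delta> = min 1 (min (eta * Rstar * ln 2 / 8) (st * \<gamma>))"
  \<comment> \<open>With this value \<open>3 / A = eta / 8\<close>, half of the quarter allotted to
    the exceptional set; the other half is reached for large \<open>n\<close>.\<close>
  define A where "A = 24 / eta"
  define K where "K = nat \<lceil>1 / st\<rceil>"
  define a where "a = Rstar * ln 2 + eps * ln 2 / 2"
  define m where "m n = nat \<lceil>exp (real n * a)\<rceil>" for n :: nat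
  define p where "p n = exp (- (real n * (Rstar * ln 2 + \<delta> / st))) / 2" for n :: nat
  have \<gamma>: "\<gamma> > 0" using assms by (simp add: \<gamma>_def)
  have st: "0 < st" "st \<le> 1" "st \<le> eta * Rstar * ln 2 / 4" using assms by (auto simp: st_def)
  have \<delta>: "0 < \<delta>" "\<delta> \<le> 1" "\<delta> \<le> eta * Rstar * ln 2 / 8" "\<delta> \<le> st * \<gamma>" 
    using assms st \<gamma> by (auto simp: \<delta>_def)
  have A: "A > 0" "3 / A = eta / 8" using assms by (auto simp: A_def)
  have dist: "(st + 2 * \<delta>) / (2 * Rstar * ln 2) \<le> eta / 4"
  proof -
    have "eta / 4 * (2 * Rstar * ln 2) = eta * Rstar * ln 2 / 4 + 2 * (eta * Rstar * ln 2 / 8)" by simp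
    then have "st + 2 * \<delta> \<le> eta / 4 * (2 * Rstar * ln 2)" using st(3) \<delta>(3) by linarith
    moreover have "0 < 2 * Rstar * ln 2" using assms by simp
    ultimately show ?thesis by (simp only: pos_divide_le_eq)
  qed
  have p: "0 \<le> p n" "p n \<le> 1" for n
  proof -
    have "0 \<le> n * (Rstar * ln 2 + \<delta> / st)" using assms \<delta> st by (intro mult_nonneg_nonneg add_nonneg_nonneg) auto
    then have "exp (- (n * (Rstar * ln 2 + \<delta> / st))) \<le> 1" by simp
    then show "p n \<le> 1" unfolding p_def by linarith
  qed (simp add: p_def)
  have miss: "(1 - p n) ^ m n \<le> exp (- exp (\<gamma> * n) / 2)" for n
  proof -
    have "exp (\<gamma> * n) / 2 \<le> p n * exp (n * a)"
    proof -
      have "\<delta> / st \<le> \<gamma>" using \<delta>(4) st(1) by (simp add: divide_le_eq mult.commute)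
      then have "n * (\<delta> / st) \<le> n * \<gamma>" by (intro mult_left_mono) auto
      moreover have "- (n * (Rstar * ln 2 + \<delta> / st)) + n * a = 2 * (n * \<gamma>) - n * (\<delta> / st)"
        by (simp add: a_def \<gamma>_def algebra_simps)
      ultimately have "\<gamma> * n \<le> - (n * (Rstar * ln 2 + \<delta> / st)) + n * a"
        by (simp only: mult.commute[of \<gamma>])
      then have "exp (\<gamma> * n) \<le> exp (- (n * (Rstar * ln 2 + \<delta> / st))) * exp (n * a)"
        by (simp flip: exp_add)
      then show ?thesis by (simp add: p_def)
    qed
    also have "\<dots> \<le> p n * m n" unfolding m_def using p by (intro mult_left_mono real_nat_ceiling_ge)
    finally have "exp (- (p n * m n)) \<le> exp (- exp (\<gamma> * n) / 2)" by simp
    then show ?thesis using one_minus_power_le_exp[OF p(1,2), of n "m n"] by linarith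
  qed
  have ev0: "eventually (\<lambda>n::nat. n > 0) sequentially" by (rule eventually_gt_at_top)
  have ev1: "eventually (\<lambda>n::nat. (24 / \<delta>\<^sup>2 + 2) / n \<le> 1 / 2) sequentially"
    by (rule eventually_le_of_nat_divide) simp
  have ev2: "eventually (\<lambda>n::nat. 12 / n \<le> eta / 4) sequentially"
    by (rule eventually_le_of_nat_divide) (use assms in simp)
  have "(\<lambda>n::nat. A * ((6 / \<delta>\<^sup>2) / n + exp (- exp (\<gamma> * real n) / 2) * real ((2 * n ^ 3 + 1) ^ (n\<^sup>2)))) \<longlonglongrightarrow> A * (0 + 0)"
    by (intro tendsto_mult tendsto_add tendsto_const lim_const_over_n tendsto_double_exp[OF \<gamma>])
  then have ev3: "eventually (\<lambda>n::nat. A * ((6 / \<delta>\<^sup>2) / n + exp (- exp (\<gamma> * real n) / 2) * real ((2 * n ^ 3 + 1) ^ (n\<^sup>2))) < eta / 8) sequentially"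
    using assms by (intro order_tendstoD(2)) auto
  have ev4: "eventually (\<lambda>n::nat. 1 + real K * (exp (n * (Rstar * ln 2 + eps * ln 2 / 2)) + 1) \<le> 2 powr (n * (Rstar + eps))) sequentially"
    using assms by (intro eventually_codebook_fits) auto
  have "eventually (\<lambda>n::nat. \<exists>(R::real) (f :: (nat \<Rightarrow> real) \<Rightarrow> real mat \<Rightarrow> real \<Rightarrow> nat)
           (g :: nat \<Rightarrow> real \<Rightarrow> (nat \<Rightarrow> real)).
     R \<le> Rstar + eps \<and>
     (\<forall>w \<in> space (gauss n). \<forall>Sigma \<in> psd_mats n. \<forall>s \<in> {0..1}.
         f w Sigma s \<in> {1..nat \<lfloor>2 powr (real n * R)\<rfloor>}) \<and>
     (\<forall>Sigma \<in> psd_mats n. \<forall>s \<in> {0..1}.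
         (\<lambda>w. f w Sigma s) \<in> measurable (gauss n) (count_space UNIV)) \<and>
     (\<forall>Sigma \<in> psd_mats n. mat_trace Sigma = real n \<longrightarrow>
        measure unif01
          {s \<in> {0..1}. (\<integral>\<^sup>+ w. ennreal (d_Sigma Sigma w (g (f w Sigma s) s)) \<partial>gauss n)
                         \<le> ennreal (real n * (D_rc (spec Sigma) Rstar + eta))}
        \<ge> 1 - exp (- (real n powr B)))) sequentially"
    using ev0 ev1 ev2 ev3 ev4
  proof eventually_elim
    case (elim n)
    have nl: "24 / (n * \<delta>\<^sup>2) + 2 / n \<le> 1 / 2"
      using elim(2) by (simp add: add_divide_distrib mult.commute)
    have "A * (6 / (n * \<delta>\<^sup>2) + (1 - p n) ^ m n * real ((2 * n ^ 3 + 1) ^ (n\<^sup>2))) 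
      \<le> A * ((6 / \<delta>\<^sup>2) / n + exp (- exp (\<gamma> * real n) / 2) * real ((2 * n ^ 3 + 1) ^ (n\<^sup>2)))"
      using A(1) miss[of n] by (intro mult_left_mono add_mono mult_right_mono) (auto simp: mult.commute)
    then have small: "A * (6 / (n * \<delta>\<^sup>2) + (1 - p n) ^ m n * real ((2 * n ^ 3 + 1) ^ (n\<^sup>2))) + 3 / A \<le> eta / 4"
      using elim(4) A(2) by linarith
    from codebook_exists[OF assms(1) \<delta>(1,2) st(1,2) elim(1) assms(3) A(1) nl elim(3) dist small[unfolded p_def]]
    obtain C :: "(nat \<Rightarrow> real) set" where C: "finite C" "C \<noteq> {}" "card C \<le> 1 + K * m n"
      and good: "\<And>S. S \<in> psd_mats n \<Longrightarrow> mat_trace S = real n \<Longrightarrow>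
        (\<integral>\<^sup>+w. ennreal (Min (d_Sigma S w ` C)) \<partial>gauss n) \<le> ennreal (n * (D_rc (spec S) Rstar + eta))"
      unfolding K_def by blast
    define N where "N = nat \<lfloor>2 powr (real n * (Rstar + eps))\<rfloor>"
    have "0 \<le> \<lceil>exp (n * a)\<rceil>" using exp_gt_zero[of "n * a"] by linarith
    then have "real (m n) \<le> exp (n * a) + 1" unfolding m_def by (simp add: ceiling_correct less_imp_le)
    then have "real K * real (m n) \<le> real K * (exp (n * a) + 1)" by (intro mult_left_mono) auto
    then have "real (1 + K * m n) \<le> 2 powr (real n * (Rstar + eps))" using elim(5) by (simp add: a_def)
    then have "1 + K * m n \<le> N" unfolding N_def by (simp add: le_nat_floor del: of_nat_add of_nat_mult)
    then have cN: "card C \<le> N" using C(3) by simp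
    from minimal_index_encoder[OF C(1,2) cN] obtain f g where f: "\<And>w S. f w S \<in> {1..N}" 
      and fg: "\<And>w S. d_Sigma S w (g (f w S)) = Min (d_Sigma S w ` C)"
      and fm: "\<And>S. dim_row S = n \<Longrightarrow> (\<lambda>w. f w S) \<in> measurable (gauss n) (count_space UNIV)"
      by metis
    have "1 - exp (- (real n powr B)) \<le> measure unif01
          {s \<in> {0..1}. (\<integral>\<^sup>+ w. ennreal (d_Sigma S w (g (f w S))) \<partial>gauss n)
                         \<le> ennreal (real n * (D_rc (spec S) Rstar + eta))}"
      if S: "S \<in> psd_mats n" "mat_trace S = real n" for S
    proof -
      have "{s \<in> {0..1::real}. (\<integral>\<^sup>+ w. ennreal (d_Sigma S w (g (f w S))) \<partial>gauss n)
                         \<le> ennreal (real n * (D_rc (spec S) Rstar + eta))} = {0..1}"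
        unfolding fg using good[OF S] by auto
      then show ?thesis by (simp add: measure_unif01_Icc)
    qed
    moreover have "(\<lambda>w. f w S) \<in> measurable (gauss n) (count_space UNIV)" if "S \<in> psd_mats n" for S
      using that by (intro fm) (auto simp: psd_mats_def)
    ultimately show ?case using f unfolding N_def
      by (intro exI[of _ "Rstar + eps"] exI[of _ "\<lambda>w S _. f w S"] exI[of _ "\<lambda>k _. g k"]) auto
  qed
  then show ?thesis unfolding eventually_sequentially .
qed

end
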